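(* Let $t>0$. Let $B=\{B_s\}_{s\ge 0}$ be a standard one-dimensional Brownian motion (started at $0$) and let $L=\{L_s\}_{s\ge 0}$ be its local time process at $0$. Let $\mathbf{B}=\{\mathbf{B}_s=(B^1_s,B^2_s,B^3_s)\}_{s\ge 0}$ be a standard three-dimensional Brownian motion (started at the origin). Then the two-dimensional process $$\bigl(|B_s|+L_s,\ |B_s|\bigr),\quad 0\le s\le t,$$ is identical in law with the process $$\Bigl(|\mathbf{B}_s|,\ |\mathbf{B}_s|-\min\Bigl\{\min_{s\le u\le t}|\mathbf{B}_u|,\ |\mathbf{B}_t|-|B^1_t|\Bigr\}\Bigr),\quad 0\le s\le t.$$
   Context: $|\cdot|$ denotes the absolute value on $\mathbb{R}$ and the Euclidean norm on $\mathbb{R}^3$. A standard three-dimensional Brownian motion started at the origin is a triple of independent standard one-dimensional Brownian motions $B^1,B^2,B^3$ started at $0$. The local time at $0$ has the standard (semimartingale) normalization: almost surely, $L_s=\lim_{\epsilon\downarrow0}\frac{1}{2\epsilon}\int_0^s\mathbf{1}_{(-\epsilon,\epsilon)}(B_u)\,du$ for all $s\ge0$, $L$ being continuous. "Identical in law" means equality of laws as continuous processes, i.e. as random elements of $C([0,t];\mathbb{R}^2)$. *)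

theory Defs
  imports "HOL-Probability.Probability"
begin

text \<open>Processes are functions of a real time parameter; only times \<open>s \<ge> 0\<close> matter.\<close>

definition continuous_process ::
    "'a measure \<Rightarrow> (real \<Rightarrow> 'a \<Rightarrow> 'b::{second_countable_topology, real_normed_vector}) \<Rightarrow> bool" where
  "continuous_process M X \<longleftrightarrow>
     prob_space M \<and>
     (\<forall>s\<ge>0. X s \<in> borel_measurable M) \<and>
     (\<forall>\<omega>\<in>space M. continuous_on {0..} (\<lambda>s. X s \<omega>))"

definition standard_BM :: "'a measure \<Rightarrow> (real \<Rightarrow> 'a \<Rightarrow> real) \<Rightarrow> bool" where
  "standard_BM M B \<longleftrightarrow>
     continuous_process M B \<and>
     (AE \<omega> in M. B 0 \<omega> = 0) \<and>
     (\<forall>(n::nat) (\<tau>::nat \<Rightarrow> real). 0 \<le> \<tau> 0 \<and> mono_on {..n} \<tau> \<longrightarrow>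
        prob_space.indep_vars M (\<lambda>_. borel) (\<lambda>i \<omega>. B (\<tau> (Suc i)) \<omega> - B (\<tau> i) \<omega>) {..<n}) \<and>
     (\<forall>s u. 0 \<le> s \<and> s < u \<longrightarrow>
        distributed M lborel (\<lambda>\<omega>. B u \<omega> - B s \<omega>) (normal_density 0 (sqrt (u - s))))"

text \<open>The three coordinate processes are independent as random elements of the product
  space \<open>\<real>\<^bsup>[0,\<infinity>)\<^esup>\<close>, i.e. the sigma-algebras they generate are independent.\<close>

definition standard_BM3 :: "'a measure \<Rightarrow> (real \<Rightarrow> 'a \<Rightarrow> real ^ 3) \<Rightarrow> bool" where
  "standard_BM3 M W \<longleftrightarrow>
     (\<forall>i. standard_BM M (\<lambda>s \<omega>. W s \<omega> $ i)) \<and>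
     prob_space.indep_vars M (\<lambda>_. PiM {0..} (\<lambda>_. borel))
       (\<lambda>i \<omega>. \<lambda>s\<in>{0..}. W s \<omega> $ i) UNIV"

text \<open>Semimartingale normalization: occupation time of \<open>(-\<epsilon>, \<epsilon>)\<close> divided by \<open>2\<epsilon>\<close>. The exceptional
  null set is the same for all times \<open>s\<close>.\<close>

definition local_time_at_0 ::
    "'a measure \<Rightarrow> (real \<Rightarrow> 'a \<Rightarrow> real) \<Rightarrow> (real \<Rightarrow> 'a \<Rightarrow> real) \<Rightarrow> bool" where
  "local_time_at_0 M B L \<longleftrightarrow>
     continuous_process M L \<and>
     (AE \<omega> in M. \<forall>s\<ge>0.
        ((\<lambda>\<epsilon>. 1 / (2 * \<epsilon>) * (LINT u:{0..s}|lborel. indicat_real {-\<epsilon><..<\<epsilon>} (B u \<omega>)))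
           \<longlongrightarrow> L s \<omega>) (at_right 0))"

text \<open>The space \<open>C([0,t]; E)\<close> with the Borel sigma-algebra of the supremum metric. Its elements are
  continuous functions on \<open>[0,t]\<close>, represented as extensional functions (\<open>undefined\<close> elsewhere).\<close>

definition path_metric :: "real \<Rightarrow> (real \<Rightarrow> 'b::real_normed_vector) metric" where
  "path_metric t = cfunspace (top_of_set {0..t}) euclidean_metric"

definition path_space :: "real \<Rightarrow> (real \<Rightarrow> 'b::real_normed_vector) measure" where
  "path_space t = sigma (mspace (path_metric t)) {U. openin (mtopology_of (path_metric t)) U}"

definition path_map :: "real \<Rightarrow> (real \<Rightarrow> 'a \<Rightarrow> 'b) \<Rightarrow> 'a \<Rightarrow> real \<Rightarrow> 'b" where
  "path_map t X \<omega> = (\<lambda>s\<in>{0..t}. X s \<omega>)"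

text \<open>Measurability is part of the definition because \<^const>\<open>distr\<close> is only meaningful for
  measurable maps; it also forces every path to be continuous on \<open>[0,t]\<close>.\<close>

definition identical_in_law ::
    "real \<Rightarrow> 'a measure \<Rightarrow> (real \<Rightarrow> 'a \<Rightarrow> 'c::real_normed_vector) \<Rightarrow>
      'b measure \<Rightarrow> (real \<Rightarrow> 'b \<Rightarrow> 'c) \<Rightarrow> bool" where
  "identical_in_law t M X N Y \<longleftrightarrow>
     path_map t X \<in> M \<rightarrow>\<^sub>M path_space t \<and>
     path_map t Y \<in> N \<rightarrow>\<^sub>M path_space t \<and>
     distr M (path_space t) (path_map t X) = distr N (path_space t) (path_map t Y)"

end

theory Submission
  imports Defs
begin

text \<open>For real \<open>\<xi>\<close> and \<open>k > 0\<close> put \<open>F(x, l) = exp (-k l) (\<xi> cos (\<xi> x) + k sin (\<xi> x))\<close>; this is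
  \<open>pitman_fun\<close>. It satisfies \<open>F\<^sub>x\<^sub>x = -\<xi>\<^sup>2 F\<close>, and \<open>F\<^sub>x + F\<^sub>l = 0\<close> on the line \<open>x = 0\<close>.

  The proof compares the pair \<open>(X, L) = (\<bar>B\<bar>, L)\<close> with the pair
  \<open>(X, L) = (\<bar>W\<^sup>1\<bar>, \<bar>W\<bar> - \<bar>W\<^sup>1\<bar>)\<close>. In both cases \<open>exp (\<xi>\<^sup>2 s / 2) F(X s, L s)\<close> is a martingale
  relative to the past of the sum process \<open>X + L\<close>, which is \<open>\<bar>B\<bar> + L\<close> and \<open>\<bar>W\<bar>\<close> respectively
  (\<open>pitman_martingale\<close>, \<open>bessel_martingale\<close>). The functions \<open>F\<close> determine the law of a pair of
  nonnegative random variables with integrable first component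
  (\<open>pitman_fun_determines_law\<close>). So the joint law of \<open>(X m, L m)\<close> and
  finitely many values of \<open>X + L\<close> before time \<open>m\<close> determines the joint law of \<open>(X u, L u)\<close> and these
  values for every later \<open>u\<close>; by induction over the times, the process \<open>X + L\<close> on \<open>[0, t]\<close> together
  with the final value \<open>L t\<close> has the same law in both cases (\<open>pitman_pair_observations\<close>).

  Both processes of the theorem are the same function of these data. For \<open>W\<close> this is
  how the process is written. For \<open>B\<close> the local time is nondecreasing and constant on intervals
  without zeros of \<open>B\<close>, whence \<open>L s\<close> is the minimum of \<open>L t\<close> and of the smallest value of
  \<open>\<bar>B\<bar> + L\<close> on \<open>[s, t]\<close> (\<open>growth_at_zeros_eq_future_min\<close>).

  With stochastic calculus the martingale property for \<open>B\<close> is the formula of Ito and Tanaka. Here it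
  comes from elementary Gaussian estimates: the local time is approximated by integrals
  \<open>\<integral>\<^sub>0\<^sup>s c (B v) dv\<close> with a continuous bump \<open>c\<close>, and \<open>sin (\<xi> \<bar>x\<bar>)\<close> by a solution of
  \<open>\<Psi>'' + \<xi>\<^sup>2 \<Psi> = 2 \<xi> c\<close>. A Feynman-Kac formula (\<open>feynman_kac_derivative\<close>) then gives a differential
  equation for the expectation, up to an error that tends to \<open>0\<close> with the width of the bump.

  For \<open>W\<close>, the law of \<open>W m\<close> given the past of \<open>\<bar>W\<bar>\<close> is invariant under rotations, so that
  \<open>\<bar>W\<^sup>1 m\<bar> / \<bar>W m\<bar>\<close> is uniform on \<open>[0, 1]\<close> by the theorem of Archimedes on the sphere. Averaging
  \<open>F (r v, r - r v)\<close> over \<open>v \<in> [0, 1]\<close> gives \<open>sin (\<xi> r) / r\<close>, and averaging \<open>\<xi> cos (\<xi> r v)\<close> gives the same.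
  Hence \<open>F\<close> may be replaced by \<open>\<xi> cos (\<xi> W\<^sup>1)\<close>, whose martingale property is the characteristic
  function of a Gaussian increment.\<close>


section \<open>Laws on the space of continuous paths\<close>

lemma mspace_path_metric:
  "mspace (path_metric t :: (real \<Rightarrow> 'b::real_normed_vector) metric) =
     {f \<in> extensional {0..t}. continuous_on {0..t} f}"
proof -
  have *: "compactin (top_of_set {0..t}) (topspace (top_of_set {0..t}))"
    by (simp add: compactin_subtopology)
  show ?thesis
    unfolding path_metric_def
    by (subst compactin_mspace_cfunspace[OF *]) (auto simp: extensional_def)
qed

lemma path_metric_dist_le:
  assumes "t \<ge> 0" "f \<in> mspace (path_metric t)" "g \<in> mspace (path_metric t)"
  shows "mdist (path_metric t) f g \<le> a \<longleftrightarrow> (\<forall>s\<in>{0..t}. dist (f s) (g s) \<le> a)"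
  using assms unfolding path_metric_def by (subst cfunspace_mdist_le) auto

lemma space_path_space: "space (path_space t) = mspace (path_metric t)"
  unfolding path_space_def
  by (rule space_measure_of) (metis Pow_iff mem_Collect_eq openin_subset subsetI topspace_mtopology_of)

lemma sets_path_space:
  "sets (path_space t) = sigma_sets (mspace (path_metric t)) {U. openin (mtopology_of (path_metric t)) U}"
  unfolding path_space_def
  by (rule sets_measure_of) (metis Pow_iff mem_Collect_eq openin_subset subsetI topspace_mtopology_of)

text \<open>Rational coefficients leave countably many candidates, which makes the path space separable.\<close>

lemma Bernstein_approx_rational:
  fixes f :: "real \<Rightarrow> real"
  assumes "t > 0" "continuous_on {0..t} f" "e > 0"
  shows "\<exists>N. \<forall>n\<ge>N. \<exists>q::rat list. length q = Suc n \<and>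
    (\<forall>s\<in>{0..t}. \<bar>f s - (\<Sum>k\<le>n. of_rat (q ! k) * Bernstein n k (s / t))\<bar> \<le> e)"
proof -
  have "continuous_on {0..1} (\<lambda>x. f (t * x))"
    by (rule continuous_on_compose2[OF assms(2)])
       (use \<open>t > 0\<close> in \<open>auto intro!: continuous_intros simp: mult_left_le\<close>)
  from Bernstein_Weierstrass[OF this, of "e/2"] \<open>e > 0\<close> obtain N where
    N: "\<And>n x. N \<le> n \<Longrightarrow> x \<in> {0..1} \<Longrightarrow> \<bar>f (t*x) - (\<Sum>k\<le>n. f (t * (k/n)) * Bernstein n k x)\<bar> < e/2"
    by auto
  show ?thesis
  proof (intro exI[of _ N] allI impI)
    fix n assume "N \<le> n"
    have "\<forall>k. \<exists>r::rat. \<bar>f (t * (real k / real n)) - of_rat r\<bar> < e/2"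
    proof
      fix k
      obtain r where "r \<in> \<rat>" "f (t * (real k / real n)) - e/2 < r" "r < f (t * (real k / real n)) + e/2"
        using Rats_dense_in_real[of "f (t * (real k / real n)) - e/2" "f (t * (real k / real n)) + e/2"] \<open>e>0\<close>
        by auto
      then show "\<exists>r::rat. \<bar>f (t * (real k / real n)) - of_rat r\<bar> < e/2"
        by (elim Rats_cases) (smt (verit, ccfv_SIG))
    qed
    then obtain r :: "nat \<Rightarrow> rat" where r: "\<And>k. \<bar>f (t * (real k / real n)) - of_rat (r k)\<bar> < e/2" by metis
    define q where "q = map r [0..<Suc n]"
    show "\<exists>q::rat list. length q = Suc n \<and>
      (\<forall>s\<in>{0..t}. \<bar>f s - (\<Sum>k\<le>n. of_rat (q ! k) * Bernstein n k (s / t))\<bar> \<le> e)"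
    proof (intro exI[of _ q] conjI ballI)
      show "length q = Suc n" by (simp add: q_def)
      fix s assume s: "s \<in> {0..t}"
      have x: "s/t \<in> {0..1}" using s \<open>t>0\<close> by auto
      have qk: "q ! k = r k" if "k \<le> n" for k using that unfolding q_def
        by (metis add_0 diff_zero le_imp_less_Suc length_upt nth_map nth_upt)
      have "\<bar>(\<Sum>k\<le>n. f (t * (k/n)) * Bernstein n k (s/t)) - (\<Sum>k\<le>n. of_rat (q ! k) * Bernstein n k (s / t))\<bar>
        = \<bar>\<Sum>k\<le>n. (f (t * (k/n)) - of_rat (r k)) * Bernstein n k (s/t)\<bar>"
        by (simp add: sum_subtractf left_diff_distrib qk)
      also have "\<dots> \<le> (\<Sum>k\<le>n. \<bar>(f (t * (k/n)) - of_rat (r k)) * Bernstein n k (s/t)\<bar>)" by (rule sum_abs)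
      also have "\<dots> \<le> (\<Sum>k\<le>n. e/2 * Bernstein n k (s/t))"
        using x unfolding abs_mult
        by (intro sum_mono mult_mono less_imp_le[OF r]) (auto simp: Bernstein_nonneg \<open>e > 0\<close> less_imp_le)
      also have "\<dots> = e/2" by (simp only: sum_distrib_left[symmetric] sum_Bernstein mult_1_right)
      finally have "\<bar>(\<Sum>k\<le>n. f (t * (k/n)) * Bernstein n k (s/t)) - (\<Sum>k\<le>n. of_rat (q ! k) * Bernstein n k (s / t))\<bar> \<le> e/2" .
      moreover have "\<bar>f s - (\<Sum>k\<le>n. f (t * (k/n)) * Bernstein n k (s/t))\<bar> < e/2"
        using N[OF \<open>N \<le> n\<close> x] \<open>t>0\<close> by simp
      ultimately show "\<bar>f s - (\<Sum>k\<le>n. of_rat (q ! k) * Bernstein n k (s / t))\<bar> \<le> e" by linarith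
    qed
  qed
qed

text \<open>Indexed by a countable type; the length of a coefficient list encodes the degree plus one.\<close>

definition bernstein_path :: "real \<Rightarrow> rat list \<times> rat list \<Rightarrow> real \<Rightarrow> real \<times> real" where
  "bernstein_path t = (\<lambda>(p, q). \<lambda>s\<in>{0..t}.
     (\<Sum>k<length p. of_rat (p ! k) * Bernstein (length p - 1) k (s / t),
      \<Sum>k<length q. of_rat (q ! k) * Bernstein (length q - 1) k (s / t)))"

lemma continuous_on_restrict_iff: "continuous_on A (\<lambda>x\<in>A. f x) \<longleftrightarrow> continuous_on A f"
  by (rule continuous_on_cong) auto

lemma bernstein_path_mem: "t > 0 \<Longrightarrow> bernstein_path t pq \<in> mspace (path_metric t)"
  unfolding mspace_path_metric bernstein_path_def case_prod_beta
  by (intro CollectI conjI restrict_extensional continuous_on_restrict_iff[THEN iffD2])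
     (auto simp: Bernstein_def intro!: continuous_intros)

lemma bernstein_path_dense:
  assumes "t > 0" "f \<in> mspace (path_metric t)" "e > 0"
  shows "\<exists>pq. mdist (path_metric t) f (bernstein_path t pq) \<le> e"
proof -
  have cf: "continuous_on {0..t} f" using assms(2) by (simp add: mspace_path_metric)
  have "continuous_on {0..t} (\<lambda>s. fst (f s))" "continuous_on {0..t} (\<lambda>s. snd (f s))"
    by (intro continuous_intros cf)+
  then obtain N1 N2 and p q :: "rat list" where
    p: "length p = Suc N1" "\<forall>s\<in>{0..t}. \<bar>fst (f s) - (\<Sum>k\<le>N1. of_rat (p ! k) * Bernstein N1 k (s / t))\<bar> \<le> e/2"
    and q: "length q = Suc N2" "\<forall>s\<in>{0..t}. \<bar>snd (f s) - (\<Sum>k\<le>N2. of_rat (q ! k) * Bernstein N2 k (s / t))\<bar> \<le> e/2"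
    using Bernstein_approx_rational[OF \<open>t>0\<close>, of "\<lambda>s. fst (f s)" "e/2"]
      Bernstein_approx_rational[OF \<open>t>0\<close>, of "\<lambda>s. snd (f s)" "e/2"] \<open>e > 0\<close>
    by (meson half_gt_zero order_refl)
  have "mdist (path_metric t) f (bernstein_path t (p,q)) \<le> e"
  proof (subst path_metric_dist_le, goal_cases)
    case 4
    show ?case
    proof
      fix s assume s: "s \<in> {0..t}"
      have "dist (f s) (bernstein_path t (p,q) s) \<le>
         dist (fst (f s)) (fst (bernstein_path t (p,q) s)) + dist (snd (f s)) (snd (bernstein_path t (p,q) s))"
        unfolding dist_prod_def by (rule sqrt_sum_squares_le_sum) auto
      also have "\<dots> \<le> e/2 + e/2"
        using p q s by (intro add_mono) (auto simp: bernstein_path_def dist_real_def lessThan_Suc_atMost)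
      finally show "dist (f s) (bernstein_path t (p,q) s) \<le> e" by simp
    qed
  qed (use assms bernstein_path_mem in auto)
  then show ?thesis by blast
qed

text \<open>The Borel sets of the path space are traces of the product sigma-algebra: an open set is a
  countable union of closed balls around the rational Bernstein paths, and a closed ball is cut out
  by conditions at rational times.\<close>

lemma sets_path_space_trace:
  assumes "t > 0" "A \<in> sets (path_space t :: (real \<Rightarrow> real \<times> real) measure)"
  shows "\<exists>A'\<in>sets (PiM {0..t} (\<lambda>_. borel)). A = A' \<inter> space (path_space t)"
proof -
  let ?C = "mspace (path_metric t) :: (real \<Rightarrow> real \<times> real) set"
  let ?P = "PiM {0..t} (\<lambda>_. borel) :: (real \<Rightarrow> real \<times> real) measure"
  let ?D = "mdist (path_metric t) :: (real \<Rightarrow> real \<times> real) \<Rightarrow> _"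
  interpret Metric_space ?C ?D by simp
  have ball: "\<exists>A'\<in>sets ?P. mcball c r = A' \<inter> ?C" if c: "c \<in> ?C" for c r
  proof
    let ?A = "{f\<in>space ?P. \<forall>s\<in>\<rat> \<inter> {0..t}. dist (f s) (c s) \<le> r}"
    have cnt: "countable (\<rat> \<inter> {0..t})" using countable_rat by blast
    have 1: "{f\<in>space ?P. dist (f s) (c s) \<le> r} \<in> sets ?P" if "s \<in> \<rat> \<inter> {0..t}" for s
    proof -
      have [measurable]: "(\<lambda>f. f s) \<in> ?P \<rightarrow>\<^sub>M borel" using that by (intro measurable_component_singleton) auto
      show ?thesis by measurable
    qed
    show "?A \<in> sets ?P"
    proof -
      have "(\<forall>s\<in>\<rat> \<inter> {0..t}. dist (f s) (c s) \<le> r) \<longleftrightarrow> (\<forall>s\<in>\<rat> \<inter> {0..t}. f \<in> {f\<in>space ?P. dist (f s) (c s) \<le> r})" if "f \<in> space ?P" for f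
        using that by auto
      then have "?A = {f\<in>space ?P. \<forall>s\<in>\<rat> \<inter> {0..t}. f \<in> {f\<in>space ?P. dist (f s) (c s) \<le> r}}" by auto
      also have "\<dots> \<in> sets ?P"
        using 1 by (intro sets.sets_Collect_countable_All'[OF _ cnt]) simp
      finally show ?thesis .
    qed
    have spC: "?C \<subseteq> space ?P" by (auto simp: space_PiM PiE_def mspace_path_metric)
    have "(\<forall>s\<in>{0..t}. dist (f s) (c s) \<le> r) \<longleftrightarrow> (\<forall>s\<in>\<rat> \<inter> {0..t}. dist (f s) (c s) \<le> r)" if f: "f \<in> ?C" for f
    proof safe
      fix s assume *: "\<forall>s\<in>\<rat> \<inter> {0..t}. dist (f s) (c s) \<le> r" and s: "s \<in> {0..t}"
      have cont: "continuous_on {0..t} (\<lambda>s. dist (f s) (c s))"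
        using f c by (intro continuous_intros) (auto simp: mspace_path_metric)
      \<comment> \<open>The endpoint \<open>t\<close> may be irrational; the rationals of the open interval are dense in the closed one.\<close>
      have scl: "s \<in> closure (\<rat> \<inter> {0<..<t})"
      proof -
        have "closure (\<rat> \<inter> {0<..<t}) = closure {0<..<t}"
          using closure_open_Int_superset[of "{0<..<t}" "\<rat>"] by (simp add: Rats_closure_real Int_commute)
        then show ?thesis using s \<open>t > 0\<close> by simp
      qed
      have sub: "closure (\<rat> \<inter> {0<..<t}) \<subseteq> {0..t}"
        by (rule closure_minimal) auto
      show "dist (f s) (c s) \<le> r"
        by (rule continuous_le_on_closure[OF continuous_on_subset[OF cont sub] scl])
          (use * in force)
    qed auto
    then show "mcball c r = ?A \<inter> ?C"
      using c spC \<open>t>0\<close> path_metric_dist_le[of t c _ r] by (auto simp: dist_commute)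
  qed
  have basic: "\<exists>A'\<in>sets ?P. U = A' \<inter> ?C" if U: "openin (mtopology_of (path_metric t)) U" for U
  proof -
    \<comment> \<open>An open set is the union of the countably many rational balls that it contains.\<close>
    define I where "I = {(pq, r::rat). mcball (bernstein_path t pq) (of_rat r) \<subseteq> U}"
    have op: "openin mtopology U" using U by (simp add: mtopology_of_def)
    have "U = (\<Union>(pq, r)\<in>I. mcball (bernstein_path t pq) (of_rat r))"
    proof
      show "U \<subseteq> (\<Union>(pq, r)\<in>I. mcball (bernstein_path t pq) (of_rat r))"
      proof
        fix f assume f: "f \<in> U"
        then obtain e where e: "e > 0" "mball f e \<subseteq> U" using op by (auto simp: openin_mtopology)
        have fC: "f \<in> ?C" using op f by (meson openin_mtopology subsetD)
        obtain r :: rat where r: "0 < real_of_rat r" "real_of_rat r < e/2"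
          using of_rat_dense[of 0 "e/2"] e by auto
        obtain pq where pq: "?D f (bernstein_path t pq) \<le> real_of_rat r"
          using bernstein_path_dense[OF \<open>t>0\<close> fC r(1)] by auto
        have bC: "bernstein_path t pq \<in> ?C" using bernstein_path_mem \<open>t>0\<close> by blast
        have "mcball (bernstein_path t pq) (of_rat r) \<subseteq> mball f e"
        proof
          fix g assume g: "g \<in> mcball (bernstein_path t pq) (of_rat r)"
          then have "?D f g \<le> ?D f (bernstein_path t pq) + ?D (bernstein_path t pq) g"
            using fC bC by (intro triangle) auto
          also have "\<dots> < e" using g pq r by auto
          finally show "g \<in> mball f e" using g fC by auto
        qed
        then have "(pq, r) \<in> I" using e by (auto simp: I_def)
        moreover have "f \<in> mcball (bernstein_path t pq) (of_rat r)"
          using pq fC bC by (simp add: commute)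
        ultimately show "f \<in> (\<Union>(pq, r)\<in>I. mcball (bernstein_path t pq) (of_rat r))" by blast
      qed
    qed (auto simp: I_def)
    moreover have "\<forall>i. \<exists>A. A \<in> sets ?P \<and> mcball (bernstein_path t (fst i)) (of_rat (snd i)) = A \<inter> ?C"
      using ball[OF bernstein_path_mem[OF \<open>t>0\<close>]] by blast
    then obtain A where A: "\<And>i. A i \<in> sets ?P \<and> mcball (bernstein_path t (fst i)) (of_rat (snd i)) = A i \<inter> ?C"
      using choice[of "\<lambda>i A. A \<in> sets ?P \<and> mcball (bernstein_path t (fst i)) (of_rat (snd i)) = A \<inter> ?C"] by blast
    ultimately have "U = (\<Union>i\<in>I. A i) \<inter> ?C" by (auto simp: case_prod_beta)
    moreover have "(\<Union>i\<in>I. A i) \<in> sets ?P"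
      using A by (intro sets.countable_UN') (auto simp: countableI_type)
    ultimately show ?thesis by blast
  qed
  have "A \<in> sigma_sets ?C {U. openin (mtopology_of (path_metric t)) U}"
    using assms(2) by (simp add: sets_path_space)
  then have "\<exists>A'\<in>sets ?P. A = A' \<inter> ?C"
  proof induction
    case (Basic U) then show ?case using basic by auto
  next
    case Empty then show ?case by (intro bexI[of _ "{}"]) auto
  next
    case (Compl a)
    then obtain A' where "A' \<in> sets ?P" "a = A' \<inter> ?C" by auto
    moreover have "?C \<subseteq> space ?P" by (auto simp: space_PiM PiE_def mspace_path_metric)
    ultimately show ?case
      by (intro bexI[of _ "space ?P - A'"] sets.compl_sets) blast+
  next
    case (Union a)
    then have "\<forall>i. \<exists>A'. A' \<in> sets ?P \<and> a i = A' \<inter> ?C" by blast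
    from choice[OF this] obtain A' where A': "\<And>i. A' i \<in> sets ?P" "\<And>i. a i = A' i \<inter> ?C" by blast
    then have "(\<Union>i. A' i) \<in> sets ?P" by (intro sets.countable_UN) auto
    then show ?case using A'(2) by (intro bexI[of _ "\<Union>i. A' i"]) auto
  qed
  then show ?thesis by (simp add: space_path_space)
qed

lemma measurable_path_map_PiM:
  assumes "\<And>s. s \<in> {0..t} \<Longrightarrow> X s \<in> borel_measurable M"
  shows "path_map t X \<in> M \<rightarrow>\<^sub>M PiM {0..t} (\<lambda>_. borel)"
proof -
  have "path_map t X = (\<lambda>\<omega>. \<lambda>s\<in>{0..t}. X s \<omega>)" by (simp add: path_map_def fun_eq_iff)
  then show ?thesis using assms by (auto intro: measurable_restrict)
qed

lemma measurable_path_map: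
  fixes X :: "real \<Rightarrow> 'a \<Rightarrow> real \<times> real"
  assumes "t > 0" and m: "\<And>s. s \<in> {0..t} \<Longrightarrow> X s \<in> borel_measurable M"
    and c: "\<And>\<omega>. \<omega> \<in> space M \<Longrightarrow> continuous_on {0..t} (\<lambda>s. X s \<omega>)"
  shows "path_map t X \<in> M \<rightarrow>\<^sub>M path_space t"
proof (rule measurableI)
  show sp: "path_map t X \<omega> \<in> space (path_space t)" if "\<omega> \<in> space M" for \<omega>
    using c[OF that] unfolding space_path_space mspace_path_metric path_map_def
    by (intro CollectI conjI restrict_extensional continuous_on_restrict_iff[THEN iffD2])
  fix A :: "(real \<Rightarrow> real \<times> real) set" assume "A \<in> sets (path_space t)"
  from sets_path_space_trace[OF \<open>t>0\<close> this] obtain A' where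
    A': "A' \<in> sets (PiM {0..t} (\<lambda>_. borel))" "A = A' \<inter> space (path_space t)" by auto
  have "path_map t X -` A \<inter> space M = path_map t X -` A' \<inter> space M"
    using sp A'(2) by auto
  then show "path_map t X -` A \<inter> space M \<in> sets M"
    using measurable_sets[OF measurable_path_map_PiM[OF m] A'(1)] by simp
qed

text \<open>By the trace description of the Borel sets it is enough to compare the laws on the product space,
  which are given by finitely many times.\<close>

lemma identical_in_lawI:
  fixes X :: "real \<Rightarrow> 'a \<Rightarrow> real \<times> real" and Y :: "real \<Rightarrow> 'b \<Rightarrow> real \<times> real"
  assumes "t > 0"
    and mX: "\<And>s. s \<in> {0..t} \<Longrightarrow> X s \<in> borel_measurable M"
    and cX: "\<And>\<omega>. \<omega> \<in> space M \<Longrightarrow> continuous_on {0..t} (\<lambda>s. X s \<omega>)"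
    and mY: "\<And>s. s \<in> {0..t} \<Longrightarrow> Y s \<in> borel_measurable N"
    and cY: "\<And>\<omega>. \<omega> \<in> space N \<Longrightarrow> continuous_on {0..t} (\<lambda>s. Y s \<omega>)"
    and eq: "distr M (PiM {0..t} (\<lambda>_. borel)) (path_map t X) = distr N (PiM {0..t} (\<lambda>_. borel)) (path_map t Y)"
  shows "identical_in_law t M X N Y"
  unfolding identical_in_law_def
proof (intro conjI measure_eqI)
  show pX: "path_map t X \<in> M \<rightarrow>\<^sub>M path_space t" using assms by (intro measurable_path_map)
  show pY: "path_map t Y \<in> N \<rightarrow>\<^sub>M path_space t" using assms by (intro measurable_path_map)
  fix A assume "A \<in> sets (distr M (path_space t) (path_map t X))"
  then have A: "A \<in> sets (path_space t)" by simp
  from sets_path_space_trace[OF \<open>t>0\<close> this] obtain A' where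
    A': "A' \<in> sets (PiM {0..t} (\<lambda>_. borel))" "A = A' \<inter> space (path_space t)" by auto
  have "path_map t X -` A \<inter> space M = path_map t X -` A' \<inter> space M"
    using measurable_space[OF pX] A'(2) by auto
  moreover have "path_map t Y -` A \<inter> space N = path_map t Y -` A' \<inter> space N"
    using measurable_space[OF pY] A'(2) by auto
  moreover have "emeasure (distr M (PiM {0..t} (\<lambda>_. borel)) (path_map t X)) A' = emeasure (distr N (PiM {0..t} (\<lambda>_. borel)) (path_map t Y)) A'"
    using eq by simp
  ultimately show "emeasure (distr M (path_space t) (path_map t X)) A = emeasure (distr N (path_space t) (path_map t Y)) A"
    using A A'(1) pX pY measurable_path_map_PiM[OF mX] measurable_path_map_PiM[OF mY]
    by (simp add: emeasure_distr)
qed auto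


section \<open>Running minima\<close>

lemma bdd_below_running_min:
  fixes f :: "real \<Rightarrow> real"
  assumes "\<And>u. u \<in> {s..t} \<Longrightarrow> 0 \<le> f u"
  shows "bdd_below (f ` {s..t})"
  using assms by (intro bdd_belowI[of _ 0]) auto

text \<open>By uniform continuity: on a short interval \<open>f\<close> stays close to its value at the right end, so
  the additional times hardly lower the minimum.\<close>

lemma running_min_continuous:
  fixes f :: "real \<Rightarrow> real"
  assumes "t \<ge> 0" and cont: "continuous_on {0..t} f"
  shows "continuous_on {0..t} (\<lambda>s. INF u\<in>{s..t}. f u)"
proof -
  have bdd: "bdd_below (f ` {s..t})" if "s \<ge> 0" for s
    using compact_imp_bounded[OF compact_continuous_image[OF continuous_on_subset[OF cont, of "{s..t}"]]] that
    by (auto intro: bounded_imp_bdd_below)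
  have uc: "uniformly_continuous_on {0..t} f"
    using compact_uniformly_continuous[OF cont] by simp
  have "\<exists>d>0. \<forall>x\<in>{0..t}. \<forall>y\<in>{0..t}. dist y x < d \<longrightarrow> dist (INF u\<in>{y..t}. f u) (INF u\<in>{x..t}. f u) < e"
    if "e > 0" for e
  proof -
    from uc \<open>e > 0\<close> obtain d where d: "d > 0" "\<And>x y. x\<in>{0..t} \<Longrightarrow> y\<in>{0..t} \<Longrightarrow> dist y x < d \<Longrightarrow> dist (f y) (f x) < e/2"
      unfolding uniformly_continuous_on_def by (meson half_gt_zero)
    have main: "\<bar>(INF u\<in>{y..t}. f u) - (INF u\<in>{x..t}. f u)\<bar> \<le> e/2"
      if xy: "0 \<le> x" "x \<le> y" "y \<le> t" "y - x < d" for x y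
    proof -
      have 1: "(INF u\<in>{x..t}. f u) \<le> (INF u\<in>{y..t}. f u)"
        using xy by (intro cINF_superset_mono bdd) auto
      have "(INF u\<in>{y..t}. f u) - e/2 \<le> (INF u\<in>{x..t}. f u)"
      proof (rule cINF_greatest)
        fix u assume u: "u \<in> {x..t}"
        show "(INF u\<in>{y..t}. f u) - e/2 \<le> f u"
        proof (cases "u \<ge> y")
          case True
          then have "(INF u\<in>{y..t}. f u) \<le> f u" using u xy by (intro cINF_lower bdd) auto
          then show ?thesis using \<open>e>0\<close> by linarith
        next
          case False
          have "(INF u\<in>{y..t}. f u) \<le> f y" using xy by (intro cINF_lower bdd) auto
          moreover have "dist (f y) (f u) < e/2" using u xy False by (intro d) (auto simp: dist_real_def)
          ultimately show ?thesis unfolding dist_real_def by linarith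
        qed
      qed (use xy in auto)
      with 1 show ?thesis by linarith
    qed
    show ?thesis
    proof (intro exI[of _ d] conjI ballI impI \<open>d>0\<close>)
      fix x y assume *: "x \<in> {0..t}" "y \<in> {0..t}" "dist y x < d"
      show "dist (INF u\<in>{y..t}. f u) (INF u\<in>{x..t}. f u) < e"
      proof (cases "x \<le> y")
        case True
        then have "\<bar>(INF u\<in>{y..t}. f u) - (INF u\<in>{x..t}. f u)\<bar> \<le> e/2"
          using * by (intro main) (auto simp: dist_real_def)
        then show ?thesis unfolding dist_real_def using \<open>e > 0\<close> by linarith
      next
        case False
        then have "\<bar>(INF u\<in>{x..t}. f u) - (INF u\<in>{y..t}. f u)\<bar> \<le> e/2"
          using * by (intro main) (auto simp: dist_real_def)
        then show ?thesis unfolding dist_real_def using \<open>e > 0\<close> by linarith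
      qed
    qed
  qed
  then have "uniformly_continuous_on {0..t} (\<lambda>s. INF u\<in>{s..t}. f u)"
    unfolding uniformly_continuous_on_def by blast
  then show ?thesis by (rule uniformly_continuous_imp_continuous)
qed

text \<open>The endpoints are added since they may be irrational and since the interval may be a point.\<close>

definition rational_times :: "real \<Rightarrow> real \<Rightarrow> real set" where
  "rational_times s t = insert s (insert t (\<rat> \<inter> {s..t}))"

lemma countable_rational_times: "countable (rational_times s t)"
  unfolding rational_times_def using countable_rat by (intro countable_insert countable_Int1)

text \<open>The absolute value does not change the nonnegative \<open>f\<close>; it keeps the infimum bounded below for
  arbitrary functions, which makes it a measurable function of the coordinates.\<close>

lemma running_min_rational:
  fixes f :: "real \<Rightarrow> real"
  assumes "0 \<le> s" "s \<le> t" and cont: "continuous_on {0..t} f" and nn: "\<And>u. u \<in> {0..t} \<Longrightarrow> 0 \<le> f u"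
  shows "(INF u\<in>{s..t}. f u) = (INF u\<in>rational_times s t. \<bar>f u\<bar>)"
proof (rule antisym)
  have sub: "rational_times s t \<subseteq> {s..t}" using assms by (auto simp: rational_times_def)
  have bdd: "bdd_below (f ` {s..t})" using assms by (intro bdd_below_running_min) auto
  show "(INF u\<in>{s..t}. f u) \<le> (INF u\<in>rational_times s t. \<bar>f u\<bar>)"
  proof (rule cINF_mono)
    show "rational_times s t \<noteq> {}" by (auto simp: rational_times_def)
  next
    fix m assume "m \<in> rational_times s t"
    then show "\<exists>n\<in>{s..t}. f n \<le> \<bar>f m\<bar>" using sub by (intro bexI[of _ m]) auto
  qed (rule bdd)
  show "(INF u\<in>rational_times s t. \<bar>f u\<bar>) \<le> (INF u\<in>{s..t}. f u)"
  proof (rule cINF_greatest)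
    fix u assume u: "u \<in> {s..t}"
    let ?I = "INF u\<in>rational_times s t. \<bar>f u\<bar>"
    have low: "?I \<le> f v" if "v \<in> rational_times s t" for v
    proof -
      have "?I \<le> \<bar>f v\<bar>" using that by (intro cINF_lower bdd_belowI[of _ 0]) auto
      also have "\<dots> = f v" using that sub nn[of v] \<open>0\<le>s\<close> by force
      finally show ?thesis .
    qed
    show "?I \<le> f u"
    proof (cases "s < t")
      case False
      then have "u = s" using u by auto
      then show ?thesis using low[of s] by (simp add: rational_times_def)
    next
      case True
      have "closure (\<rat> \<inter> {s<..<t}) = closure {s<..<t}"
        using closure_open_Int_superset[of "{s<..<t}" "\<rat>"] by (simp add: Rats_closure_real Int_commute)
      then have cl: "u \<in> closure (\<rat> \<inter> {s<..<t})" "closure (\<rat> \<inter> {s<..<t}) \<subseteq> {0..t}"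
        using True u \<open>0\<le>s\<close> by (simp_all add: closure_greaterThanLessThan)
      show ?thesis
        by (rule continuous_ge_on_closure[OF continuous_on_subset[OF cont cl(2)] cl(1)])
           (rule low, auto simp: rational_times_def)
    qed
  qed (use assms in auto)
qed

text \<open>Between \<open>s\<close> and the next zero \<open>z\<close> of \<open>b\<close> the function \<open>l\<close> is constant, so the sum
  \<open>\<bar>b\<bar> + l\<close> attains its lower bound \<open>l s\<close> at \<open>z\<close>; if there is no such zero before \<open>t\<close> then \<open>l t = l s\<close>.\<close>

lemma growth_at_zeros_eq_future_min:
  fixes b l :: "real \<Rightarrow> real"
  assumes s: "0 \<le> s" "s \<le> t" and cb: "continuous_on {0..t} b"
    and mono: "\<And>r u. 0 \<le> r \<Longrightarrow> r \<le> u \<Longrightarrow> u \<le> t \<Longrightarrow> l r \<le> l u" and cl: "continuous_on {0..t} l"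
    and flat: "\<And>r u. 0 \<le> r \<Longrightarrow> r \<le> u \<Longrightarrow> u \<le> t \<Longrightarrow> (\<And>v. v \<in> {r..u} \<Longrightarrow> b v \<noteq> 0) \<Longrightarrow> l u = l r"
    and l0: "l 0 \<ge> 0"
  shows "l s = min (INF u\<in>{s..t}. \<bar>b u\<bar> + l u) (l t)"
proof -
  have lnn: "0 \<le> l u" if "u \<in> {0..t}" for u using mono[of 0 u] l0 that by auto
  have bdd: "bdd_below ((\<lambda>u. \<bar>b u\<bar> + l u) ` {s..t})"
    using lnn s by (intro bdd_below_running_min) (auto intro!: add_nonneg_nonneg)
  have lo: "l s \<le> (INF u\<in>{s..t}. \<bar>b u\<bar> + l u)"
  proof (rule cINF_greatest)
    fix u assume "u \<in> {s..t}" then show "l s \<le> \<bar>b u\<bar> + l u" using mono[of s u] s by auto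
  qed (use s in auto)
  have "l s \<le> l t" using mono s by auto
  moreover have "(INF u\<in>{s..t}. \<bar>b u\<bar> + l u) \<le> l s \<or> l t = l s"
  proof (cases "\<exists>v\<in>{s..t}. b v = 0")
    case False then show ?thesis using flat[of s t] s by auto
  next
    case True
    let ?Z = "{v\<in>{s..t}. b v = 0}"
    have "closed ?Z"
      using continuous_closed_preimage_constant[OF continuous_on_subset[OF cb], of "{s..t}" 0] s by auto
    moreover have Z: "?Z \<noteq> {}" "bdd_below ?Z" using True by auto
    ultimately have "Inf ?Z \<in> ?Z" by (intro closed_contains_Inf)
    then obtain z where z: "z \<in> {s..t}" "b z = 0" "z = Inf ?Z" by auto
    have nz: "b v \<noteq> 0" if "v \<in> {s..<z}" for v
    proof
      assume "b v = 0" then have "Inf ?Z \<le> v" using that z Z by (intro cInf_lower) auto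
      then show False using that z(3) by auto
    qed
    have "l z = l s"
    proof (cases "z = s")
      case False
      then have "s < z" using z(1) by auto
      have clz: "closure {s..<z} = {s..z}" using \<open>s<z\<close> by simp
      have "l z \<le> l s"
      proof (rule continuous_le_on_closure[of "{s..<z}" l])
        show "continuous_on (closure {s..<z}) l" unfolding clz using z(1) s by (intro continuous_on_subset[OF cl]) auto
        show "z \<in> closure {s..<z}" unfolding clz using \<open>s<z\<close> by simp
        fix u assume "u \<in> {s..<z}"
        then have "l u = l s" using nz z(1) s by (intro flat) auto
        then show "l u \<le> l s" by simp
      qed
      moreover have "l s \<le> l z" using mono z(1) s by auto
      ultimately show ?thesis by simp
    qed simp
    moreover have "(INF u\<in>{s..t}. \<bar>b u\<bar> + l u) \<le> \<bar>b z\<bar> + l z"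
      using z(1) by (intro cINF_lower bdd)
    ultimately show ?thesis using z(2) by auto
  qed
  ultimately show ?thesis using lo by linarith
qed


section \<open>Functions that determine the law of a nonnegative pair\<close>

text \<open>By uniform approximation with polynomials on \<open>[0, 1]\<close>. Boundedness of \<open>D\<close> for the supremum norm is
  phrased with an arbitrary bound \<open>e\<close>, and linearity concerns continuous functions only, as differences
  of two integrals satisfy it there.\<close>

lemma weierstrass_functional:
  fixes D :: "(real \<Rightarrow> real) \<Rightarrow> real"
  assumes add: "\<And>f g. continuous_on UNIV f \<Longrightarrow> continuous_on UNIV g \<Longrightarrow> D (\<lambda>x. f x + g x) = D f + D g"
    and scale: "\<And>f c. continuous_on UNIV f \<Longrightarrow> D (\<lambda>x. c * f x) = c * D f"
    and bound: "\<And>f e. continuous_on UNIV f \<Longrightarrow> (\<And>x. x \<in> {0..1} \<Longrightarrow> \<bar>f x\<bar> \<le> e) \<Longrightarrow> \<bar>D f\<bar> \<le> C * e"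
    and mono: "\<And>k. D (\<lambda>x. x ^ k) = 0"
    and f: "continuous_on UNIV f"
  shows "D f = 0"
proof -
  have poly: "D (\<lambda>x. \<Sum>i\<le>n. a i * x ^ i) = 0" for a n
  proof (induction n)
    case 0
    have "D (\<lambda>x. a 0 * x ^ 0) = a 0 * D (\<lambda>x. x ^ 0)" by (intro scale continuous_intros)
    then show ?case using mono[of 0] by simp
  next
    case (Suc n)
    have "D (\<lambda>x. (\<Sum>i\<le>n. a i * x ^ i) + a (Suc n) * x ^ Suc n) =
        D (\<lambda>x. \<Sum>i\<le>n. a i * x ^ i) + D (\<lambda>x. a (Suc n) * x ^ Suc n)"
      by (intro add continuous_intros)
    also have "D (\<lambda>x. a (Suc n) * x ^ Suc n) = a (Suc n) * D (\<lambda>x. x ^ Suc n)"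
      by (intro scale continuous_intros)
    finally show ?case using Suc.IH mono[of "Suc n"] by simp
  qed
  have "\<bar>D f\<bar> \<le> C * e" if "e > 0" for e
  proof -
    note e = that
    obtain g where g: "real_polynomial_function g" "\<And>x. x \<in> {0..1} \<Longrightarrow> \<bar>f x - g x\<bar> < e"
      by (rule Stone_Weierstrass_real_polynomial_function[of "{0..1}" f e])
        (use e continuous_on_subset[OF f subset_UNIV] in auto)
    then obtain a n where a: "g = (\<lambda>x. \<Sum>i\<le>n. a i * x ^ i)"
      by (auto simp: real_polynomial_function_iff_sum)
    have cg: "continuous_on UNIV g" unfolding a by (intro continuous_intros)
    have "D (\<lambda>x. (f x - g x) + g x) = D (\<lambda>x. f x - g x) + D g"
      by (intro add continuous_intros f cg)
    then have "D f = D (\<lambda>x. f x - g x)" using poly[of a n] by (simp add: a)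
    also have "\<bar>\<dots>\<bar> \<le> C * e" using g(2) by (intro bound continuous_intros f cg) (auto intro: less_imp_le)
    finally show ?thesis .
  qed
  note small = this
  have "((\<lambda>e. C * e) \<longlongrightarrow> C * 0) (at_right 0)" by (intro tendsto_intros)
  moreover have "\<forall>\<^sub>F e in at_right 0. \<bar>D f\<bar> \<le> C * e"
    using small by (auto simp: eventually_at_right[of 0 1] intro!: exI[of _ 1])
  ultimately have "\<bar>D f\<bar> \<le> C * 0"
    by (intro tendsto_lowerbound) auto
  then show ?thesis by simp
qed

lemma continuous_bounded_unit:
  fixes g :: "real \<Rightarrow> real"
  assumes "continuous_on UNIV g"
  obtains B where "\<And>x. x \<in> {0..1} \<Longrightarrow> \<bar>g x\<bar> \<le> B"
proof -
  have "bounded (g ` {0..1})"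
    by (intro compact_imp_bounded compact_continuous_image continuous_on_subset[OF assms]) auto
  then obtain B where "\<forall>y\<in>g ` {0..1}. norm y \<le> B" unfolding bounded_iff by blast
  then show ?thesis by (intro that[of B]) simp
qed

lemma integral_mult_continuous_unit:
  fixes h Y :: "'a \<Rightarrow> real"
  assumes h: "integrable P h" and Y[measurable]: "Y \<in> borel_measurable P"
    and r: "\<And>x. x \<in> space P \<Longrightarrow> Y x \<in> {0..1}" and g: "continuous_on UNIV g"
  shows "integrable P (\<lambda>x. h x * g (Y x))"
    and "(\<And>x. x \<in> {0..1} \<Longrightarrow> \<bar>g x\<bar> \<le> e) \<Longrightarrow> \<bar>\<integral>x. h x * g (Y x) \<partial>P\<bar> \<le> (\<integral>x. \<bar>h x\<bar> \<partial>P) * e"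
proof -
  note [measurable] = borel_measurable_integrable[OF h] borel_measurable_continuous_onI[OF g]
  obtain B where B: "\<And>x. x \<in> {0..1} \<Longrightarrow> \<bar>g x\<bar> \<le> B" using continuous_bounded_unit[OF g] by metis
  show int: "integrable P (\<lambda>x. h x * g (Y x))"
  proof (rule Bochner_Integration.integrable_bound[of _ "\<lambda>x. B * h x"])
    show "AE x in P. norm (h x * g (Y x)) \<le> norm (B * h x)"
    proof (rule AE_I2)
      fix x assume "x \<in> space P"
      from mult_right_mono[OF order_trans[OF B[OF r[OF this]] abs_ge_self], of "\<bar>h x\<bar>"]
      show "norm (h x * g (Y x)) \<le> norm (B * h x)" by (simp add: abs_mult mult.commute)
    qed
  qed (use h in simp_all)
  assume e: "\<And>x. x \<in> {0..1} \<Longrightarrow> \<bar>g x\<bar> \<le> e"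
  have "\<bar>\<integral>x. h x * g (Y x) \<partial>P\<bar> \<le> (\<integral>x. \<bar>h x * g (Y x)\<bar> \<partial>P)" by (rule integral_abs_bound)
  also have "\<dots> \<le> (\<integral>x. \<bar>h x\<bar> * e \<partial>P)"
    using e r by (intro integral_mono integrable_abs int integrable_mult_left h)
      (auto simp: abs_mult intro!: mult_left_mono)
  finally show "\<bar>\<integral>x. h x * g (Y x) \<partial>P\<bar> \<le> (\<integral>x. \<bar>h x\<bar> \<partial>P) * e" by simp
qed

text \<open>Weights of any sign are admitted, so that one coordinate of a pair can be treated after the other,
  with a function of the first coordinate as weight for the second.\<close>

lemma moments_determine_integrals:
  fixes h1 Y1 :: "'a \<Rightarrow> real" and h2 Y2 :: "'b \<Rightarrow> real"
  assumes h: "integrable P1 h1" "integrable P2 h2"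
    and Y1[measurable]: "Y1 \<in> borel_measurable P1" and Y2[measurable]: "Y2 \<in> borel_measurable P2"
    and r: "\<And>x. x \<in> space P1 \<Longrightarrow> Y1 x \<in> {0..1}" "\<And>x. x \<in> space P2 \<Longrightarrow> Y2 x \<in> {0..1}"
    and eq: "\<And>k. (\<integral>x. h1 x * Y1 x ^ k \<partial>P1) = (\<integral>x. h2 x * Y2 x ^ k \<partial>P2)"
    and f: "continuous_on UNIV f"
  shows "(\<integral>x. h1 x * f (Y1 x) \<partial>P1) = (\<integral>x. h2 x * f (Y2 x) \<partial>P2)"
proof -
  let ?D = "\<lambda>f. (\<integral>x. h1 x * f (Y1 x) \<partial>P1) - (\<integral>x. h2 x * f (Y2 x) \<partial>P2)"
  note int1 = integral_mult_continuous_unit(1)[OF h(1) Y1 r(1)] and int2 = integral_mult_continuous_unit(1)[OF h(2) Y2 r(2)]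
  have "?D f = 0"
  proof (rule weierstrass_functional[where C = "(\<integral>x. \<bar>h1 x\<bar> \<partial>P1) + (\<integral>x. \<bar>h2 x\<bar> \<partial>P2)", OF _ _ _ _ f])
    fix f g :: "real \<Rightarrow> real" assume "continuous_on UNIV f" "continuous_on UNIV g"
    then show "?D (\<lambda>x. f x + g x) = ?D f + ?D g"
      by (simp add: distrib_left int1 int2)
  next
    fix f :: "real \<Rightarrow> real" and c assume "continuous_on UNIV f"
    show "?D (\<lambda>x. c * f x) = c * ?D f"
      by (simp add: mult.left_commute[of _ c] right_diff_distrib)
  next
    fix g :: "real \<Rightarrow> real" and e assume g: "continuous_on UNIV g" and b: "\<And>x. x \<in> {0..1} \<Longrightarrow> \<bar>g x\<bar> \<le> e"
    show "\<bar>?D g\<bar> \<le> ((\<integral>x. \<bar>h1 x\<bar> \<partial>P1) + (\<integral>x. \<bar>h2 x\<bar> \<partial>P2)) * e"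
      using integral_mult_continuous_unit(2)[OF h(1) Y1 r(1) g b] integral_mult_continuous_unit(2)[OF h(2) Y2 r(2) g b]
      unfolding distrib_right by linarith
  qed (simp add: eq)
  then show ?thesis by simp
qed

lemma cos_std_normal: "(\<integral>z. cos (a * z) \<partial>std_normal_distribution) = exp (- a\<^sup>2 / 2)"
  and integrable_cos_std_normal: "integrable std_normal_distribution (\<lambda>z. cos (a * z))"
proof -
  interpret S: real_distribution std_normal_distribution by (rule real_dist_normal_dist)
  show "integrable std_normal_distribution (\<lambda>z. cos (a * z))"
    by (rule S.integrable_const_bound[of _ 1]) auto
  have "complex_of_real (exp (- a\<^sup>2 / 2)) = char std_normal_distribution a"
    by (simp add: char_std_normal_distribution)
  also have "\<dots> = (\<integral>z. iexp (a * z) \<partial>std_normal_distribution)" by (simp add: char_def)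
  finally have "Re (\<integral>z. iexp (a * z) \<partial>std_normal_distribution) = exp (- a\<^sup>2 / 2)"
    by (metis Re_complex_of_real)
  moreover have "Re (\<integral>z. iexp (a * z) \<partial>std_normal_distribution) = (\<integral>z. Re (iexp (a * z)) \<partial>std_normal_distribution)"
    by (rule integral_Re[symmetric], rule S.integrable_iexp) auto
  ultimately show "(\<integral>z. cos (a * z) \<partial>std_normal_distribution) = exp (- a\<^sup>2 / 2)"
    by (simp add: Re_exp)
qed

text \<open>With \<open>\<partial>\<^sub>x\<close> and \<open>\<partial>\<^sub>l\<close> denoting derivatives: \<open>\<partial>\<^sub>x\<^sup>2\<close> acts as multiplication by \<open>-\<xi>\<^sup>2\<close>, and
  \<open>\<partial>\<^sub>x + \<partial>\<^sub>l\<close> annihilates the function at \<open>x = 0\<close>. The second property is the boundary condition for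
  a reflected motion whose local time is the second argument.\<close>

definition pitman_fun :: "real \<Rightarrow> real \<Rightarrow> real \<Rightarrow> real \<Rightarrow> real" where
  "pitman_fun \<xi> k x l = exp (- k * l) * (\<xi> * cos (\<xi> * x) + k * sin (\<xi> * x))"

abbreviation unit_lborel :: "real measure" where
  "unit_lborel \<equiv> restrict_space lborel {0..1}"

lemma prob_space_unit_lborel: "prob_space unit_lborel"
  by (rule prob_space_restrict_space) auto

lemma unit_lborel_integral_FTC:
  fixes F :: "real \<Rightarrow> real"
  assumes "\<And>v. DERIV F v :> f v" "continuous_on UNIV f"
  shows "(\<integral>v. f v \<partial>unit_lborel) = F 1 - F 0"
proof -
  have "(\<integral>v. f v * indicator {0..1} v \<partial>lborel) = F 1 - F 0"
    using assms by (intro integral_FTC_Icc_real) (auto simp: continuous_on_eq_continuous_at)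
  then show ?thesis by (subst integral_restrict_space) (auto simp: mult.commute)
qed

locale nonneg_pair = finite_measure Q for Q :: "'a measure" +
  fixes X L :: "'a \<Rightarrow> real"
  assumes X_meas[measurable]: "X \<in> borel_measurable Q" and L_meas[measurable]: "L \<in> borel_measurable Q"
    and X_nonneg: "\<And>\<omega>. \<omega> \<in> space Q \<Longrightarrow> 0 \<le> X \<omega>" and L_nonneg: "\<And>\<omega>. \<omega> \<in> space Q \<Longrightarrow> 0 \<le> L \<omega>"
    and X_int: "integrable Q X"
begin

sublocale U: prob_space unit_lborel by (rule prob_space_unit_lborel)
sublocale QU: pair_sigma_finite Q unit_lborel ..

abbreviation "QU \<equiv> Q \<Otimes>\<^sub>M unit_lborel"

text \<open>The integral of \<open>kernel k f\<close> over the additional variable \<open>v \<in> [0, 1]\<close> is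
  \<open>exp (-k L) (f(X) + k \<integral>\<^sub>0\<^sup>X f)\<close>. Writing \<open>\<integral>\<^sub>0\<^sup>X f\<close> as an average over the unit interval turns
  \<open>transform k\<close> into integration against a finite measure, to which Fubini and dominated convergence
  apply. The choice \<open>f(x) = cos (\<xi> x)\<close> gives back \<open>pitman_fun\<close> divided by \<open>\<xi>\<close>.\<close>

definition kernel :: "real \<Rightarrow> (real \<Rightarrow> real) \<Rightarrow> 'a \<times> real \<Rightarrow> real" where
  "kernel k f p = exp (- k * L (fst p)) * (f (X (fst p)) + k * X (fst p) * f (X (fst p) * snd p))"

definition transform :: "real \<Rightarrow> (real \<Rightarrow> real) \<Rightarrow> real" where
  "transform k f = (\<integral>p. kernel k f p \<partial>QU)"

lemma snd_meas[measurable]: "snd \<in> borel_measurable QU"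
  using measurable_snd[of Q unit_lborel] by (auto simp: measurable_restrict_space2_iff)

lemma kernel_meas[measurable]:
  assumes [measurable]: "f \<in> borel_measurable borel"
  shows "kernel k f \<in> borel_measurable QU"
  unfolding kernel_def[abs_def] by measurable

lemma X_fst_int: "integrable QU (\<lambda>p. X (fst p))"
proof -
  have "integrable (distr QU Q fst) X" using X_int by (simp add: U.distr_pair_fst)
  then show ?thesis by (subst (asm) integrable_distr_eq) auto
qed

lemma finite_QU: "finite_measure QU"
  by (rule finite_measure_pair_measure) (unfold_locales)

lemma bound_int: "integrable QU (\<lambda>p. e * (1 + k * X (fst p)))"
proof -
  interpret F: finite_measure QU by (rule finite_QU)
  show ?thesis using X_fst_int by auto
qed

lemma space_QU: "p \<in> space QU \<Longrightarrow> fst p \<in> space Q \<and> 0 \<le> snd p \<and> snd p \<le> 1"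
  by (auto simp: space_pair_measure space_restrict_space)

lemma kernel_bound:
  assumes "k \<ge> 0" "\<And>x. x \<ge> 0 \<Longrightarrow> \<bar>f x\<bar> \<le> e" "p \<in> space QU"
  shows "\<bar>kernel k f p\<bar> \<le> e * (1 + k * X (fst p))"
proof -
  have p: "0 \<le> X (fst p)" "0 \<le> L (fst p)" "0 \<le> snd p" using space_QU[OF assms(3)] X_nonneg L_nonneg by auto
  have "\<bar>kernel k f p\<bar> \<le> 1 * (\<bar>f (X (fst p))\<bar> + k * X (fst p) * \<bar>f (X (fst p) * snd p)\<bar>)"
    unfolding kernel_def abs_mult using p assms(1)
    by (intro mult_mono) (auto simp: abs_mult intro!: order_trans[OF abs_triangle_ineq])
  also have "\<dots> \<le> 1 * (e + k * X (fst p) * e)"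
    using p assms(1) by (intro mult_mono add_mono assms(2) order_refl) (auto intro!: add_nonneg_nonneg)
  finally show ?thesis by (simp add: algebra_simps)
qed

lemma kernel_int:
  assumes "k \<ge> 0" "f \<in> borel_measurable borel" "\<And>x. x \<ge> 0 \<Longrightarrow> \<bar>f x\<bar> \<le> e"
  shows "integrable QU (kernel k f)"
  by (rule Bochner_Integration.integrable_bound[OF bound_int[of e k]])
     (use assms kernel_bound[OF assms(1,3)] in \<open>auto intro!: AE_I2 order_trans[OF kernel_bound[OF assms(1,3)] abs_ge_self]\<close>)

lemma transform_bound:
  assumes "k \<ge> 0" "f \<in> borel_measurable borel" "\<And>x. x \<ge> 0 \<Longrightarrow> \<bar>f x\<bar> \<le> e"
  shows "\<bar>transform k f\<bar> \<le> (\<integral>p. 1 + k * X (fst p) \<partial>QU) * e"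
proof -
  have "\<bar>transform k f\<bar> \<le> (\<integral>p. \<bar>kernel k f p\<bar> \<partial>QU)" unfolding transform_def by (rule integral_abs_bound)
  also have "\<dots> \<le> (\<integral>p. e * (1 + k * X (fst p)) \<partial>QU)"
    using kernel_int[OF assms] bound_int by (intro integral_mono kernel_bound assms) auto
  also have "\<dots> = (\<integral>p. 1 + k * X (fst p) \<partial>QU) * e" by (simp add: mult.commute)
  finally show ?thesis .
qed

text \<open>Carries out the integration over the unit interval for an \<open>f\<close> with known primitive \<open>F x\<close> of
  \<open>v \<mapsto> x f(x v)\<close>.\<close>

lemma transform_iterated:
  assumes "k \<ge> 0" "continuous_on UNIV f" "\<And>x. x \<ge> 0 \<Longrightarrow> \<bar>f x\<bar> \<le> e"
    and F: "\<And>x v. x \<ge> 0 \<Longrightarrow> DERIV (F x) v :> x * f (x * v)"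
  shows "transform k f = (\<integral>\<omega>. exp (- k * L \<omega>) * (f (X \<omega>) + k * (F (X \<omega>) 1 - F (X \<omega>) 0)) \<partial>Q)"
proof -
  have fm: "f \<in> borel_measurable borel" using assms(2) by (rule borel_measurable_continuous_onI)
  have "transform k f = (\<integral>\<omega>. \<integral>v. kernel k f (\<omega>, v) \<partial>unit_lborel \<partial>Q)"
    unfolding transform_def by (rule QU.integral_fst'[symmetric], rule kernel_int[OF assms(1) fm assms(3)])
  also have "\<dots> = (\<integral>\<omega>. exp (- k * L \<omega>) * (f (X \<omega>) + k * (F (X \<omega>) 1 - F (X \<omega>) 0)) \<partial>Q)"
  proof (rule Bochner_Integration.integral_cong[OF refl])
    fix \<omega> assume w: "\<omega> \<in> space Q"
    have c: "continuous_on UNIV (\<lambda>v. X \<omega> * f (X \<omega> * v))"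
      by (intro continuous_intros continuous_on_compose2[OF assms(2)]) auto
    have i: "integrable unit_lborel (\<lambda>v. X \<omega> * f (X \<omega> * v))"
      by (rule U.integrable_const_bound[of _ "X \<omega> * e"])
        (use fm X_nonneg[OF w] assms(3) in \<open>auto intro!: AE_I2 mult_left_mono simp: abs_mult space_restrict_space measurable_restrict_space1\<close>)
    have "(\<integral>v. kernel k f (\<omega>, v) \<partial>unit_lborel) =
       (\<integral>v. exp (- k * L \<omega>) * (f (X \<omega>) + k * (X \<omega> * f (X \<omega> * v))) \<partial>unit_lborel)"
      by (simp add: kernel_def mult.assoc)
    also have "\<dots> = exp (- k * L \<omega>) * (f (X \<omega>) + k * (\<integral>v. X \<omega> * f (X \<omega> * v) \<partial>unit_lborel))"
      using i U.prob_space by (simp add: space_restrict_space)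
    also have "(\<integral>v. X \<omega> * f (X \<omega> * v) \<partial>unit_lborel) = F (X \<omega>) 1 - F (X \<omega>) 0"
      by (rule unit_lborel_integral_FTC[OF F[OF X_nonneg[OF w]] c])
    finally show "(\<integral>v. kernel k f (\<omega>, v) \<partial>unit_lborel) = exp (- k * L \<omega>) * (f (X \<omega>) + k * (F (X \<omega>) 1 - F (X \<omega>) 0))" .
  qed
  finally show ?thesis .
qed

lemma transform_cos:
  assumes "k \<ge> 0" "\<xi> \<noteq> 0"
  shows "\<xi> * transform k (\<lambda>y. cos (\<xi> * y)) = (\<integral>\<omega>. pitman_fun \<xi> k (X \<omega>) (L \<omega>) \<partial>Q)"
proof -
  have D: "DERIV (\<lambda>v. sin (\<xi> * (x * v)) / \<xi>) v :> x * cos (\<xi> * (x * v))" for x v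
    using \<open>\<xi> \<noteq> 0\<close> by (auto intro!: derivative_eq_intros)
  have "transform k (\<lambda>y. cos (\<xi> * y)) = (\<integral>\<omega>. exp (- k * L \<omega>) * (cos (\<xi> * X \<omega>) + k * (sin (\<xi> * (X \<omega> * 1)) / \<xi> - sin (\<xi> * (X \<omega> * 0)) / \<xi>)) \<partial>Q)"
    by (rule transform_iterated[where e = 1, OF assms(1) _ _ D]) (auto intro!: continuous_intros)
  then have "\<xi> * transform k (\<lambda>y. cos (\<xi> * y)) = (\<integral>\<omega>. \<xi> * (exp (- k * L \<omega>) * (cos (\<xi> * X \<omega>) + k * (sin (\<xi> * X \<omega>) / \<xi>))) \<partial>Q)"
    by simp
  also have "\<dots> = (\<integral>\<omega>. pitman_fun \<xi> k (X \<omega>) (L \<omega>) \<partial>Q)"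
    using \<open>\<xi> \<noteq> 0\<close> by (intro Bochner_Integration.integral_cong refl) (simp add: pitman_fun_def field_simps)
  finally show ?thesis .
qed

text \<open>For \<open>\<xi> = 0\<close> the function \<open>pitman_fun\<close> vanishes and gives no information; the frequency \<open>0\<close> is
  reached as a limit.\<close>

lemma transform_cos_tendsto:
  assumes "k \<ge> 0"
  shows "(\<lambda>n. transform k (\<lambda>y. cos (1 / real (Suc n) * y))) \<longlonglongrightarrow> transform k (\<lambda>y. cos (0 * y))"
  unfolding transform_def
proof (rule integral_dominated_convergence[OF _ _ bound_int[of 1 k]])
  show "AE p in QU. (\<lambda>n. kernel k (\<lambda>y. cos (1 / real (Suc n) * y)) p) \<longlonglongrightarrow> kernel k (\<lambda>y. cos (0 * y)) p"
    unfolding kernel_def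
    by (intro AE_I2 tendsto_intros LIMSEQ_Suc[OF lim_1_over_n[where 'a = real]])
  show "AE p in QU. norm (kernel k (\<lambda>y. cos (1 / real (Suc n) * y)) p) \<le> 1 * (1 + k * X (fst p))" for n
    by (intro AE_I2, unfold real_norm_def, intro kernel_bound assms) auto
qed auto

text \<open>A centred Gaussian function is a Gaussian mixture of cosines.\<close>

lemma transform_gauss:
  assumes "k \<ge> 0"
  shows "transform k (\<lambda>y. exp (- s\<^sup>2 * y\<^sup>2 / 2)) = (\<integral>z. transform k (\<lambda>y. cos ((s * z) * y)) \<partial>std_normal_distribution)"
proof -
  interpret S: real_distribution std_normal_distribution by (rule real_dist_normal_dist)
  interpret F: finite_measure QU by (rule finite_QU)
  interpret P: pair_sigma_finite QU std_normal_distribution ..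
  have ps: "p \<in> space (QU \<Otimes>\<^sub>M std_normal_distribution) \<Longrightarrow> fst p \<in> space QU" for p
    by (auto simp: space_pair_measure)
  have I: "integrable (QU \<Otimes>\<^sub>M std_normal_distribution) (\<lambda>(p, z). kernel k (\<lambda>y. cos ((s * z) * y)) p)"
  proof (rule Bochner_Integration.integrable_bound[where f = "\<lambda>q. 1 * (1 + k * X (fst (fst q)))"])
    show "integrable (QU \<Otimes>\<^sub>M std_normal_distribution) (\<lambda>q. 1 * (1 + k * X (fst (fst q))))"
    proof -
      have "integrable (distr (QU \<Otimes>\<^sub>M std_normal_distribution) QU fst) (\<lambda>p. 1 * (1 + k * X (fst p)))"
        using bound_int[of 1 k] by (simp add: S.distr_pair_fst)
      then show ?thesis
        by (subst (asm) integrable_distr_eq) auto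
    qed
    show "(\<lambda>(p, z). kernel k (\<lambda>y. cos ((s * z) * y)) p) \<in> borel_measurable (QU \<Otimes>\<^sub>M std_normal_distribution)"
      unfolding kernel_def by measurable
    show "AE q in QU \<Otimes>\<^sub>M std_normal_distribution.
        norm (case q of (p, z) \<Rightarrow> kernel k (\<lambda>y. cos ((s * z) * y)) p) \<le> norm (1 * (1 + k * X (fst (fst q))))"
      using ps by (intro AE_I2) (auto simp: case_prod_beta intro!: order_trans[OF kernel_bound[where e = 1, OF assms]])
  qed
  have "(\<integral>z. transform k (\<lambda>y. cos ((s * z) * y)) \<partial>std_normal_distribution) =
      (\<integral>p. \<integral>z. kernel k (\<lambda>y. cos ((s * z) * y)) p \<partial>std_normal_distribution \<partial>QU)"
    unfolding transform_def using P.Fubini_integral[OF I] by simp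
  also have "\<dots> = transform k (\<lambda>y. exp (- s\<^sup>2 * y\<^sup>2 / 2))"
    unfolding transform_def
  proof (rule Bochner_Integration.integral_cong[OF refl])
    fix p
    have eq: "(\<integral>z. cos (s * z * y) \<partial>std_normal_distribution) = exp (- s\<^sup>2 * y\<^sup>2 / 2)"
        "integrable std_normal_distribution (\<lambda>z. cos (s * z * y))" for y
      using cos_std_normal[of "s * y"] integrable_cos_std_normal[of "s * y"]
      by (simp_all add: power_mult_distrib mult.commute mult.left_commute)
    show "(\<integral>z. kernel k (\<lambda>y. cos ((s * z) * y)) p \<partial>std_normal_distribution) = kernel k (\<lambda>y. exp (- s\<^sup>2 * y\<^sup>2 / 2)) p"
      unfolding kernel_def by (simp add: eq del: mult_minus_left)
  qed
  finally show ?thesis ..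
qed

lemma transform_exp:
  assumes "k > 0" "a > 0"
  shows "transform k (\<lambda>y. exp (- a * y)) = (\<integral>\<omega>. exp (- k * L \<omega>) * (exp (- a * X \<omega>) + k * (1 - exp (- a * X \<omega>)) / a) \<partial>Q)"
proof -
  have D: "DERIV (\<lambda>v. - exp (- a * (x * v)) / a) v :> x * exp (- a * (x * v))" for x v
    using \<open>a > 0\<close> by (auto intro!: derivative_eq_intros)
  have "transform k (\<lambda>y. exp (- a * y)) = (\<integral>\<omega>. exp (- k * L \<omega>) * (exp (- a * X \<omega>) + k * (- exp (- a * (X \<omega> * 1)) / a - - exp (- a * (X \<omega> * 0)) / a)) \<partial>Q)"
    using assms by (intro transform_iterated[where e = 1, OF _ _ _ D]) (auto intro!: continuous_intros)
  also have "\<dots> = (\<integral>\<omega>. exp (- k * L \<omega>) * (exp (- a * X \<omega>) + k * (1 - exp (- a * X \<omega>)) / a) \<partial>Q)"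
    by (intro Bochner_Integration.integral_cong refl) (simp add: algebra_simps diff_divide_distrib)
  finally show ?thesis .
qed

lemma exp_int:
  assumes "k \<ge> 0" "a \<ge> 0"
  shows "integrable Q (\<lambda>\<omega>. exp (- k * L \<omega>) * exp (- a * X \<omega>))"
  by (rule integrable_const_bound[of _ 1])
     (use assms X_nonneg L_nonneg in \<open>auto intro!: AE_I2 mult_le_one\<close>)

end


text \<open>Powers of this variable are again Gaussian functions of \<open>y\<close>, so that polynomials in it are
  combinations of Gaussian functions and the theorem of Weierstrass applies on \<open>[0, 1]\<close>.\<close>

definition gauss_var :: "real \<Rightarrow> real" where "gauss_var y = exp (- y\<^sup>2 / 2)"

lemma gauss_var_range: "gauss_var y \<in> {0..1}"
  by (auto simp: gauss_var_def)

context nonneg_pair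
begin

lemma transform_gauss_var_int:
  assumes "k \<ge> 0" "continuous_on UNIV f"
  shows "integrable QU (kernel k (\<lambda>y. f (gauss_var y)))"
proof -
  obtain e where e: "\<And>x. x \<in> {0..1} \<Longrightarrow> \<bar>f x\<bar> \<le> e" using continuous_bounded_unit[OF assms(2)] by metis
  have [measurable]: "f \<in> borel_measurable borel" using assms(2) by (rule borel_measurable_continuous_onI)
  have "(\<lambda>y. f (gauss_var y)) \<in> borel_measurable borel" unfolding gauss_var_def by measurable
  then show ?thesis by (rule kernel_int[OF assms(1) _ e[OF gauss_var_range]])
qed

lemma transform_gauss_var_add:
  assumes "k \<ge> 0" "continuous_on UNIV f" "continuous_on UNIV g"
  shows "transform k (\<lambda>y. f (gauss_var y) + g (gauss_var y)) = transform k (\<lambda>y. f (gauss_var y)) + transform k (\<lambda>y. g (gauss_var y))"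
proof -
  have "kernel k (\<lambda>y. f (gauss_var y) + g (gauss_var y)) = (\<lambda>p. kernel k (\<lambda>y. f (gauss_var y)) p + kernel k (\<lambda>y. g (gauss_var y)) p)"
    by (simp add: kernel_def fun_eq_iff algebra_simps)
  then show ?thesis unfolding transform_def using assms by (simp add: transform_gauss_var_int)
qed

lemma transform_scale: "transform k (\<lambda>y. c * f y) = c * transform k f"
proof -
  have "kernel k (\<lambda>y. c * f y) = (\<lambda>p. c * kernel k f p)"
    by (simp add: kernel_def fun_eq_iff algebra_simps)
  then show ?thesis unfolding transform_def by simp
qed

lemma transform_gauss_var_bound:
  assumes "k \<ge> 0" "continuous_on UNIV f" "\<And>x. x \<in> {0..1} \<Longrightarrow> \<bar>f x\<bar> \<le> e"
  shows "\<bar>transform k (\<lambda>y. f (gauss_var y))\<bar> \<le> (\<integral>p. 1 + k * X (fst p) \<partial>QU) * e"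
proof -
  have [measurable]: "f \<in> borel_measurable borel" using assms(2) by (rule borel_measurable_continuous_onI)
  have "(\<lambda>y. f (gauss_var y)) \<in> borel_measurable borel" unfolding gauss_var_def by measurable
  then show ?thesis by (rule transform_bound[OF assms(1) _ assms(3)[OF gauss_var_range]])
qed

lemma transform_cong: 
  assumes "\<And>y. y \<ge> 0 \<Longrightarrow> f y = g y"
  shows "transform k f = transform k g"
  unfolding transform_def
  by (intro Bochner_Integration.integral_cong refl)
     (use assms space_QU X_nonneg in \<open>auto simp: kernel_def\<close>)

text \<open>For \<open>f(y) = exp (-k y)\<close> the two terms \<open>f(X)\<close> and \<open>k \<integral>\<^sub>0\<^sup>X f\<close> add up to \<open>1\<close>, so that
  \<open>X\<close> drops out.\<close>

lemma transform_exp_self: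
  assumes "k > 0"
  shows "transform k (\<lambda>y. exp (- k * y)) = (\<integral>\<omega>. exp (- k * L \<omega>) \<partial>Q)"
  using assms by (subst transform_exp) auto

lemma transform_exp_other:
  assumes "k > 0" "a > 0"
  shows "a * transform k (\<lambda>y. exp (- a * y)) = (a - k) * (\<integral>\<omega>. exp (- k * L \<omega>) * exp (- a * X \<omega>) \<partial>Q)
    + k * (\<integral>\<omega>. exp (- k * L \<omega>) \<partial>Q)"
proof -
  have i1: "integrable Q (\<lambda>\<omega>. exp (- k * L \<omega>) * exp (- a * X \<omega>))" using assms by (intro exp_int) auto
  have i2: "integrable Q (\<lambda>\<omega>. exp (- k * L \<omega>))" using exp_int[of k 0] assms by simp
  have "a * transform k (\<lambda>y. exp (- a * y)) = (\<integral>\<omega>. a * (exp (- k * L \<omega>) * (exp (- a * X \<omega>) + k * (1 - exp (- a * X \<omega>)) / a)) \<partial>Q)"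
    using assms by (subst transform_exp) auto
  also have "\<dots> = (\<integral>\<omega>. (a - k) * (exp (- k * L \<omega>) * exp (- a * X \<omega>)) + k * exp (- k * L \<omega>) \<partial>Q)"
    using assms by (intro Bochner_Integration.integral_cong refl) (simp add: field_simps)
  also have "\<dots> = (a - k) * (\<integral>\<omega>. exp (- k * L \<omega>) * exp (- a * X \<omega>) \<partial>Q) + k * (\<integral>\<omega>. exp (- k * L \<omega>) \<partial>Q)"
    using i1 i2 by simp
  finally show ?thesis .
qed

end

text \<open>The function is \<open>exp (-a sqrt (-2 ln x))\<close>, extended by \<open>0\<close> to \<open>x \<le> 0\<close>.\<close>

lemma exp_as_gauss_var:
  assumes "a > 0"
  obtains f where "continuous_on UNIV f" "\<And>y. y \<ge> 0 \<Longrightarrow> f (gauss_var y) = exp (- a * y)"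
proof
  let ?f = "\<lambda>x::real. if x \<le> 0 then 0 else exp (- a * sqrt (-2 * ln x))"
  show "?f (gauss_var y) = exp (- a * y)" if "y \<ge> 0" for y
    using that by (simp add: gauss_var_def)
  have "isCont ?f x" for x
  proof -
    consider "x < 0" | "x = 0" | "x > 0" by linarith
    then show ?thesis
    proof cases
      case 1
      then have "\<forall>\<^sub>F y in nhds x. ?f y = 0"
        using eventually_nhds_in_open[of "{..<0}" x] by (auto elim!: eventually_mono)
      then show ?thesis by (subst isCont_cong[of _ "\<lambda>_. 0"]) auto
    next
      case 3
      then have "\<forall>\<^sub>F y in nhds x. ?f y = exp (- a * sqrt (-2 * ln y))"
        using eventually_nhds_in_open[of "{0<..}" x] by (auto elim!: eventually_mono)
      then show ?thesis using 3 by (subst isCont_cong) (auto intro!: continuous_intros)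
    next
      case 2
      have l: "(?f \<longlongrightarrow> 0) (at_left 0)"
        by (rule tendsto_eventually) (auto simp: eventually_at_filter)
      have "filterlim (\<lambda>x::real. 2 * - ln x) at_top (at_right 0)"
        using ln_at_0 by (intro filterlim_tendsto_pos_mult_at_top[OF tendsto_const])
          (auto simp: filterlim_uminus_at_bot)
      then have "filterlim (\<lambda>x::real. -2 * ln x) at_top (at_right 0)" by simp
      then have "filterlim (\<lambda>x::real. sqrt (-2 * ln x)) at_top (at_right 0)"
        by (rule filterlim_compose[OF sqrt_at_top])
      then have "filterlim (\<lambda>x::real. - a * sqrt (-2 * ln x)) at_bot (at_right 0)"
        using assms by (intro filterlim_tendsto_neg_mult_at_bot[OF tendsto_const]) auto
      then have "((\<lambda>x::real. exp (- a * sqrt (-2 * ln x))) \<longlongrightarrow> 0) (at_right 0)"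
        by (rule filterlim_compose[OF exp_at_bot])
      then have r: "(?f \<longlongrightarrow> 0) (at_right 0)"
        by (rule Lim_transform_eventually) (auto simp: eventually_at_filter)
      show ?thesis unfolding \<open>x = 0\<close> continuous_at using l r by (simp add: filterlim_at_split)
    qed
  qed
  then show "continuous_on UNIV ?f" by (simp add: continuous_on_eq_continuous_at)
qed

text \<open>A continuous function with support bounded above extends continuously to \<open>y = \<infinity>\<close>, hence is a
  continuous function of \<open>exp (-y)\<close>.\<close>

lemma tail_as_exp:
  fixes r :: "real \<Rightarrow> real"
  assumes "continuous_on UNIV r" "\<And>x. x \<ge> N \<Longrightarrow> r x = 0"
  obtains f where "continuous_on UNIV f" "\<And>y. y \<ge> 0 \<Longrightarrow> f (exp (- y)) = r y"
proof
  let ?f = "\<lambda>x::real. r (- ln (max x (exp (- N))))"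
  have "continuous_on UNIV (\<lambda>x::real. - ln (max x (exp (- N))))"
    by (intro continuous_intros) (auto simp: max_def)
  then show "continuous_on UNIV ?f"
    by (intro continuous_on_compose2[OF assms(1)]) auto
  show "?f (exp (- y)) = r y" if "y \<ge> 0" for y
    using assms(2) by (cases "y \<le> N") (auto simp: max_def)
qed

text \<open>A continuous approximation from above to the indicator of the half-line up to \<open>a\<close>.\<close>

definition ramp :: "real \<Rightarrow> nat \<Rightarrow> real \<Rightarrow> real" where
  "ramp a j x = max 0 (min 1 (1 - real j * (x - a)))"

lemma ramp_continuous: "continuous_on UNIV (ramp a j)"
  unfolding ramp_def by (intro continuous_intros)

lemma ramp_vanishes: "j > 0 \<Longrightarrow> x \<ge> a + 1 \<Longrightarrow> ramp a j x = 0"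
proof -
  assume "j > 0" "x \<ge> a + 1"
  then have "1 * 1 \<le> real j * (x - a)" by (intro mult_mono) auto
  then show ?thesis by (simp add: ramp_def)
qed

lemma ramp_bounded: "\<bar>ramp a j x\<bar> \<le> 1"
  by (auto simp: ramp_def)

lemma ramp_tendsto: "(\<lambda>j. ramp a (Suc j) x) \<longlonglongrightarrow> indicator {..a} x"
proof (cases "x \<le> a")
  case True
  then have "ramp a (Suc j) x = 1" for j
    using mult_nonneg_nonpos[of "real (Suc j)" "x - a"] by (simp add: ramp_def del: of_nat_Suc)
  then show ?thesis using True by simp
next
  case False
  then obtain n :: nat where n: "1 / (x - a) < real n" using reals_Archimedean2 by blast
  have "ramp a (Suc j) x = 0" if "j \<ge> n" for j
  proof -
    have "1 / (x - a) \<le> real (Suc j)" using n that by simp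
    then have "1 \<le> real (Suc j) * (x - a)" using False by (simp add: field_simps)
    then show ?thesis by (simp add: ramp_def)
  qed
  then have "\<forall>\<^sub>F j in sequentially. ramp a (Suc j) x = indicator {..a} x"
    using False by (auto simp: eventually_sequentially)
  then show ?thesis by (rule tendsto_eventually)
qed

text \<open>From cosines to Gaussian functions by mixing, and to \<open>f(y) = exp (-a y)\<close> by the theorem of
  Weierstrass. The value \<open>a = k\<close> yields the Laplace transform of \<open>L\<close>, and the other values then yield
  the joint Laplace transform of the pair, from which a second and third use of Weierstrass recover
  the law.\<close>

theorem pitman_fun_determines_law:
  assumes A: "nonneg_pair Q1 X1 L1" and B: "nonneg_pair Q2 X2 L2"
    and eq: "\<And>\<xi> k. \<xi> \<noteq> 0 \<Longrightarrow> k > 0 \<Longrightarrow>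
       (\<integral>\<omega>. pitman_fun \<xi> k (X1 \<omega>) (L1 \<omega>) \<partial>Q1) = (\<integral>\<omega>. pitman_fun \<xi> k (X2 \<omega>) (L2 \<omega>) \<partial>Q2)"
  shows "distr Q1 borel (\<lambda>\<omega>. (X1 \<omega>, L1 \<omega>)) = distr Q2 borel (\<lambda>\<omega>. (X2 \<omega>, L2 \<omega>))"
proof -
  interpret A: nonneg_pair Q1 X1 L1 by (rule A)
  interpret B: nonneg_pair Q2 X2 L2 by (rule B)
  have cos: "A.transform k (\<lambda>y. cos (\<xi> * y)) = B.transform k (\<lambda>y. cos (\<xi> * y))" if "k > 0" for k \<xi>
  proof -
    have nz: "A.transform k (\<lambda>y. cos (\<xi> * y)) = B.transform k (\<lambda>y. cos (\<xi> * y))" if "\<xi> \<noteq> 0" for \<xi>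
      using A.transform_cos[of k \<xi>] B.transform_cos[of k \<xi>] eq[of \<xi> k] that \<open>k > 0\<close>
      by (metis less_imp_le mult_cancel_left)
    show ?thesis
    proof (cases "\<xi> = 0")
      case True
      have "(\<lambda>n. A.transform k (\<lambda>y. cos (1 / real (Suc n) * y))) = (\<lambda>n. B.transform k (\<lambda>y. cos (1 / real (Suc n) * y)))"
        by (intro ext nz) auto
      then show ?thesis
        using A.transform_cos_tendsto[of k] B.transform_cos_tendsto[of k] that True LIMSEQ_unique by auto
    qed (rule nz)
  qed
  have gauss: "A.transform k (\<lambda>y. exp (- s\<^sup>2 * y\<^sup>2 / 2)) = B.transform k (\<lambda>y. exp (- s\<^sup>2 * y\<^sup>2 / 2))" if "k > 0" for k s
    unfolding A.transform_gauss[OF less_imp_le[OF that]] B.transform_gauss[OF less_imp_le[OF that]] cos[OF that] ..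
  have weier: "A.transform k (\<lambda>y. f (gauss_var y)) = B.transform k (\<lambda>y. f (gauss_var y))" if "k > 0" and f: "continuous_on UNIV f" for k f
  proof -
    let ?D = "\<lambda>f. A.transform k (\<lambda>y. f (gauss_var y)) - B.transform k (\<lambda>y. f (gauss_var y))"
    have "?D f = 0"
    proof (rule weierstrass_functional[where C = "(\<integral>p. 1 + k * X1 (fst p) \<partial>A.QU) + (\<integral>p. 1 + k * X2 (fst p) \<partial>B.QU)", OF _ _ _ _ f])
      fix f g :: "real \<Rightarrow> real" assume "continuous_on UNIV f" "continuous_on UNIV g"
      then show "?D (\<lambda>x. f x + g x) = ?D f + ?D g"
        using \<open>k > 0\<close> by (simp add: A.transform_gauss_var_add B.transform_gauss_var_add)
    next
      fix g :: "real \<Rightarrow> real" and e assume g: "continuous_on UNIV g" "\<And>x. x \<in> {0..1} \<Longrightarrow> \<bar>g x\<bar> \<le> e"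
      show "\<bar>?D g\<bar> \<le> ((\<integral>p. 1 + k * X1 (fst p) \<partial>A.QU) + (\<integral>p. 1 + k * X2 (fst p) \<partial>B.QU)) * e"
        using A.transform_gauss_var_bound[OF less_imp_le[OF \<open>k > 0\<close>] g] B.transform_gauss_var_bound[OF less_imp_le[OF \<open>k > 0\<close>] g]
        unfolding distrib_right by linarith
    next
      fix j :: nat
      have "gauss_var y ^ j = exp (- (sqrt j)\<^sup>2 * y\<^sup>2 / 2)" for y
        by (simp add: gauss_var_def flip: exp_of_nat_mult)
      then have "(\<lambda>y. gauss_var y ^ j) = (\<lambda>y. exp (- (sqrt j)\<^sup>2 * y\<^sup>2 / 2))" by blast
      then show "?D (\<lambda>x. x ^ j) = 0" using gauss[OF \<open>k > 0\<close>, of "sqrt j"] by (simp only:) 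
    qed (simp add: A.transform_scale B.transform_scale right_diff_distrib)
    then show ?thesis by simp
  qed
  have ex: "A.transform k (\<lambda>y. exp (- a * y)) = B.transform k (\<lambda>y. exp (- a * y))" if "k > 0" "a > 0" for k a
  proof -
    obtain f where f: "continuous_on UNIV f" "\<And>y. y \<ge> 0 \<Longrightarrow> f (gauss_var y) = exp (- a * y)"
      using exp_as_gauss_var[OF \<open>a > 0\<close>] by metis
    show ?thesis
      using weier[OF \<open>k > 0\<close> f(1)] A.transform_cong[of "\<lambda>y. f (gauss_var y)" "\<lambda>y. exp (- a * y)" k]
        B.transform_cong[of "\<lambda>y. f (gauss_var y)" "\<lambda>y. exp (- a * y)" k] f(2) by simp
  qed
  have lap0: "(\<integral>\<omega>. exp (- k * L1 \<omega>) \<partial>Q1) = (\<integral>\<omega>. exp (- k * L2 \<omega>) \<partial>Q2)" if "k > 0" for k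
    using ex[OF that that] A.transform_exp_self[OF that] B.transform_exp_self[OF that] by simp
  have lap: "(\<integral>\<omega>. exp (- k * L1 \<omega>) * exp (- a * X1 \<omega>) \<partial>Q1) = (\<integral>\<omega>. exp (- k * L2 \<omega>) * exp (- a * X2 \<omega>) \<partial>Q2)"
    if "k > 0" "a \<ge> 0" "a \<noteq> k" for k a
  proof (cases "a = 0")
    case False
    then have "a > 0" using that by simp
    from A.transform_exp_other[OF \<open>k > 0\<close> this] B.transform_exp_other[OF \<open>k > 0\<close> this] ex[OF \<open>k > 0\<close> this] lap0[OF \<open>k > 0\<close>] \<open>a \<noteq> k\<close>
    show ?thesis by simp
  qed (use lap0[OF \<open>k > 0\<close>] in simp)
  have stepX: "(\<integral>\<omega>. exp (- k * L1 \<omega>) * f (exp (- X1 \<omega>)) \<partial>Q1) = (\<integral>\<omega>. exp (- k * L2 \<omega>) * f (exp (- X2 \<omega>)) \<partial>Q2)"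
    if k: "k = real n + 1/2" and f: "continuous_on UNIV f" for k n f
  proof (rule moments_determine_integrals[OF _ _ _ _ _ _ _ f])
    \<comment> \<open>Half-integer \<open>k\<close> avoid the exponents \<open>a = k\<close>, for which the transform contains no information on \<open>X\<close>.\<close>
    have "real j \<noteq> k" for j :: nat
    proof
      assume "real j = k"
      then have "real (2 * j) = real (2 * n + 1)" unfolding k by simp
      then have "2 * j = 2 * n + 1" by (simp only: of_nat_eq_iff)
      then show False by presburger
    qed
    then show "(\<integral>x. exp (- k * L1 x) * exp (- X1 x) ^ j \<partial>Q1) = (\<integral>x. exp (- k * L2 x) * exp (- X2 x) ^ j \<partial>Q2)" for j :: nat
      using lap[of k "real j"] k by (simp flip: exp_of_nat_mult)
    show "integrable Q1 (\<lambda>\<omega>. exp (- k * L1 \<omega>))" using A.exp_int[of k 0] k by simp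
    show "integrable Q2 (\<lambda>\<omega>. exp (- k * L2 \<omega>))" using B.exp_int[of k 0] k by simp
  qed (use A.X_nonneg B.X_nonneg in auto)
  have stepL: "(\<integral>\<omega>. exp (- (1/2) * L1 \<omega>) * f (exp (- X1 \<omega>)) * g (exp (- L1 \<omega>)) \<partial>Q1) =
      (\<integral>\<omega>. exp (- (1/2) * L2 \<omega>) * f (exp (- X2 \<omega>)) * g (exp (- L2 \<omega>)) \<partial>Q2)"
    if f: "continuous_on UNIV f" and g: "continuous_on UNIV g" for f g
  proof (rule moments_determine_integrals[OF _ _ _ _ _ _ _ g])
    obtain C where C: "\<And>x. x \<in> {0..1} \<Longrightarrow> \<bar>f x\<bar> \<le> C" using continuous_bounded_unit[OF f] by metis
    have [measurable]: "f \<in> borel_measurable borel" using f by (rule borel_measurable_continuous_onI)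
    have C0: "0 \<le> C" using C[of 0] by auto
    have b: "\<bar>exp (- (1/2) * l) * f (exp (- x))\<bar> \<le> C" if "0 \<le> l" "0 \<le> x" for l x
      using mult_mono[of "exp (- (1/2) * l)" 1 "\<bar>f (exp (- x))\<bar>" C] that C[of "exp (-x)"] by (simp add: abs_mult)
    show "integrable Q1 (\<lambda>\<omega>. exp (- (1/2) * L1 \<omega>) * f (exp (- X1 \<omega>)))"
      using b A.X_nonneg A.L_nonneg by (intro A.integrable_const_bound[of _ C] AE_I2) auto
    show "integrable Q2 (\<lambda>\<omega>. exp (- (1/2) * L2 \<omega>) * f (exp (- X2 \<omega>)))"
      using b B.X_nonneg B.L_nonneg by (intro B.integrable_const_bound[of _ C] AE_I2) auto
    fix j :: nat
    have e: "exp (- (1/2) * l) * c * exp (- l) ^ j = exp (- (real j + 1/2) * l) * c" for l c :: real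
    proof -
      have "exp (- (1/2) * l) * exp (- l) ^ j = exp (- (real j + 1/2) * l)"
        by (simp add: algebra_simps flip: exp_of_nat_mult exp_add)
      then show ?thesis by (simp add: mult.commute mult.left_commute)
    qed
    show "(\<integral>x. exp (- (1/2) * L1 x) * f (exp (- X1 x)) * exp (- L1 x) ^ j \<partial>Q1) =
      (\<integral>x. exp (- (1/2) * L2 x) * f (exp (- X2 x)) * exp (- L2 x) ^ j \<partial>Q2)"
      unfolding e by (rule stepX[OF refl f])
  qed (use A.L_nonneg B.L_nonneg in auto)
  have ramps: "(\<integral>\<omega>. ramp a (Suc j) (X1 \<omega>) * ramp b (Suc j) (L1 \<omega>) \<partial>Q1) = (\<integral>\<omega>. ramp a (Suc j) (X2 \<omega>) * ramp b (Suc j) (L2 \<omega>) \<partial>Q2)" for a b j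
  proof -
    obtain f where f: "continuous_on UNIV f" "\<And>y. y \<ge> 0 \<Longrightarrow> f (exp (- y)) = ramp a (Suc j) y"
      using tail_as_exp[OF ramp_continuous, of "a + 1"] ramp_vanishes[of "Suc j" a] by blast
    have c: "continuous_on UNIV (\<lambda>y. exp (1/2 * y) * ramp b (Suc j) y)"
      by (intro continuous_intros ramp_continuous)
    obtain g where g: "continuous_on UNIV g" "\<And>y. y \<ge> 0 \<Longrightarrow> g (exp (- y)) = exp (1/2 * y) * ramp b (Suc j) y"
      using tail_as_exp[OF c, of "b + 1"] ramp_vanishes[of "Suc j" b] by auto
    have e: "exp (- (1/2) * l) * f (exp (- x)) * g (exp (- l)) = ramp a (Suc j) x * ramp b (Suc j) l" if "0 \<le> x" "0 \<le> l" for x l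
    proof -
      have "exp (- (1/2) * l) * exp (1/2 * l) = 1" by (simp flip: exp_add)
      then show ?thesis using that f(2) g(2) by (simp add: mult_ac)
    qed
    have "(\<integral>\<omega>. ramp a (Suc j) (X1 \<omega>) * ramp b (Suc j) (L1 \<omega>) \<partial>Q1) = (\<integral>\<omega>. exp (- (1/2) * L1 \<omega>) * f (exp (- X1 \<omega>)) * g (exp (- L1 \<omega>)) \<partial>Q1)"
      using A.X_nonneg A.L_nonneg by (intro Bochner_Integration.integral_cong refl e[symmetric]) auto
    also have "\<dots> = (\<integral>\<omega>. exp (- (1/2) * L2 \<omega>) * f (exp (- X2 \<omega>)) * g (exp (- L2 \<omega>)) \<partial>Q2)"
      by (rule stepL[OF f(1) g(1)])
    also have "\<dots> = (\<integral>\<omega>. ramp a (Suc j) (X2 \<omega>) * ramp b (Suc j) (L2 \<omega>) \<partial>Q2)"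
      using B.X_nonneg B.L_nonneg by (intro Bochner_Integration.integral_cong refl e) auto
    finally show ?thesis .
  qed
  have [measurable]: "ramp a j \<in> borel_measurable borel" for a j
    by (rule borel_measurable_continuous_onI[OF ramp_continuous])
  have bnd: "norm (ramp a j x * ramp b j y) \<le> 1" for a b j x y
    using mult_mono[OF ramp_bounded[of a j x] ramp_bounded[of b j y]] by (simp add: abs_mult)
  have rect: "measure Q1 {\<omega>\<in>space Q1. X1 \<omega> \<le> a \<and> L1 \<omega> \<le> b} = measure Q2 {\<omega>\<in>space Q2. X2 \<omega> \<le> a \<and> L2 \<omega> \<le> b}" for a b
  proof -
    have "(\<lambda>j. \<integral>\<omega>. ramp a (Suc j) (X1 \<omega>) * ramp b (Suc j) (L1 \<omega>) \<partial>Q1) \<longlonglongrightarrow> (\<integral>\<omega>. indicator {..a} (X1 \<omega>) * indicator {..b} (L1 \<omega>) \<partial>Q1)"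
      by (rule integral_dominated_convergence[where w = "\<lambda>_. 1"];
          (intro AE_I2 tendsto_mult ramp_tendsto bnd)?; simp?)
    moreover have "(\<lambda>j. \<integral>\<omega>. ramp a (Suc j) (X2 \<omega>) * ramp b (Suc j) (L2 \<omega>) \<partial>Q2) \<longlonglongrightarrow> (\<integral>\<omega>. indicator {..a} (X2 \<omega>) * indicator {..b} (L2 \<omega>) \<partial>Q2)"
      by (rule integral_dominated_convergence[where w = "\<lambda>_. 1"];
          (intro AE_I2 tendsto_mult ramp_tendsto bnd)?; simp?)
    ultimately have "(\<integral>\<omega>. indicator {..a} (X1 \<omega>) * indicator {..b} (L1 \<omega>) \<partial>Q1) = (\<integral>\<omega>. indicator {..a} (X2 \<omega>) * indicat_real {..b} (L2 \<omega>) \<partial>Q2)"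
      unfolding ramps by (rule LIMSEQ_unique)
    moreover have "(\<integral>\<omega>. indicator {..a} (X1 \<omega>) * indicat_real {..b} (L1 \<omega>) \<partial>Q1) = (\<integral>\<omega>. indicator {\<omega>\<in>space Q1. X1 \<omega> \<le> a \<and> L1 \<omega> \<le> b} \<omega> \<partial>Q1)"
      by (intro Bochner_Integration.integral_cong) (auto simp: indicator_def)
    moreover have "(\<integral>\<omega>. indicator {..a} (X2 \<omega>) * indicat_real {..b} (L2 \<omega>) \<partial>Q2) = (\<integral>\<omega>. indicator {\<omega>\<in>space Q2. X2 \<omega> \<le> a \<and> L2 \<omega> \<le> b} \<omega> \<partial>Q2)"
      by (intro Bochner_Integration.integral_cong) (auto simp: indicator_def)
    ultimately show ?thesis by (simp add: Int_absorb2)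
  qed
  have m1: "(\<lambda>\<omega>. (X1 \<omega>, L1 \<omega>)) \<in> borel_measurable Q1" and m2: "(\<lambda>\<omega>. (X2 \<omega>, L2 \<omega>)) \<in> borel_measurable Q2"
    by measurable
  show ?thesis
  proof (rule measure_eqI_generator_eq[where E = "range (\<lambda>a. {..a})" and \<Omega> = UNIV and A = "\<lambda>i. {..(real i, real i)}"])
    show "Int_stable (range (\<lambda>a::real \<times> real. {..a}))"
    proof (clarsimp simp: Int_stable_def)
      fix a b c d :: real
      show "{..(a, b)} \<inter> {..(c, d)} \<in> range atMost"
        by (rule range_eqI[of _ _ "(min a c, min b d)"]) (auto simp: less_eq_prod_def)
    qed
    show "sets (distr Q1 borel (\<lambda>\<omega>. (X1 \<omega>, L1 \<omega>))) = sigma_sets UNIV (range (\<lambda>a. {..a}))"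
      by (simp add: borel_eq_atMost)
    show "sets (distr Q2 borel (\<lambda>\<omega>. (X2 \<omega>, L2 \<omega>))) = sigma_sets UNIV (range (\<lambda>a. {..a}))"
      by (simp add: borel_eq_atMost)
    show "(\<Union>i. {..(real i, real i)}) = UNIV"
    proof safe
      fix x y :: real
      obtain i :: nat where "max x y \<le> real i" using real_arch_simple by blast
      then show "(x, y) \<in> (\<Union>i. {..(real i, real i)})" by auto
    qed auto
    fix C :: "(real \<times> real) set" assume "C \<in> range (\<lambda>a. {..a})"
    then obtain a b where C: "C = {..(a, b)}" by auto
    have "emeasure (distr Q1 borel (\<lambda>\<omega>. (X1 \<omega>, L1 \<omega>))) C = emeasure Q1 {\<omega>\<in>space Q1. X1 \<omega> \<le> a \<and> L1 \<omega> \<le> b}"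
      unfolding C by (subst emeasure_distr[OF m1]) (auto intro!: arg_cong2[where f = emeasure] simp: less_eq_prod_def)
    moreover have "emeasure (distr Q2 borel (\<lambda>\<omega>. (X2 \<omega>, L2 \<omega>))) C = emeasure Q2 {\<omega>\<in>space Q2. X2 \<omega> \<le> a \<and> L2 \<omega> \<le> b}"
      unfolding C by (subst emeasure_distr[OF m2]) (auto intro!: arg_cong2[where f = emeasure] simp: less_eq_prod_def)
    ultimately show "emeasure (distr Q1 borel (\<lambda>\<omega>. (X1 \<omega>, L1 \<omega>))) C = emeasure (distr Q2 borel (\<lambda>\<omega>. (X2 \<omega>, L2 \<omega>))) C"
      using rect by (simp add: A.emeasure_eq_measure B.emeasure_eq_measure)
  next
    interpret D: finite_measure "distr Q1 borel (\<lambda>\<omega>. (X1 \<omega>, L1 \<omega>))" by (rule A.finite_measure_distr[OF m1])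
    show "emeasure (distr Q1 borel (\<lambda>\<omega>. (X1 \<omega>, L1 \<omega>))) {..(real i, real i)} \<noteq> \<infinity>" for i
      using D.emeasure_finite by auto
  qed auto
qed


section \<open>Brownian motion and its past\<close>

text \<open>The sigma-algebra of the path up to time \<open>s\<close>, as a measure space on \<open>space M\<close> of which only the
  measurable sets matter.\<close>

definition history :: "'a measure \<Rightarrow> (real \<Rightarrow> 'a \<Rightarrow> real) \<Rightarrow> real \<Rightarrow> 'a measure" where
  "history M X s = vimage_algebra (space M) (\<lambda>\<omega>. \<lambda>r\<in>{0..s}. X r \<omega>) (PiM {0..s} (\<lambda>_. borel))"

lemma space_history[simp]: "space (history M X s) = space M"
  by (simp add: history_def)

lemma path_in_PiM: "(\<lambda>\<omega>. \<lambda>r\<in>{0..s}. X r \<omega>) \<in> space M \<rightarrow> space (PiM {0..s} (\<lambda>_. borel))"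
  by (auto simp: space_PiM)

lemma sets_history:
  "sets (history M X s) = {(\<lambda>\<omega>. \<lambda>r\<in>{0..s}. X r \<omega>) -` A \<inter> space M | A. A \<in> sets (PiM {0..s} (\<lambda>_. borel))}"
  unfolding history_def by (rule sets_vimage_algebra2[OF path_in_PiM])

lemma measurable_history:
  assumes "r \<in> {0..s}"
  shows "X r \<in> borel_measurable (history M X s)"
proof -
  have "(\<lambda>\<omega>. \<lambda>r\<in>{0..s}. X r \<omega>) \<in> history M X s \<rightarrow>\<^sub>M PiM {0..s} (\<lambda>_. borel)"
    unfolding history_def by (rule measurable_vimage_algebra1[OF path_in_PiM])
  from measurable_compose[OF this measurable_component_singleton[OF assms]] show ?thesis
    using assms by simp
qed

lemma sets_history_subset_events:
  assumes "\<And>r. r \<ge> 0 \<Longrightarrow> X r \<in> borel_measurable M"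
  shows "sets (history M X s) \<subseteq> sets M"
proof -
  have "(\<lambda>\<omega>. \<lambda>r\<in>{0..s}. X r \<omega>) \<in> M \<rightarrow>\<^sub>M PiM {0..s} (\<lambda>_. borel)"
    using assms by (intro measurable_restrict) auto
  then show ?thesis by (auto simp: sets_history dest: measurable_sets)
qed

lemma sets_history_mono:
  assumes "s \<le> u"
  shows "sets (history M X s) \<subseteq> sets (history M X u)"
proof -
  have "(\<lambda>\<omega>. \<lambda>r\<in>{0..s}. X r \<omega>) \<in> history M X u \<rightarrow>\<^sub>M PiM {0..s} (\<lambda>_. borel)"
    using assms by (intro measurable_restrict measurable_history) auto
  from measurable_sets[OF this] show ?thesis by (auto simp: sets_history)
qed

lemma measurable_history_mono:
  assumes "f \<in> N \<rightarrow>\<^sub>M K" "sets N = sets (history M X s)" "space N = space M" "s \<le> u"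
  shows "f \<in> history M X u \<rightarrow>\<^sub>M K"
  using assms sets_history_mono[OF \<open>s \<le> u\<close>, of M X]
  by (auto simp: measurable_def)

locale brownian_motion =
  fixes M :: "'a measure" and B :: "real \<Rightarrow> 'a \<Rightarrow> real"
  assumes bm: "standard_BM M B"
begin

sublocale prob_space M
  using bm by (auto simp: standard_BM_def continuous_process_def)

lemma B_meas: "s \<ge> 0 \<Longrightarrow> B s \<in> borel_measurable M"
  using bm by (auto simp: standard_BM_def continuous_process_def)

lemma B_cont: "\<omega> \<in> space M \<Longrightarrow> continuous_on {0..} (\<lambda>s. B s \<omega>)"
  using bm by (auto simp: standard_BM_def continuous_process_def)

lemma B_zero: "AE \<omega> in M. B 0 \<omega> = 0"
  using bm by (auto simp: standard_BM_def)

lemma B_incr: "0 \<le> s \<Longrightarrow> s < u \<Longrightarrow> distributed M lborel (\<lambda>\<omega>. B u \<omega> - B s \<omega>) (normal_density 0 (sqrt (u - s)))"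
  using bm by (auto simp: standard_BM_def)

lemma B_indep: "0 \<le> \<tau> 0 \<Longrightarrow> mono_on {..n} \<tau> \<Longrightarrow>
   indep_vars (\<lambda>_. borel) (\<lambda>i \<omega>. B (\<tau> (Suc i)) \<omega> - B (\<tau> i) \<omega>) {..<n}"
  using bm by (auto simp: standard_BM_def)

text \<open>On a finite set of times the past is, up to the null event \<open>B 0 \<noteq> 0\<close>, a function of finitely
  many increments, and these are independent of the increment that follows.\<close>

lemma indep_finite_past:
  assumes J: "finite J" "J \<subseteq> {0..s}" and s: "0 \<le> s" "s \<le> u"
    and E: "\<And>j. j \<in> J \<Longrightarrow> E j \<in> sets borel" and C: "C \<in> sets borel"
  shows "prob ({\<omega>\<in>space M. \<forall>j\<in>J. B j \<omega> \<in> E j} \<inter> {\<omega>\<in>space M. B u \<omega> - B s \<omega> \<in> C}) =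
         prob {\<omega>\<in>space M. \<forall>j\<in>J. B j \<omega> \<in> E j} * prob {\<omega>\<in>space M. B u \<omega> - B s \<omega> \<in> C}"
proof -
  define xs where "xs = sorted_list_of_set (insert 0 (insert s J))"
  define n where "n = length xs - 1"
  define \<tau> where "\<tau> i = (if i \<le> n then xs ! i else u)" for i
  have fin: "finite (insert 0 (insert s J))" using J by simp
  have set_xs: "set xs = insert 0 (insert s J)" unfolding xs_def by (rule set_sorted_list_of_set[OF fin])
  have sorted: "sorted xs" unfolding xs_def by simp
  have len: "length xs = Suc n" using set_xs by (cases xs) (auto simp: n_def)
  have range: "x \<in> {0..s}" if "x \<in> set xs" for x using that J s by (auto simp: set_xs)
  have mono: "mono_on {..Suc n} \<tau>"
  proof (rule mono_onI)
    fix i j assume ij: "i \<in> {..Suc n}" "j \<in> {..Suc n}" "i \<le> j"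
    show "\<tau> i \<le> \<tau> j"
    proof (cases "j \<le> n")
      case True then show ?thesis using ij sorted len by (auto simp: \<tau>_def sorted_iff_nth_mono)
    next
      case False
      have "\<tau> i \<le> u" using range[of "xs ! i"] s len by (auto simp: \<tau>_def)
      then show ?thesis using False by (simp add: \<tau>_def)
    qed
  qed
  have t0: "\<tau> 0 = 0"
  proof -
    obtain i where i: "i < length xs" "xs ! i = 0" using set_xs by (metis in_set_conv_nth insertI1)
    have "xs ! 0 \<le> xs ! i" using sorted i by (intro sorted_nth_mono) auto
    moreover have "0 \<le> xs ! 0" using range[of "xs ! 0"] len by auto
    ultimately show ?thesis using i by (simp add: \<tau>_def)
  qed
  have tn: "\<tau> n = s"
  proof -
    obtain i where i: "i < length xs" "xs ! i = s" using set_xs by (metis in_set_conv_nth insertI1 insertI2)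
    have "xs ! i \<le> xs ! n" using sorted i len by (auto simp: sorted_iff_nth_mono)
    moreover have "xs ! n \<le> s" using range[of "xs ! n"] len by auto
    ultimately show ?thesis using i by (simp add: \<tau>_def)
  qed
  have tSn: "\<tau> (Suc n) = u" by (simp add: \<tau>_def)
  let ?D = "\<lambda>i \<omega>. B (\<tau> (Suc i)) \<omega> - B (\<tau> i) \<omega>"
  have ind: "indep_vars (\<lambda>_. borel) ?D {..<Suc n}" by (rule B_indep[OF _ mono]) (simp add: t0)
  have "\<forall>j\<in>J. \<exists>i. i \<le> n \<and> \<tau> i = j"
  proof
    fix j assume "j \<in> J"
    then obtain i where "i < length xs" "xs ! i = j" using set_xs by (metis in_set_conv_nth insertCI)
    then show "\<exists>i. i \<le> n \<and> \<tau> i = j" using len by (auto simp: \<tau>_def)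
  qed
  then obtain k where k: "\<And>j. j \<in> J \<Longrightarrow> k j \<le> n" "\<And>j. j \<in> J \<Longrightarrow> \<tau> (k j) = j" by metis
  have tele: "\<forall>m \<omega>. (\<Sum>i<m. ?D i \<omega>) = B (\<tau> m) \<omega> - B 0 \<omega>"
    using sum_lessThan_telescope[of "\<lambda>i. B (\<tau> i) _"] t0 by simp
  let ?X = "\<lambda>\<omega>. restrict (\<lambda>i. ?D i \<omega>) {..<n}" and ?Y = "\<lambda>\<omega>. restrict (\<lambda>i. ?D i \<omega>) {n}"
  have iv: "indep_var (PiM {..<n} (\<lambda>_. borel)) ?X (PiM {n} (\<lambda>_. borel)) ?Y"
    by (rule indep_var_restrict[OF ind]) auto
  let ?A = "{x \<in> space (PiM {..<n} (\<lambda>_. borel)). \<forall>j\<in>J. (\<Sum>i<k j. x i) \<in> E j}"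
  let ?C = "{x \<in> space (PiM {n} (\<lambda>_. borel)). x n \<in> C}"
  have A: "?A \<in> sets (PiM {..<n} (\<lambda>_. borel))"
  proof (intro sets.sets_Collect_finite_All J(1))
    fix j assume "j \<in> J"
    then have [measurable]: "(\<lambda>x::nat \<Rightarrow> real. \<Sum>i<k j. x i) \<in> borel_measurable (PiM {..<n} (\<lambda>_. borel))"
    proof -
      have "(\<lambda>x. x i) \<in> borel_measurable (PiM {..<n} (\<lambda>_. borel :: real measure))" if "i \<in> {..<k j}" for i
        using that k(1)[OF \<open>j \<in> J\<close>] by (intro measurable_component_singleton[of i "{..<n}" "\<lambda>_. borel"]) auto
      from borel_measurable_sum[of "{..<k j}" "\<lambda>i x. x i", OF this] show ?thesis by simp
    qed
    have [measurable]: "E j \<in> sets borel" using E \<open>j \<in> J\<close> by blast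
    show "{x \<in> space (PiM {..<n} (\<lambda>_. borel)). (\<Sum>i<k j. x i) \<in> E j} \<in> sets (PiM {..<n} (\<lambda>_. borel))"
      by measurable
  qed
  have C': "?C \<in> sets (PiM {n} (\<lambda>_. borel))"
  proof -
    have [measurable]: "(\<lambda>x. x n) \<in> borel_measurable (PiM {n} (\<lambda>_. borel :: real measure))" "C \<in> sets borel"
      using C by (auto intro: measurable_component_singleton)
    show ?thesis by measurable
  qed
  have m: "(\<lambda>\<omega>. B j \<omega>) \<in> borel_measurable M" if "j \<in> J" for j using J that by (intro B_meas) auto
  have mi: "(\<lambda>\<omega>. B r \<omega> - B v \<omega>) \<in> borel_measurable M" if "0 \<le> r" "0 \<le> v" for r v
    using B_meas that by auto
  have Xe: "?X -` ?A \<inter> space M = {\<omega>\<in>space M. \<forall>j\<in>J. B j \<omega> - B 0 \<omega> \<in> E j}"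
  proof -
    have "(\<Sum>i<k j. ?X \<omega> i) = B j \<omega> - B 0 \<omega>" if "j \<in> J" for j \<omega>
    proof -
      have "(\<Sum>i<k j. ?X \<omega> i) = (\<Sum>i<k j. ?D i \<omega>)"
        using k(1)[OF that] by (intro sum.cong) auto
      then show ?thesis using tele k(2)[OF that] by simp
    qed
    then show ?thesis by (auto simp: space_PiM)
  qed
  have Ye: "?Y -` ?C \<inter> space M = {\<omega>\<in>space M. B u \<omega> - B s \<omega> \<in> C}"
    by (auto simp: space_PiM tn tSn)
  have main: "prob ({\<omega>\<in>space M. \<forall>j\<in>J. B j \<omega> - B 0 \<omega> \<in> E j} \<inter> {\<omega>\<in>space M. B u \<omega> - B s \<omega> \<in> C}) =
         prob {\<omega>\<in>space M. \<forall>j\<in>J. B j \<omega> - B 0 \<omega> \<in> E j} * prob {\<omega>\<in>space M. B u \<omega> - B s \<omega> \<in> C}"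
  proof -
    have "(\<lambda>\<omega>. (?X \<omega>, ?Y \<omega>)) -` (?A \<times> ?C) \<inter> space M = (?X -` ?A \<inter> space M) \<inter> (?Y -` ?C \<inter> space M)"
      by blast
    with indep_varD[OF iv A C'] show ?thesis unfolding Xe Ye by (simp only:)
  qed
  have ev: "{\<omega>\<in>space M. \<forall>j\<in>J. F j \<omega> \<in> E j} \<in> events" if "\<And>j. j \<in> J \<Longrightarrow> F j \<in> borel_measurable M" for F
  proof (intro sets.sets_Collect_finite_All J(1))
    fix j assume "j \<in> J"
    then have [measurable]: "F j \<in> borel_measurable M" "E j \<in> sets borel" using that E by auto
    show "{\<omega>\<in>space M. F j \<omega> \<in> E j} \<in> events" by measurable
  qed
  have e1: "{\<omega>\<in>space M. \<forall>j\<in>J. B j \<omega> - B 0 \<omega> \<in> E j} \<in> events"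
    using J by (intro ev mi) auto
  have e2: "{\<omega>\<in>space M. \<forall>j\<in>J. B j \<omega> \<in> E j} \<in> events"
    by (intro ev m)
  have e3: "{\<omega>\<in>space M. B u \<omega> - B s \<omega> \<in> C} \<in> events"
  proof -
    have [measurable]: "(\<lambda>\<omega>. B u \<omega> - B s \<omega>) \<in> borel_measurable M" "C \<in> sets borel" using s C by (auto intro!: mi)
    show ?thesis by measurable
  qed
  have "prob {\<omega>\<in>space M. \<forall>j\<in>J. B j \<omega> - B 0 \<omega> \<in> E j} = prob {\<omega>\<in>space M. \<forall>j\<in>J. B j \<omega> \<in> E j}"
    using B_zero by (intro finite_measure_eq_AE e1 e2) auto
  moreover have "prob ({\<omega>\<in>space M. \<forall>j\<in>J. B j \<omega> - B 0 \<omega> \<in> E j} \<inter> {\<omega>\<in>space M. B u \<omega> - B s \<omega> \<in> C}) =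
      prob ({\<omega>\<in>space M. \<forall>j\<in>J. B j \<omega> \<in> E j} \<inter> {\<omega>\<in>space M. B u \<omega> - B s \<omega> \<in> C})"
    using B_zero by (intro finite_measure_eq_AE sets.Int e1 e2 e3) auto
  ultimately show ?thesis using main by simp
qed

text \<open>The cylinder sets over finitely many times form an intersection-stable generator.\<close>

lemma indep_history_increment:
  assumes s: "0 \<le> s" "s \<le> u"
  shows "indep_set (sets (history M B s)) {(\<lambda>\<omega>. B u \<omega> - B s \<omega>) -` C \<inter> space M | C. C \<in> sets borel}"
proof -
  let ?p = "\<lambda>\<omega>. \<lambda>r\<in>{0..s}. B r \<omega>" and ?P = "PiM {0..s} (\<lambda>_. borel :: real measure)"
  let ?G = "{?p -` A \<inter> space M | A. A \<in> prod_algebra {0..s} (\<lambda>_. borel :: real measure)}"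
  let ?H = "{(\<lambda>\<omega>. B u \<omega> - B s \<omega>) -` C \<inter> space M | C. C \<in> sets borel}"
  have pm: "?p \<in> M \<rightarrow>\<^sub>M ?P" using s by (intro measurable_restrict B_meas) auto
  have d: "(\<lambda>\<omega>. B u \<omega> - B s \<omega>) \<in> borel_measurable M" using s B_meas by auto
  have "indep_set ?G ?H"
    unfolding indep_sets2_eq
  proof (intro conjI ballI)
    show "?G \<subseteq> events"
      using measurable_sets[OF pm] by (auto simp: sets_PiM)
    show "?H \<subseteq> events" using measurable_sets[OF d] by auto
    fix a b assume "a \<in> ?G" "b \<in> ?H"
    then obtain A C where A: "A \<in> prod_algebra {0..s} (\<lambda>_. borel :: real measure)" "a = ?p -` A \<inter> space M"
      and C: "C \<in> sets borel" "b = (\<lambda>\<omega>. B u \<omega> - B s \<omega>) -` C \<inter> space M" by auto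
    from A(1) obtain J E where J: "A = prod_emb {0..s} (\<lambda>_. borel) J (Pi\<^sub>E J E)" "finite J" "J \<subseteq> {0..s}"
      "\<And>j. j \<in> J \<Longrightarrow> E j \<in> sets (borel :: real measure)"
      by (elim prod_algebraE) auto
    have "a = {\<omega>\<in>space M. \<forall>j\<in>J. B j \<omega> \<in> E j}"
      using J(3) unfolding A(2) J(1) by (auto simp: prod_emb_def space_PiM PiE_iff subset_eq)
    moreover have "b = {\<omega>\<in>space M. B u \<omega> - B s \<omega> \<in> C}" using C by auto
    ultimately show "prob (a \<inter> b) = prob a * prob b"
      using indep_finite_past[OF J(2,3) s J(4) C(1)] by simp
  qed
  moreover have "Int_stable ?G"
  proof (rule Int_stableI)
    fix a b assume "a \<in> ?G" "b \<in> ?G"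
    then obtain A A' where "A \<in> prod_algebra {0..s} (\<lambda>_. borel :: real measure)" "a = ?p -` A \<inter> space M"
       "A' \<in> prod_algebra {0..s} (\<lambda>_. borel :: real measure)" "b = ?p -` A' \<inter> space M" by auto
    then show "a \<inter> b \<in> ?G"
      using Int_stable_prod_algebra[of "{0..s}" "\<lambda>_. borel :: real measure"]
      by (auto simp: Int_stable_def intro!: exI[of _ "A \<inter> A'"])
  qed
  moreover have "Int_stable ?H"
  proof (rule Int_stableI)
    fix a b assume "a \<in> ?H" "b \<in> ?H"
    then obtain C C' where "C \<in> sets (borel::real measure)" "a = (\<lambda>\<omega>. B u \<omega> - B s \<omega>) -` C \<inter> space M"
       "C' \<in> sets (borel::real measure)" "b = (\<lambda>\<omega>. B u \<omega> - B s \<omega>) -` C' \<inter> space M" by auto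
    then show "a \<inter> b \<in> ?H" by (auto intro!: exI[of _ "C \<inter> C'"])
  qed
  ultimately have *: "indep_set (sigma_sets (space M) ?G) (sigma_sets (space M) ?H)"
    by (rule indep_set_sigma_sets)
  have "sigma_sets (space M) ?G = {?p -` A \<inter> space M | A. A \<in> sigma_sets (\<Pi>\<^sub>E i\<in>{0..s}. UNIV) (prod_algebra {0..s} (\<lambda>_. borel :: real measure))}"
    by (rule sigma_sets_vimage_commute[symmetric]) auto
  also have "\<dots> = sets (history M B s)" by (simp add: sets_history sets_PiM)
  finally have "sigma_sets (space M) ?G = sets (history M B s)" .
  with * have **: "indep_set (sets (history M B s)) (sigma_sets (space M) ?H)" by simp
  show ?thesis
    unfolding indep_sets2_eq
  proof (intro conjI ballI)
    show "sets (history M B s) \<subseteq> events" using ** unfolding indep_sets2_eq by blast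
    show "?H \<subseteq> events" using measurable_sets[OF d] by auto
    fix a b assume "a \<in> sets (history M B s)" "b \<in> ?H"
    then show "prob (a \<inter> b) = prob a * prob b"
      using ** sigma_sets.Basic[of b ?H] unfolding indep_sets2_eq by blast
  qed
qed

end

text \<open>Lets a sub-sigma-algebra serve as the target of a random variable, namely of the identity.\<close>

lemma measurable_id_subalgebra:
  assumes "space G = space M" "sets G \<subseteq> sets M"
  shows "(\<lambda>\<omega>. \<omega>) \<in> M \<rightarrow>\<^sub>M G"
proof (rule measurableI)
  fix A assume A: "A \<in> sets G"
  then have "A \<subseteq> space M" using sets.sets_into_space assms(1) by metis
  then show "(\<lambda>\<omega>. \<omega>) -` A \<inter> space M \<in> sets M" using A assms(2) by (simp add: Int_absorb2 subset_eq)
qed (simp add: assms)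

lemma (in prob_space) indep_set_distr_pair:
  assumes G: "space G = space M" "sets G \<subseteq> events" and D: "D \<in> M \<rightarrow>\<^sub>M N"
    and ind: "indep_set (sets G) {D -` C \<inter> space M | C. C \<in> sets N}"
  shows "distr M (G \<Otimes>\<^sub>M N) (\<lambda>\<omega>. (\<omega>, D \<omega>)) = distr M G (\<lambda>\<omega>. \<omega>) \<Otimes>\<^sub>M distr M N D"
proof -
  have id: "(\<lambda>\<omega>. \<omega>) \<in> M \<rightarrow>\<^sub>M G"
    by (rule measurable_id_subalgebra[OF G])
  interpret G': prob_space "distr M G (\<lambda>\<omega>. \<omega>)" by (rule prob_space_distr[OF id])
  interpret D': prob_space "distr M N D" by (rule prob_space_distr[OF D])
  have p: "(\<lambda>\<omega>. (\<omega>, D \<omega>)) \<in> M \<rightarrow>\<^sub>M G \<Otimes>\<^sub>M N" using id D by measurable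
  show ?thesis
  proof (rule pair_measure_eqI[symmetric])
    show "sigma_finite_measure (distr M G (\<lambda>\<omega>. \<omega>))" ..
    show "sigma_finite_measure (distr M N D)" ..
    show "sets (distr M G (\<lambda>\<omega>. \<omega>) \<Otimes>\<^sub>M distr M N D) = sets (distr M (G \<Otimes>\<^sub>M N) (\<lambda>\<omega>. (\<omega>, D \<omega>)))"
      by (simp cong: sets_pair_measure_cong)
    fix A C assume "A \<in> sets (distr M G (\<lambda>\<omega>. \<omega>))" "C \<in> sets (distr M N D)"
    then have AC: "A \<in> sets G" "C \<in> sets N" by auto
    have As: "A \<subseteq> space M" using sets.sets_into_space[OF AC(1)] G by simp
    have "prob (A \<inter> (D -` C \<inter> space M)) = prob A * prob (D -` C \<inter> space M)"
      using ind AC unfolding indep_sets2_eq by blast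
    moreover have "(\<lambda>\<omega>. (\<omega>, D \<omega>)) -` (A \<times> C) \<inter> space M = A \<inter> (D -` C \<inter> space M)" using As by auto
    ultimately show "emeasure (distr M G (\<lambda>\<omega>. \<omega>)) A * emeasure (distr M N D) C =
        emeasure (distr M (G \<Otimes>\<^sub>M N) (\<lambda>\<omega>. (\<omega>, D \<omega>))) (A \<times> C)"
      using AC As by (simp add: emeasure_distr id D p emeasure_eq_measure Int_absorb2 ennreal_mult'')
  qed
qed

text \<open>Integrating out a random variable that is independent of the sigma-algebra \<open>G\<close>, while the
  remaining dependence on the point \<open>\<omega>\<close> is \<open>G\<close>-measurable: Fubini for the joint law of the identity and
  of \<open>D\<close>, which is a product.\<close>

lemma (in prob_space) indep_set_integral:
  fixes f :: "'a \<times> 'c \<Rightarrow> real"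
  assumes G: "space G = space M" "sets G \<subseteq> events" and D: "D \<in> M \<rightarrow>\<^sub>M N"
    and ind: "indep_set (sets G) {D -` C \<inter> space M | C. C \<in> sets N}"
    and f[measurable]: "f \<in> borel_measurable (G \<Otimes>\<^sub>M N)" and b: "\<And>p. p \<in> space (G \<Otimes>\<^sub>M N) \<Longrightarrow> \<bar>f p\<bar> \<le> c"
  shows "(\<integral>\<omega>. f (\<omega>, D \<omega>) \<partial>M) = (\<integral>\<omega>. (\<integral>z. f (\<omega>, z) \<partial>distr M N D) \<partial>M)"
proof -
  have id: "(\<lambda>\<omega>. \<omega>) \<in> M \<rightarrow>\<^sub>M G"
    by (rule measurable_id_subalgebra[OF G])
  interpret G': prob_space "distr M G (\<lambda>\<omega>. \<omega>)" by (rule prob_space_distr[OF id])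
  interpret D': prob_space "distr M N D" by (rule prob_space_distr[OF D])
  interpret P: pair_prob_space "distr M G (\<lambda>\<omega>. \<omega>)" "distr M N D" ..
  have p: "(\<lambda>\<omega>. (\<omega>, D \<omega>)) \<in> M \<rightarrow>\<^sub>M G \<Otimes>\<^sub>M N" using id D by measurable
  have fm: "f \<in> borel_measurable (distr M G (\<lambda>\<omega>. \<omega>) \<Otimes>\<^sub>M distr M N D)"
    using f by (simp cong: measurable_cong_sets sets_pair_measure_cong)
  have sp: "space (distr M G (\<lambda>\<omega>. \<omega>) \<Otimes>\<^sub>M distr M N D) = space (G \<Otimes>\<^sub>M N)" by (simp add: space_pair_measure)
  have int: "integrable (distr M G (\<lambda>\<omega>. \<omega>) \<Otimes>\<^sub>M distr M N D) f"
    by (rule P.integrable_const_bound[of _ c]) (use b fm in \<open>auto intro!: AE_I2 simp: sp\<close>)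
  have m: "(\<lambda>\<omega>. \<integral>z. f (\<omega>, z) \<partial>distr M N D) \<in> borel_measurable G"
  proof -
    have "(\<lambda>(\<omega>, z). f (\<omega>, z)) \<in> borel_measurable (G \<Otimes>\<^sub>M distr M N D)"
      using f by (simp cong: measurable_cong_sets sets_pair_measure_cong)
    then show ?thesis by (rule D'.borel_measurable_lebesgue_integral)
  qed
  have "(\<integral>\<omega>. f (\<omega>, D \<omega>) \<partial>M) = (\<integral>q. f q \<partial>distr M (G \<Otimes>\<^sub>M N) (\<lambda>\<omega>. (\<omega>, D \<omega>)))"
    by (subst integral_distr[OF p]) auto
  also have "\<dots> = (\<integral>\<omega>. (\<integral>z. f (\<omega>, z) \<partial>distr M N D) \<partial>distr M G (\<lambda>\<omega>. \<omega>))"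
    unfolding indep_set_distr_pair[OF G D ind] by (rule P.integral_fst'[symmetric, OF int])
  also have "\<dots> = (\<integral>\<omega>. (\<integral>z. f (\<omega>, z) \<partial>distr M N D) \<partial>M)"
    by (rule integral_distr[OF id m])
  finally show "(\<integral>\<omega>. f (\<omega>, D \<omega>) \<partial>M) = (\<integral>\<omega>. (\<integral>z. f (\<omega>, z) \<partial>distr M N D) \<partial>M)" .
qed

text \<open>A Gaussian average written against the standard normal law, so that it depends on the
  time \<open>h\<close> through a scaling only.\<close>

definition heat :: "real \<Rightarrow> (real \<Rightarrow> real) \<Rightarrow> real \<Rightarrow> real" where
  "heat h g x = (\<integral>z. g (x + sqrt h * z) \<partial>std_normal_distribution)"

context brownian_motion
begin

lemma increment_std_normal:
  assumes "0 \<le> s" "s < u"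
  shows "distr M borel (\<lambda>\<omega>. B u \<omega> - B s \<omega>) = distr std_normal_distribution borel (\<lambda>z. sqrt (u - s) * z)"
proof -
  have d: "distributed M lborel (\<lambda>\<omega>. B u \<omega> - B s \<omega>) (normal_density 0 (sqrt (u - s)))"
    by (rule B_incr[OF assms])
  interpret S: real_distribution std_normal_distribution by (rule real_dist_normal_dist)
  have "distributed std_normal_distribution lborel (\<lambda>z. z) std_normal_density"
    by (auto simp: distributed_def distr_id2)
  from S.normal_density_affine[OF this, of "sqrt (u - s)" 0] assms
  have d2: "distributed std_normal_distribution lborel (\<lambda>z. sqrt (u - s) * z) (normal_density 0 (sqrt (u - s)))"
    by simp
  have "distr M borel (\<lambda>\<omega>. B u \<omega> - B s \<omega>) = distr M lborel (\<lambda>\<omega>. B u \<omega> - B s \<omega>)"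
    by (rule distr_cong) auto
  also have "\<dots> = distr std_normal_distribution lborel (\<lambda>z. sqrt (u - s) * z)"
    using distributed_distr_eq_density[OF d] distributed_distr_eq_density[OF d2] by simp
  also have "\<dots> = distr std_normal_distribution borel (\<lambda>z. sqrt (u - s) * z)"
    by (rule distr_cong) auto
  finally show ?thesis .
qed

lemma markov:
  assumes s: "0 \<le> s" "s < u" and Y: "Y \<in> borel_measurable (history M B s)" "\<And>\<omega>. \<omega> \<in> space M \<Longrightarrow> \<bar>Y \<omega>\<bar> \<le> c"
    and g: "g \<in> borel_measurable borel" "\<And>x. \<bar>g x\<bar> \<le> d"
  shows "(\<integral>\<omega>. Y \<omega> * g (B u \<omega>) \<partial>M) = (\<integral>\<omega>. Y \<omega> * heat (u - s) g (B s \<omega>) \<partial>M)"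
proof -
  let ?H = "history M B s" and ?D = "\<lambda>\<omega>. B u \<omega> - B s \<omega>"
  note [measurable] = g(1) Y(1)
  have sub: "sets ?H \<subseteq> events" by (intro sets_history_subset_events B_meas)
  have D: "?D \<in> M \<rightarrow>\<^sub>M borel" using s B_meas by auto
  have [measurable]: "B s \<in> borel_measurable ?H" using s by (intro measurable_history) auto
  have b: "\<bar>Y (fst p) * g (B s (fst p) + snd p)\<bar> \<le> c * d" if "p \<in> space (?H \<Otimes>\<^sub>M borel)" for p
  proof -
    have "fst p \<in> space M" using that by (auto simp: space_pair_measure)
    from mult_mono'[OF Y(2)[OF this] g(2)] show ?thesis by (simp add: abs_mult)
  qed
  have "(\<integral>\<omega>. Y \<omega> * g (B u \<omega>) \<partial>M) = (\<integral>\<omega>. (\<lambda>p. Y (fst p) * g (B s (fst p) + snd p)) (\<omega>, ?D \<omega>) \<partial>M)"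
    by simp
  also have "\<dots> = (\<integral>\<omega>. (\<integral>z. Y \<omega> * g (B s \<omega> + z) \<partial>distr M borel ?D) \<partial>M)"
    by (subst indep_set_integral[where f = "\<lambda>p. Y (fst p) * g (B s (fst p) + snd p)",
          OF space_history sub D indep_history_increment[OF s(1) less_imp_le[OF s(2)]] _ b])
       simp_all
  also have "\<dots> = (\<integral>\<omega>. Y \<omega> * heat (u - s) g (B s \<omega>) \<partial>M)"
    unfolding heat_def increment_std_normal[OF s]
    by (subst integral_distr) auto
  finally show ?thesis .
qed

lemma B_law:
  fixes f :: "real \<Rightarrow> real"
  assumes "u > 0" "f \<in> borel_measurable borel"
  shows "(\<integral>\<omega>. f (B u \<omega>) \<partial>M) = (\<integral>z. f (sqrt u * z) \<partial>std_normal_distribution)"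
proof -
  note [measurable] = assms(2)
  have [measurable]: "B u \<in> borel_measurable M" "B 0 \<in> borel_measurable M" using assms by (auto intro!: B_meas)
  have "(\<integral>\<omega>. f (B u \<omega>) \<partial>M) = (\<integral>\<omega>. f (B u \<omega> - B 0 \<omega>) \<partial>M)"
    using B_zero by (intro integral_cong_AE) auto
  also have "\<dots> = (\<integral>z. f z \<partial>distr M borel (\<lambda>\<omega>. B u \<omega> - B 0 \<omega>))"
    by (rule integral_distr[symmetric]) auto
  also have "\<dots> = (\<integral>z. f (sqrt u * z) \<partial>std_normal_distribution)"
    using increment_std_normal[OF order_refl \<open>u > 0\<close>] by (simp add: integral_distr)
  finally show ?thesis .
qed

end


section \<open>Gaussian averages and occupation integrals\<close>

lemma std_normal_moments:
  "integrable std_normal_distribution (\<lambda>z. z)" "(\<integral>z. z \<partial>std_normal_distribution) = 0"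
  "integrable std_normal_distribution (\<lambda>z. z\<^sup>2)" "(\<integral>z. z\<^sup>2 \<partial>std_normal_distribution) = 1"
proof -
  have 1: "has_bochner_integral lborel (\<lambda>x. std_normal_density x * x) 0"
    using std_normal_moment_odd[of 0] by simp
  have 2: "has_bochner_integral lborel (\<lambda>x. std_normal_density x * x\<^sup>2) 1"
    using std_normal_moment_even[of 1] by (simp add: fact_numeral)
  show "integrable std_normal_distribution (\<lambda>z. z)" "(\<integral>z. z \<partial>std_normal_distribution) = 0"
    using 1 by (auto simp: integrable_density integral_density has_bochner_integral_iff)
  show "integrable std_normal_distribution (\<lambda>z. z\<^sup>2)" "(\<integral>z. z\<^sup>2 \<partial>std_normal_distribution) = 1"
    using 2 by (auto simp: integrable_density integral_density has_bochner_integral_iff)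
qed

text \<open>Taylor's formula with Lagrange remainder, with the position of \<open>\<zeta>\<close> described uniformly for
  increments \<open>y\<close> of either sign and for \<open>y = 0\<close>.\<close>

lemma taylor_remainder:
  fixes g g' g'' :: "real \<Rightarrow> real"
  assumes "\<And>x. DERIV g x :> g' x" "\<And>x. DERIV g' x :> g'' x"
  obtains \<zeta> where "\<bar>\<zeta> - a\<bar> \<le> \<bar>y\<bar>" "g (a + y) = g a + g' a * y + g'' \<zeta> / 2 * y\<^sup>2"
proof (cases "y = 0")
  case True
  show ?thesis by (rule that[of a]) (use True in auto)
next
  case False
  define diff where "diff m = (if m = 0 then g else if m = 1 then g' else g'')" for m :: nat
  have "\<exists>t. (if a + y < a then a + y < t \<and> t < a else a < t \<and> t < a + y) \<and>
     g (a + y) = (\<Sum>m<2. diff m a / fact m * (a + y - a) ^ m) + diff 2 t / fact 2 * (a + y - a) ^ 2"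
    using False assms
    by (intro Taylor[where a = "a - \<bar>y\<bar>" and b = "a + \<bar>y\<bar>"])
       (auto simp: diff_def less_2_cases_iff)
  then obtain t where t: "if a + y < a then a + y < t \<and> t < a else a < t \<and> t < a + y"
    "g (a + y) = (\<Sum>m<2. diff m a / fact m * (a + y - a) ^ m) + diff 2 t / fact 2 * (a + y - a) ^ 2" by blast
  show ?thesis
  proof (rule that[of t])
    show "\<bar>t - a\<bar> \<le> \<bar>y\<bar>" using t(1) by (auto split: if_splits)
    show "g (a + y) = g a + g' a * y + g'' t / 2 * y\<^sup>2"
      using t(2) by (simp add: diff_def numeral_2_eq_2)
  qed
qed

locale bounded_C2 =
  fixes g g' g'' :: "real \<Rightarrow> real" and C K :: real
  assumes g1: "\<And>x. DERIV g x :> g' x" and g2: "\<And>x. DERIV g' x :> g'' x"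
    and cont2: "continuous_on UNIV g''" and bound0: "\<And>x. \<bar>g x\<bar> \<le> C" and bound2: "\<And>x. \<bar>g'' x\<bar> \<le> K"
begin

lemma cont0: "continuous_on UNIV g"
  using g1 by (auto simp: continuous_on_eq_continuous_at intro: DERIV_isCont)

lemma meas0[measurable]: "g \<in> borel_measurable borel"
  by (rule borel_measurable_continuous_onI[OF cont0])

lemma meas2[measurable]: "g'' \<in> borel_measurable borel"
  by (rule borel_measurable_continuous_onI[OF cont2])

text \<open>Second order Taylor remainder of \<open>g\<close> for a Gaussian step of variance \<open>h\<close>, divided by \<open>h\<close>. Its
  Gaussian mean is the difference quotient of the heat semigroup, as the linear term has mean \<open>0\<close>.\<close>

definition remainder :: "real \<Rightarrow> real \<Rightarrow> real \<Rightarrow> real" where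
  "remainder h x z = (g (x + sqrt h * z) - g x - g' x * (sqrt h * z)) / h"

lemma remainder_bound: "h > 0 \<Longrightarrow> \<bar>remainder h x z\<bar> \<le> K / 2 * z\<^sup>2"
proof -
  assume h: "h > 0"
  obtain \<zeta> where "g (x + sqrt h * z) = g x + g' x * (sqrt h * z) + g'' \<zeta> / 2 * (sqrt h * z)\<^sup>2"
    using taylor_remainder[OF g1 g2, of x "sqrt h * z"] by metis
  then have "remainder h x z = g'' \<zeta> / 2 * z\<^sup>2"
    using h by (simp add: remainder_def power_mult_distrib)
  then have "\<bar>remainder h x z\<bar> = \<bar>g'' \<zeta>\<bar> / 2 * z\<^sup>2" by (simp only: abs_mult abs_divide) simp
  also have "\<dots> \<le> K / 2 * z\<^sup>2" by (intro mult_right_mono divide_right_mono bound2) auto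
  finally show ?thesis .
qed

lemma remainder_tendsto:
  assumes h: "\<And>n. h n > 0" "h \<longlonglongrightarrow> 0" and x: "x \<longlonglongrightarrow> x0"
  shows "(\<lambda>n. remainder (h n) (x n) z) \<longlonglongrightarrow> g'' x0 / 2 * z\<^sup>2"
proof -
  have "\<forall>n. \<exists>\<zeta>. \<bar>\<zeta> - x n\<bar> \<le> \<bar>sqrt (h n) * z\<bar> \<and> remainder (h n) (x n) z = g'' \<zeta> / 2 * z\<^sup>2"
  proof
    fix n
    obtain \<zeta> where z: "\<bar>\<zeta> - x n\<bar> \<le> \<bar>sqrt (h n) * z\<bar>"
      "g (x n + sqrt (h n) * z) = g (x n) + g' (x n) * (sqrt (h n) * z) + g'' \<zeta> / 2 * (sqrt (h n) * z)\<^sup>2"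
      using taylor_remainder[OF g1 g2, of "x n" "sqrt (h n) * z"] by metis
    then have "remainder (h n) (x n) z = g'' \<zeta> / 2 * z\<^sup>2"
      using h(1)[of n] by (simp add: remainder_def power_mult_distrib)
    with z(1) show "\<exists>\<zeta>. \<bar>\<zeta> - x n\<bar> \<le> \<bar>sqrt (h n) * z\<bar> \<and> remainder (h n) (x n) z = g'' \<zeta> / 2 * z\<^sup>2" by blast
  qed
  then obtain \<zeta> where z: "\<And>n. \<bar>\<zeta> n - x n\<bar> \<le> \<bar>sqrt (h n) * z\<bar>" "\<And>n. remainder (h n) (x n) z = g'' (\<zeta> n) / 2 * z\<^sup>2"
    by metis
  have "(\<lambda>n. \<bar>sqrt (h n) * z\<bar>) \<longlonglongrightarrow> \<bar>sqrt 0 * z\<bar>" by (intro tendsto_intros h)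
  then have "(\<lambda>n. \<zeta> n - x n) \<longlonglongrightarrow> 0"
    by (intro tendsto_rabs_zero_cancel[of "\<lambda>n. \<zeta> n - x n"] tendsto_sandwich[of "\<lambda>_. 0" "\<lambda>n. \<bar>\<zeta> n - x n\<bar>" _ "\<lambda>n. \<bar>sqrt (h n) * z\<bar>" 0])
       (auto intro!: always_eventually z)
  from tendsto_add[OF this x] have "\<zeta> \<longlonglongrightarrow> x0" by simp
  then have "(\<lambda>n. g'' (\<zeta> n)) \<longlonglongrightarrow> g'' x0"
    using cont2 by (intro isCont_tendsto_compose[of x0 g'']) (auto simp: continuous_on_eq_continuous_at)
  then show ?thesis unfolding z(2) by (intro tendsto_intros) auto
qed

lemma integral_remainder:
  assumes "h > 0"
  shows "(\<integral>z. remainder h x z \<partial>std_normal_distribution) = (heat h g x - g x) / h"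
proof -
  interpret S: real_distribution std_normal_distribution by (rule real_dist_normal_dist)
  have i: "integrable std_normal_distribution (\<lambda>z. g (x + sqrt h * z))"
    by (rule S.integrable_const_bound[of _ C]) (auto intro!: bound0)
  have "(\<integral>z. remainder h x z \<partial>std_normal_distribution) =
     ((\<integral>z. g (x + sqrt h * z) - g x - g' x * (sqrt h * z) \<partial>std_normal_distribution)) / h"
    unfolding remainder_def by simp
  also have "(\<integral>z. g (x + sqrt h * z) - g x - g' x * (sqrt h * z) \<partial>std_normal_distribution) = heat h g x - g x"
    using i std_normal_moments(1,2) S.prob_space by (simp add: heat_def)
  finally show ?thesis .
qed

lemma remainder_meas[measurable]: "remainder h x \<in> borel_measurable borel"
  unfolding remainder_def[abs_def] by measurable

lemma heat_le: "\<bar>heat h g x\<bar> \<le> C"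
proof -
  interpret S: real_distribution std_normal_distribution by (rule real_dist_normal_dist)
  have C0: "0 \<le> C" using bound0[of 0] by linarith
  have "\<bar>heat h g x\<bar> \<le> (\<integral>z. \<bar>g (x + sqrt h * z)\<bar> \<partial>std_normal_distribution)"
    unfolding heat_def by (rule integral_abs_bound)
  also have "\<dots> \<le> (\<integral>z. C \<partial>std_normal_distribution)"
    by (intro integral_mono S.integrable_const_bound[of _ C]) (auto simp: bound0 C0)
  also have "\<dots> = C" using S.prob_space by simp
  finally show ?thesis .
qed

lemma heat_meas: "heat h g \<in> borel_measurable borel"
proof -
  interpret S: real_distribution std_normal_distribution by (rule real_dist_normal_dist)
  have "(\<lambda>(x, z). g (x + sqrt h * z)) \<in> borel_measurable (borel \<Otimes>\<^sub>M std_normal_distribution)"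
    by measurable
  from S.borel_measurable_lebesgue_integral[OF this] show ?thesis by (simp add: heat_def[abs_def])
qed

lemma heat_quotient_bound:
  assumes "h > 0"
  shows "\<bar>(heat h g x - g x) / h\<bar> \<le> K / 2"
proof -
  have i: "integrable std_normal_distribution (remainder h x)"
  proof (rule Bochner_Integration.integrable_bound[of _ "\<lambda>z. K / 2 * z\<^sup>2"])
    show "integrable std_normal_distribution (\<lambda>z. K / 2 * z\<^sup>2)" using std_normal_moments(3) by simp
    show "AE z in std_normal_distribution. norm (remainder h x z) \<le> norm (K / 2 * z\<^sup>2)"
      unfolding real_norm_def by (intro AE_I2 order_trans[OF remainder_bound[OF assms] abs_ge_self])
  qed simp
  have "\<bar>\<integral>z. remainder h x z \<partial>std_normal_distribution\<bar> \<le> (\<integral>z. \<bar>remainder h x z\<bar> \<partial>std_normal_distribution)"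
    by (rule integral_abs_bound)
  also have "\<dots> \<le> (\<integral>z. K / 2 * z\<^sup>2 \<partial>std_normal_distribution)"
    using i std_normal_moments(3) remainder_bound[OF assms] by (intro integral_mono) auto
  also have "\<dots> = K / 2" using std_normal_moments(4) by simp
  finally show ?thesis by (simp add: integral_remainder[OF assms])
qed

text \<open>The generator of the heat semigroup is \<open>g'' / 2\<close>. The base point may move with the step, because
  below it is a value of the path at a time that varies with \<open>h\<close>.\<close>

lemma heat_quotient_tendsto:
  assumes h: "\<And>n. h n > 0" "h \<longlonglongrightarrow> 0" and x: "x \<longlonglongrightarrow> x0"
  shows "(\<lambda>n. (heat (h n) g (x n) - g (x n)) / h n) \<longlonglongrightarrow> g'' x0 / 2"
proof -
  have "(\<lambda>n. \<integral>z. remainder (h n) (x n) z \<partial>std_normal_distribution) \<longlonglongrightarrow> (\<integral>z. g'' x0 / 2 * z\<^sup>2 \<partial>std_normal_distribution)"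
  proof (rule integral_dominated_convergence[where w = "\<lambda>z. K / 2 * z\<^sup>2"])
    show "integrable std_normal_distribution (\<lambda>z. K / 2 * z\<^sup>2)" using std_normal_moments(3) by simp
    show "AE z in std_normal_distribution. (\<lambda>n. remainder (h n) (x n) z) \<longlonglongrightarrow> g'' x0 / 2 * z\<^sup>2"
      by (intro AE_I2 remainder_tendsto assms)
    show "AE z in std_normal_distribution. norm (remainder (h n) (x n) z) \<le> K / 2 * z\<^sup>2" for n
      by (intro AE_I2) (simp only: real_norm_def remainder_bound[OF h(1)])
  qed auto
  then show ?thesis using std_normal_moments(4) by (simp add: integral_remainder[OF h(1)])
qed

end

text \<open>Functionals of the occupation measure of the path up to time \<open>u\<close>.\<close>

definition (in brownian_motion) occ :: "(real \<Rightarrow> real) \<Rightarrow> real \<Rightarrow> 'a \<Rightarrow> real" where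
  "occ c u \<omega> = (LINT v:{0..u}|lborel. c (B v \<omega>))"

locale occupation = brownian_motion +
  fixes c :: "real \<Rightarrow> real" and Cc :: real
  assumes c_cont: "continuous_on UNIV c" and c_nonneg: "\<And>x. 0 \<le> c x" and c_le: "\<And>x. c x \<le> Cc"
begin

lemma cB_cont: "\<omega> \<in> space M \<Longrightarrow> continuous_on {0..} (\<lambda>v. c (B v \<omega>))"
  using continuous_on_compose2[OF c_cont B_cont] by auto

lemma c_meas[measurable]: "c \<in> borel_measurable borel"
  by (rule borel_measurable_continuous_onI[OF c_cont])

lemma occ_eq_integral:
  assumes "\<omega> \<in> space M"
  shows "occ c u \<omega> = integral {0..u} (\<lambda>v. c (B v \<omega>))" "set_integrable lborel {0..u} (\<lambda>v. c (B v \<omega>))"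
proof -
  have c: "continuous_on {0..u} (\<lambda>v. c (B v \<omega>))"
    by (rule continuous_on_subset[OF cB_cont[OF assms]]) auto
  show i: "set_integrable lborel {0..u} (\<lambda>v. c (B v \<omega>))"
    unfolding set_integrable_def using borel_integrable_atLeastAtMost'[OF c] by (simp add: set_integrable_def)
  show "occ c u \<omega> = integral {0..u} (\<lambda>v. c (B v \<omega>))"
    unfolding occ_def by (rule set_borel_integral_eq_integral(2)[OF i])
qed

lemma occ_nonneg: "0 \<le> occ c u \<omega>"
  unfolding occ_def set_lebesgue_integral_def using c_nonneg by (intro integral_nonneg_AE AE_I2) auto

lemma occ_deriv:
  assumes "\<omega> \<in> space M" "u > 0"
  shows "((\<lambda>r. occ c r \<omega>) has_real_derivative c (B u \<omega>)) (at u)"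
proof -
  have c: "continuous_on {0..u+1} (\<lambda>v. c (B v \<omega>))"
    by (rule continuous_on_subset[OF cB_cont[OF assms(1)]]) auto
  have "((\<lambda>r. integral {0..r} (\<lambda>v. c (B v \<omega>))) has_real_derivative c (B u \<omega>)) (at u within {0..u+1})"
    using assms by (intro integral_has_real_derivative[OF c]) auto
  moreover have "at u within {0..u+1} = at u" using assms by (intro at_within_interior) auto
  ultimately show ?thesis using occ_eq_integral(1)[OF assms(1)] by simp
qed

lemma occ_increment:
  assumes "\<omega> \<in> space M" "0 \<le> a" "a \<le> b"
  shows "occ c a \<omega> \<le> occ c b \<omega>" "occ c b \<omega> - occ c a \<omega> \<le> Cc * (b - a)"
proof -
  have "(\<lambda>v. c (B v \<omega>)) integrable_on {0..b}"
    by (intro integrable_continuous_interval continuous_on_subset[OF cB_cont[OF assms(1)]]) auto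
  then have eq: "occ c b \<omega> = occ c a \<omega> + integral {a..b} (\<lambda>v. c (B v \<omega>))"
    using Henstock_Kurzweil_Integration.integral_combine[OF assms(2,3)] occ_eq_integral(1)[OF assms(1)] by metis
  have i: "(\<lambda>v. c (B v \<omega>)) integrable_on {a..b}"
    using assms by (intro integrable_continuous_interval continuous_on_subset[OF cB_cont[OF assms(1)]]) auto
  have "0 \<le> integral {a..b} (\<lambda>v. c (B v \<omega>))" by (rule Henstock_Kurzweil_Integration.integral_nonneg[OF i]) (simp add: c_nonneg)
  then show "occ c a \<omega> \<le> occ c b \<omega>" using eq by simp
  have "integral {a..b} (\<lambda>v. c (B v \<omega>)) \<le> integral {a..b} (\<lambda>v. Cc)"
    by (rule integral_le[OF i]) (auto simp: c_le)
  then show "occ c b \<omega> - occ c a \<omega> \<le> Cc * (b - a)" using eq assms by (simp add: mult.commute)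
qed

text \<open>The path up to time \<open>u\<close>, evaluated at the clamped time \<open>max 0 (min u v)\<close>, is jointly measurable
  in \<open>(\<omega>, v)\<close> as a limit of step functions in \<open>v\<close>; then the parameter \<open>v\<close> is integrated out.\<close>

lemma occ_adapted: "occ c u \<in> borel_measurable (history M B u)"
proof (cases "u \<ge> 0")
  case False
  then show ?thesis unfolding occ_def[abs_def] set_lebesgue_integral_def by simp
next
  case True
  let ?H = "history M B u"
  let ?clamp = "\<lambda>v. max 0 (min u v)"
  let ?step = "\<lambda>n (p::'a \<times> real). B (?clamp (real_of_int \<lfloor>real (Suc n) * snd p\<rfloor> / real (Suc n))) (fst p)"
  have m: "(\<lambda>p. B (?clamp (snd p)) (fst p)) \<in> borel_measurable (?H \<Otimes>\<^sub>M lborel)"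
  proof (rule borel_measurable_LIMSEQ_metric)
    fix n
    show "?step n \<in> borel_measurable (?H \<Otimes>\<^sub>M lborel)"
    proof (rule measurable_compose_countable[where g = "\<lambda>p::'a \<times> real. \<lfloor>real (Suc n) * snd p\<rfloor>" and f = "\<lambda>i p. B (?clamp (real_of_int i / real (Suc n))) (fst p)"])
      show "(\<lambda>p. B (?clamp (real_of_int i / real (Suc n))) (fst p)) \<in> borel_measurable (?H \<Otimes>\<^sub>M lborel)" for i
        using True by (intro measurable_compose[OF measurable_fst measurable_history]) auto
    qed measurable
  next
    fix p :: "'a \<times> real" assume "p \<in> space (?H \<Otimes>\<^sub>M lborel)"
    then have w: "fst p \<in> space M" by (auto simp: space_pair_measure)
    have "(\<lambda>n. real_of_int \<lfloor>real (Suc n) * snd p\<rfloor> / real (Suc n)) \<longlonglongrightarrow> snd p"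
    proof (rule tendsto_sandwich[of "\<lambda>n. snd p - 1 / real (Suc n)" _ _ "\<lambda>_. snd p"])
      show "\<forall>\<^sub>F n in sequentially. snd p - 1 / real (Suc n) \<le> real_of_int \<lfloor>real (Suc n) * snd p\<rfloor> / real (Suc n)"
      proof (intro always_eventually allI)
        fix n
        have "real (Suc n) * snd p - 1 \<le> real_of_int \<lfloor>real (Suc n) * snd p\<rfloor>" by linarith
        then have "(real (Suc n) * snd p - 1) / real (Suc n) \<le> real_of_int \<lfloor>real (Suc n) * snd p\<rfloor> / real (Suc n)"
          by (intro divide_right_mono) auto
        then show "snd p - 1 / real (Suc n) \<le> real_of_int \<lfloor>real (Suc n) * snd p\<rfloor> / real (Suc n)"
          by (simp add: diff_divide_distrib del: of_nat_Suc)
      qed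
      show "\<forall>\<^sub>F n in sequentially. real_of_int \<lfloor>real (Suc n) * snd p\<rfloor> / real (Suc n) \<le> snd p"
      proof (intro always_eventually allI)
        fix n
        have "real_of_int \<lfloor>real (Suc n) * snd p\<rfloor> \<le> real (Suc n) * snd p" by linarith
        then show "real_of_int \<lfloor>real (Suc n) * snd p\<rfloor> / real (Suc n) \<le> snd p" by (simp add: divide_le_eq mult.commute del: of_nat_Suc)
      qed
      have "(\<lambda>n. snd p - 1 / real (Suc n)) \<longlonglongrightarrow> snd p - 0"
        by (intro tendsto_diff tendsto_const LIMSEQ_Suc[OF lim_1_over_n])
      then show "(\<lambda>n. snd p - 1 / real (Suc n)) \<longlonglongrightarrow> snd p" by simp
    qed auto
    then have "(\<lambda>n. ?clamp (real_of_int \<lfloor>real (Suc n) * snd p\<rfloor> / real (Suc n))) \<longlonglongrightarrow> ?clamp (snd p)"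
      by (intro tendsto_intros)
    then show "(\<lambda>n. ?step n p) \<longlonglongrightarrow> B (?clamp (snd p)) (fst p)"
      by (rule continuous_on_tendsto_compose[OF B_cont[OF w]]) auto
  qed
  have "(\<lambda>(\<omega>, v). indicator {0..u} v *\<^sub>R c (B (?clamp v) \<omega>)) \<in> borel_measurable (?H \<Otimes>\<^sub>M lborel)"
    using m by (simp add: case_prod_beta) measurable
  then have "(\<lambda>\<omega>. \<integral>v. indicator {0..u} v *\<^sub>R c (B (?clamp v) \<omega>) \<partial>lborel) \<in> borel_measurable ?H"
    by (rule lborel.borel_measurable_lebesgue_integral)
  moreover have "occ c u \<omega> = (\<integral>v. indicator {0..u} v *\<^sub>R c (B (?clamp v) \<omega>) \<partial>lborel)" for \<omega>
    unfolding occ_def set_lebesgue_integral_def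
    by (intro Bochner_Integration.integral_cong) (auto simp: indicator_def)
  ultimately show ?thesis by presburger
qed

end


section \<open>A Feynman-Kac formula\<close>

text \<open>A two-sided derivative can be computed along ordered pairs of times, of which one is the base
  point. Conditioning on the past is only possible at the earlier of the two times.\<close>

lemma difference_quotient_ordered:
  fixes f :: "real \<Rightarrow> real"
  shows "(f x - f y) / (x - y) = (f (max x y) - f (min x y)) / (max x y - min x y)"
proof (cases "x \<le> y")
  case True
  then show ?thesis using minus_divide_divide[of "f y - f x" "y - x"] by (simp add: max_def min_def)
qed (simp add: max_def min_def)

locale feynman_kac = occupation + bounded_C2 +
  fixes k :: real
  assumes k_nonneg: "0 \<le> k"
begin

lemma weight_range:
  "0 \<le> exp (- k * occ c u \<omega>)" "exp (- k * occ c u \<omega>) \<le> 1"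
  using occ_nonneg[of u \<omega>] k_nonneg by auto

lemma weight_lipschitz:
  assumes "\<omega> \<in> space M" "0 \<le> a" "a \<le> b"
  shows "\<bar>exp (- k * occ c b \<omega>) - exp (- k * occ c a \<omega>)\<bar> \<le> k * Cc * (b - a)"
proof -
  let ?x = "k * occ c a \<omega>" and ?y = "k * occ c b \<omega>"
  have xy: "?x \<le> ?y" "?y - ?x \<le> k * (Cc * (b - a))"
    using occ_increment[OF assms] k_nonneg
    by (auto simp: mult_left_mono simp flip: right_diff_distrib)
  have x0: "0 \<le> ?x" using occ_nonneg k_nonneg by simp
  have "exp (- ?x) - exp (- ?y) = exp (- ?x) * (1 - exp (?x - ?y))"
    by (simp add: right_diff_distrib flip: exp_add)
  also have "\<dots> \<le> 1 * (?y - ?x)"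
  proof (rule mult_mono)
    show "1 - exp (?x - ?y) \<le> ?y - ?x" using exp_ge_add_one_self[of "?x - ?y"] by linarith
  qed (use xy x0 in auto)
  finally have "exp (- ?x) - exp (- ?y) \<le> k * Cc * (b - a)" using xy by (simp add: mult.assoc)
  moreover have "exp (- ?y) \<le> exp (- ?x)" using xy by simp
  ultimately show ?thesis by (simp add: abs_le_iff)
qed

text \<open>The difference quotient splits into a change of the weight along the path, which gives the
  potential term, and a Gaussian average of \<open>g\<close> over an increment independent of the past.\<close>

lemma feynman_kac_derivative:
  assumes s: "0 \<le> s" "s < u" and H: "H \<in> borel_measurable (history M B s)" "\<And>\<omega>. \<omega> \<in> space M \<Longrightarrow> \<bar>H \<omega>\<bar> \<le> cH"
  shows "((\<lambda>r. \<integral>\<omega>. H \<omega> * exp (- k * occ c r \<omega>) * g (B r \<omega>) \<partial>M) has_real_derivative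
     (\<integral>\<omega>. H \<omega> * exp (- k * occ c u \<omega>) * (g'' (B u \<omega>) / 2 - k * c (B u \<omega>) * g (B u \<omega>)) \<partial>M)) (at u)"
proof -
  let ?w = "\<lambda>r \<omega>. exp (- k * occ c r \<omega>)"
  let ?\<phi> = "\<lambda>r. \<integral>\<omega>. H \<omega> * ?w r \<omega> * g (B r \<omega>) \<partial>M"
  let ?D1 = "\<integral>\<omega>. H \<omega> * (- k * c (B u \<omega>) * ?w u \<omega>) * g (B u \<omega>) \<partial>M"
  let ?D2 = "\<integral>\<omega>. H \<omega> * ?w u \<omega> * (g'' (B u \<omega>) / 2) \<partial>M"
  have cH: "0 \<le> cH" using H(2) not_empty by force
  have C0: "0 \<le> C" using bound0[of 0] by linarith
  have K0: "0 \<le> K" using bound2[of 0] by linarith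
  have Cc0: "0 \<le> Cc" using c_nonneg[of 0] c_le[of 0] by linarith
  have Hw: "(\<lambda>\<omega>. H \<omega> * ?w r \<omega>) \<in> borel_measurable (history M B r)" if "r \<ge> s" for r
  proof -
    have [measurable]: "H \<in> borel_measurable (history M B r)"
      by (rule measurable_history_mono[OF H(1) refl _ that]) simp
    note [measurable] = occ_adapted
    show ?thesis by measurable
  qed
  have toM: "f \<in> borel_measurable M" if "f \<in> borel_measurable (history M B r)" for f :: "'a \<Rightarrow> real" and r
    using that sets_history_subset_events[of B M r, OF B_meas] by (auto simp: measurable_def)
  have [measurable]: "H \<in> borel_measurable M" "occ c r \<in> borel_measurable M" for r
    using toM[OF H(1)] toM[OF occ_adapted] by auto
  have Bm[measurable]: "B r \<in> borel_measurable M" if "r \<ge> s" for r using that s by (intro B_meas) auto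
  have Hwb: "\<bar>H \<omega> * ?w r \<omega>\<bar> \<le> cH" if "\<omega> \<in> space M" for r \<omega>
    using mult_mono[OF H(2)[OF that] weight_range(2)[of r \<omega>]] cH weight_range(1)[of r \<omega>] by (simp add: abs_mult)
  have int1: "integrable M (\<lambda>\<omega>. H \<omega> * ?w r \<omega> * f (B q \<omega>))"
    if "r \<ge> s" "q \<ge> s" "f \<in> borel_measurable borel" "\<And>x. \<bar>f x\<bar> \<le> d" for r q f d
  proof (rule integrable_const_bound[of _ "cH * d"])
    note [measurable] = that(3) Bm[OF that(2)]
    show "(\<lambda>\<omega>. H \<omega> * ?w r \<omega> * f (B q \<omega>)) \<in> borel_measurable M" by measurable
    show "AE \<omega> in M. norm (H \<omega> * ?w r \<omega> * f (B q \<omega>)) \<le> cH * d"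
      unfolding real_norm_def abs_mult[of "H _ * ?w r _"]
      by (intro AE_I2 mult_mono Hwb that(4)) (auto simp: cH)
  qed
  have "(?\<phi> has_real_derivative ?D1 + ?D2) (at u within {s<..})"
    unfolding has_field_derivative_iff tendsto_at_iff_sequentially
  proof (intro allI impI)
    fix X :: "nat \<Rightarrow> real" assume X: "\<forall>i. X i \<in> {s<..} - {u}" "X \<longlonglongrightarrow> u"
    define a where "a i = min (X i) u" for i
    define b where "b i = max (X i) u" for i
    have ab: "s < a i" "a i < b i" for i
      using X(1)[rule_format, of i] s by (auto simp: a_def b_def)
    have "a \<longlonglongrightarrow> min u u" "b \<longlonglongrightarrow> max u u" unfolding a_def[abs_def] b_def[abs_def] by (intro tendsto_intros X)+
    then have lim: "a \<longlonglongrightarrow> u" "b \<longlonglongrightarrow> u" by simp_all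
    then have "(\<lambda>i. b i - a i) \<longlonglongrightarrow> u - u" by (intro tendsto_intros)
    then have limh: "(\<lambda>i. b i - a i) \<longlonglongrightarrow> 0" by simp
    have Bl: "(\<lambda>i. B (q i) \<omega>) \<longlonglongrightarrow> B u \<omega>" if "\<omega> \<in> space M" "q \<longlonglongrightarrow> u" "\<And>i. s < q i" for q \<omega>
    proof -
      have "\<forall>i. q i \<in> {0..}" using that(3) s by (auto intro: less_imp_le order_trans)
      then show ?thesis using s by (intro continuous_on_tendsto_compose[OF B_cont[OF that(1)] that(2)]) auto
    qed
    have quot: "(?\<phi> (X i) - ?\<phi> u) / (X i - u) =
       (\<integral>\<omega>. H \<omega> * ((?w (b i) \<omega> - ?w (a i) \<omega>) / (b i - a i)) * g (B (b i) \<omega>) \<partial>M) +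
       (\<integral>\<omega>. H \<omega> * ?w (a i) \<omega> * ((heat (b i - a i) g (B (a i) \<omega>) - g (B (a i) \<omega>)) / (b i - a i)) \<partial>M)" for i
    proof -
      have h: "b i - a i > 0" using ab[of i] by simp
      have "(?\<phi> (X i) - ?\<phi> u) / (X i - u) = (?\<phi> (b i) - ?\<phi> (a i)) / (b i - a i)"
        unfolding a_def b_def by (rule difference_quotient_ordered)
      also have "?\<phi> (b i) - ?\<phi> (a i) = (?\<phi> (b i) - (\<integral>\<omega>. H \<omega> * ?w (a i) \<omega> * g (B (b i) \<omega>) \<partial>M)) +
          ((\<integral>\<omega>. H \<omega> * ?w (a i) \<omega> * g (B (b i) \<omega>) \<partial>M) - ?\<phi> (a i))" by simp
      also have "?\<phi> (b i) - (\<integral>\<omega>. H \<omega> * ?w (a i) \<omega> * g (B (b i) \<omega>) \<partial>M) =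
          (\<integral>\<omega>. H \<omega> * (?w (b i) \<omega> - ?w (a i) \<omega>) * g (B (b i) \<omega>) \<partial>M)"
      proof -
        have i1: "integrable M (\<lambda>\<omega>. H \<omega> * ?w (b i) \<omega> * g (B (b i) \<omega>))"
          and i2: "integrable M (\<lambda>\<omega>. H \<omega> * ?w (a i) \<omega> * g (B (b i) \<omega>))"
          using ab[of i] by (intro int1[OF _ _ meas0 bound0]; simp)+
        show ?thesis unfolding Bochner_Integration.integral_diff[OF i1 i2, symmetric]
          by (intro Bochner_Integration.integral_cong refl) (simp add: algebra_simps)
      qed
      also have "(\<integral>\<omega>. H \<omega> * ?w (a i) \<omega> * g (B (b i) \<omega>) \<partial>M) = (\<integral>\<omega>. H \<omega> * ?w (a i) \<omega> * heat (b i - a i) g (B (a i) \<omega>) \<partial>M)"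
        using ab[of i] s by (intro markov[OF _ _ Hw Hwb meas0 bound0]) auto
      also have "\<dots> - ?\<phi> (a i) = (\<integral>\<omega>. H \<omega> * ?w (a i) \<omega> * (heat (b i - a i) g (B (a i) \<omega>) - g (B (a i) \<omega>)) \<partial>M)"
      proof -
        have i1: "integrable M (\<lambda>\<omega>. H \<omega> * ?w (a i) \<omega> * heat (b i - a i) g (B (a i) \<omega>))"
          using ab[of i] by (intro int1[OF _ _ heat_meas heat_le]; simp)
        have i2: "integrable M (\<lambda>\<omega>. H \<omega> * ?w (a i) \<omega> * g (B (a i) \<omega>))"
          using ab[of i] by (intro int1[OF _ _ meas0 bound0]; simp)
        show ?thesis unfolding Bochner_Integration.integral_diff[OF i1 i2, symmetric]
          by (intro Bochner_Integration.integral_cong refl) (simp add: algebra_simps)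
      qed
      finally show ?thesis using h by (simp add: add_divide_distrib)
    qed
    have l1: "(\<lambda>i. \<integral>\<omega>. H \<omega> * ((?w (b i) \<omega> - ?w (a i) \<omega>) / (b i - a i)) * g (B (b i) \<omega>) \<partial>M) \<longlonglongrightarrow> ?D1"
    proof (rule integral_dominated_convergence[where w = "\<lambda>_. cH * (k * Cc) * C"])
      show "(\<lambda>\<omega>. H \<omega> * (- k * c (B u \<omega>) * ?w u \<omega>) * g (B u \<omega>)) \<in> borel_measurable M"
      proof -
        note [measurable] = Bm[OF less_imp_le[OF s(2)]]
        show ?thesis by measurable
      qed
      show "(\<lambda>\<omega>. H \<omega> * ((?w (b i) \<omega> - ?w (a i) \<omega>) / (b i - a i)) * g (B (b i) \<omega>)) \<in> borel_measurable M" for i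
      proof -
        have "s \<le> b i" using ab[of i] by linarith
        note [measurable] = Bm[OF this]
        show ?thesis by measurable
      qed
      show "AE \<omega> in M. (\<lambda>i. H \<omega> * ((?w (b i) \<omega> - ?w (a i) \<omega>) / (b i - a i)) * g (B (b i) \<omega>)) \<longlonglongrightarrow>
          H \<omega> * (- k * c (B u \<omega>) * ?w u \<omega>) * g (B u \<omega>)"
      proof (intro AE_I2 tendsto_mult tendsto_const)
        fix \<omega> assume w: "\<omega> \<in> space M"
        have "((\<lambda>r. ?w r \<omega>) has_real_derivative ?w u \<omega> * (- k * c (B u \<omega>))) (at u)"
          using occ_deriv[OF w] s by (auto intro!: derivative_eq_intros)
        then have "(\<lambda>i. (?w (X i) \<omega> - ?w u \<omega>) / (X i - u)) \<longlonglongrightarrow> ?w u \<omega> * (- k * c (B u \<omega>))"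
          unfolding has_field_derivative_iff tendsto_at_iff_sequentially using X by (auto simp: o_def)
        moreover have "(?w (X i) \<omega> - ?w u \<omega>) / (X i - u) = (?w (b i) \<omega> - ?w (a i) \<omega>) / (b i - a i)" for i
          unfolding a_def b_def by (rule difference_quotient_ordered)
        ultimately show "(\<lambda>i. (?w (b i) \<omega> - ?w (a i) \<omega>) / (b i - a i)) \<longlonglongrightarrow> - k * c (B u \<omega>) * ?w u \<omega>"
          by (simp add: mult.commute)
        have "s < b i" for i using ab[of i] by linarith
        then have "(\<lambda>i. B (b i) \<omega>) \<longlonglongrightarrow> B u \<omega>" by (intro Bl[OF w lim(2)])
        then show "(\<lambda>i. g (B (b i) \<omega>)) \<longlonglongrightarrow> g (B u \<omega>)"
          by (rule isCont_tendsto_compose[OF DERIV_isCont[OF g1]])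
      qed
      show "AE \<omega> in M. norm (H \<omega> * ((?w (b i) \<omega> - ?w (a i) \<omega>) / (b i - a i)) * g (B (b i) \<omega>)) \<le> cH * (k * Cc) * C" for i
      proof (rule AE_I2)
        fix \<omega> assume w: "\<omega> \<in> space M"
        have "\<bar>(?w (b i) \<omega> - ?w (a i) \<omega>) / (b i - a i)\<bar> \<le> k * Cc"
          using weight_lipschitz[OF w, of "a i" "b i"] ab[of i] s by (simp add: abs_divide divide_le_eq)
        then show "norm (H \<omega> * ((?w (b i) \<omega> - ?w (a i) \<omega>) / (b i - a i)) * g (B (b i) \<omega>)) \<le> cH * (k * Cc) * C"
          unfolding real_norm_def abs_mult using k_nonneg Cc0 C0 cH
          by (intro mult_mono H(2)[OF w] bound0) auto
      qed
    qed simp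
    have l2: "(\<lambda>i. \<integral>\<omega>. H \<omega> * ?w (a i) \<omega> * ((heat (b i - a i) g (B (a i) \<omega>) - g (B (a i) \<omega>)) / (b i - a i)) \<partial>M) \<longlonglongrightarrow> ?D2"
    proof (rule integral_dominated_convergence[where w = "\<lambda>_. cH * (K / 2)"])
      show "(\<lambda>\<omega>. H \<omega> * ?w u \<omega> * (g'' (B u \<omega>) / 2)) \<in> borel_measurable M"
      proof -
        note [measurable] = Bm[OF less_imp_le[OF s(2)]]
        show ?thesis by measurable
      qed
      show "(\<lambda>\<omega>. H \<omega> * ?w (a i) \<omega> * ((heat (b i - a i) g (B (a i) \<omega>) - g (B (a i) \<omega>)) / (b i - a i))) \<in> borel_measurable M" for i
      proof -
        have "s \<le> a i" using ab[of i] by linarith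
        note [measurable] = heat_meas Bm[OF this]
        show ?thesis by measurable
      qed
      show "AE \<omega> in M. (\<lambda>i. H \<omega> * ?w (a i) \<omega> * ((heat (b i - a i) g (B (a i) \<omega>) - g (B (a i) \<omega>)) / (b i - a i))) \<longlonglongrightarrow>
          H \<omega> * ?w u \<omega> * (g'' (B u \<omega>) / 2)"
      proof (intro AE_I2 tendsto_mult tendsto_const)
        fix \<omega> assume w: "\<omega> \<in> space M"
        have "isCont (\<lambda>r. ?w r \<omega>) u"
          by (intro continuous_intros DERIV_isCont[OF occ_deriv[OF w]]) (use s in auto)
        then show "(\<lambda>i. ?w (a i) \<omega>) \<longlonglongrightarrow> ?w u \<omega>" using lim(1) by (rule isCont_tendsto_compose)
        show "(\<lambda>i. (heat (b i - a i) g (B (a i) \<omega>) - g (B (a i) \<omega>)) / (b i - a i)) \<longlonglongrightarrow> g'' (B u \<omega>) / 2"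
          using ab by (intro heat_quotient_tendsto limh Bl[OF w lim(1)]) (auto simp: less_diff_eq)
      qed
      show "AE \<omega> in M. norm (H \<omega> * ?w (a i) \<omega> * ((heat (b i - a i) g (B (a i) \<omega>) - g (B (a i) \<omega>)) / (b i - a i))) \<le> cH * (K / 2)" for i
        unfolding real_norm_def abs_mult[of "H _ * ?w (a i) _"]
        using ab[of i] K0 by (intro AE_I2 mult_mono Hwb heat_quotient_bound cH) auto
    qed simp
    show "((\<lambda>y. (?\<phi> y - ?\<phi> u) / (y - u)) \<circ> X) \<longlonglongrightarrow> ?D1 + ?D2"
      unfolding o_def quot by (rule tendsto_add[OF l1 l2])
  qed
  moreover have "at u within {s<..} = at u" using s by (intro at_within_open) auto
  moreover have "?D1 + ?D2 = (\<integral>\<omega>. H \<omega> * ?w u \<omega> * (g'' (B u \<omega>) / 2 - k * c (B u \<omega>) * g (B u \<omega>)) \<partial>M)"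
  proof -
    have i1: "integrable M (\<lambda>\<omega>. H \<omega> * (- k * c (B u \<omega>) * ?w u \<omega>) * g (B u \<omega>))"
    proof -
      have b: "\<bar>- k * c x * g x\<bar> \<le> k * Cc * C" for x
        unfolding abs_mult using k_nonneg c_nonneg[of x] c_le[of x] Cc0 bound0[of x]
        by (intro mult_mono) auto
      have m: "(\<lambda>x. - k * c x * g x) \<in> borel_measurable borel" by measurable
      have "integrable M (\<lambda>\<omega>. H \<omega> * ?w u \<omega> * (- k * c (B u \<omega>) * g (B u \<omega>)))"
        using s by (intro int1[OF _ _ m b]) auto
      moreover have "(\<lambda>\<omega>. H \<omega> * (- k * c (B u \<omega>) * ?w u \<omega>) * g (B u \<omega>)) =
          (\<lambda>\<omega>. H \<omega> * ?w u \<omega> * (- k * c (B u \<omega>) * g (B u \<omega>)))"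
        by (simp add: fun_eq_iff algebra_simps)
      ultimately show ?thesis by metis
    qed
    have i2: "integrable M (\<lambda>\<omega>. H \<omega> * ?w u \<omega> * (g'' (B u \<omega>) / 2))"
    proof -
      have b: "\<bar>g'' x / 2\<bar> \<le> K" for x using bound2[of x] by simp
      have m: "(\<lambda>x. g'' x / 2) \<in> borel_measurable borel" by measurable
      show ?thesis using s by (intro int1[OF _ _ m b]) auto
    qed
    show ?thesis unfolding Bochner_Integration.integral_add[OF i1 i2, symmetric]
      by (intro Bochner_Integration.integral_cong refl) (simp add: algebra_simps)
  qed
  ultimately show ?thesis by simp
qed

end


section \<open>A smooth substitute for the sine of the absolute value\<close>

text \<open>A continuous approximation of the Dirac mass at \<open>0\<close> of height \<open>n / 2\<close>: it is constant for
  \<open>\<bar>x\<bar> \<le> (1 - 1 / n) / n\<close> and vanishes for \<open>\<bar>x\<bar> \<ge> 1 / n\<close>. Since the two radii have quotient close to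
  \<open>1\<close>, the occupation integral of the bump lies between two normalized occupation times of intervals
  that both converge to the local time.\<close>

definition trapezoid :: "nat \<Rightarrow> real \<Rightarrow> real" where
  "trapezoid n x = real n / 2 * max 0 (min 1 (real n * (1 - real n * \<bar>x\<bar>)))"

lemma trapezoid_cont: "continuous_on UNIV (trapezoid n)"
  unfolding trapezoid_def by (intro continuous_intros)

lemma trapezoid_bounds: "0 \<le> trapezoid n x" "trapezoid n x \<le> real n / 2"
proof -
  have "max 0 (min 1 (real n * (1 - real n * \<bar>x\<bar>))) \<le> 1" by simp
  from mult_left_mono[OF this, of "real n / 2"] show "trapezoid n x \<le> real n / 2" by (simp add: trapezoid_def)
qed (simp add: trapezoid_def)

lemma trapezoid_even: "trapezoid n (- x) = trapezoid n x"
  by (simp add: trapezoid_def)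

lemma trapezoid_zero: "\<bar>x\<bar> \<ge> 1 / real n \<Longrightarrow> trapezoid n x = 0"
proof (cases "n = 0")
  case False
  assume "\<bar>x\<bar> \<ge> 1 / real n"
  then have "1 \<le> real n * \<bar>x\<bar>" using False by (simp add: field_simps)
  then have "real n * (1 - real n * \<bar>x\<bar>) \<le> 0" by (intro mult_nonneg_nonpos) auto
  then show ?thesis by (simp add: trapezoid_def)
qed (simp add: trapezoid_def)

lemma trapezoid_top: "n > 0 \<Longrightarrow> \<bar>x\<bar> \<le> (1 - 1 / real n) / real n \<Longrightarrow> trapezoid n x = real n / 2"
proof -
  assume n: "n > 0" and "\<bar>x\<bar> \<le> (1 - 1 / real n) / real n"
  then have "real n * \<bar>x\<bar> \<le> 1 - 1 / real n" by (simp add: field_simps)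
  then have "1 / real n \<le> 1 - real n * \<bar>x\<bar>" by linarith
  then have "1 \<le> real n * (1 - real n * \<bar>x\<bar>)" using n by (simp add: field_simps)
  then show ?thesis by (simp add: trapezoid_def)
qed

lemma continuous_antiderivative:
  fixes f :: "real \<Rightarrow> real"
  assumes "continuous_on UNIV f"
  obtains F where "\<And>x. DERIV F x :> f x" "F 0 = 0"
proof
  let ?F = "\<lambda>u. LBINT y=ereal 0..ereal u. f y"
  show "DERIV ?F x :> f x" for x
  proof -
    have "((\<lambda>u. LBINT y=ereal 0..ereal u. f y) has_vector_derivative f x) (at x within {-\<bar>x\<bar>-1..\<bar>x\<bar>+1})"
      by (rule interval_integral_FTC2) (auto intro: continuous_on_subset[OF assms])
    moreover have "at x within {-\<bar>x\<bar>-1..\<bar>x\<bar>+1} = at x" by (rule at_within_interior) auto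
    ultimately show ?thesis by (simp add: has_real_derivative_iff_has_vector_derivative)
  qed
  show "?F 0 = 0" by simp
qed

lemma abs_le_by_derivative:
  fixes f g :: "real \<Rightarrow> real"
  assumes f: "\<And>x. DERIV f x :> f' x" "f 0 = 0" and g: "\<And>x. DERIV g x :> g' x" "g 0 = 0"
    and le: "\<And>x. \<bar>f' x\<bar> \<le> g' x"
  shows "\<bar>f x\<bar> \<le> \<bar>g x\<bar>"
proof -
  have d1: "DERIV (\<lambda>x. g x - f x) y :> g' y - f' y" and d2: "DERIV (\<lambda>x. g x + f x) y :> g' y + f' y" for y
    by (auto intro!: derivative_eq_intros f g)
  have n1: "0 \<le> g' y - f' y" and n2: "0 \<le> g' y + f' y" for y using le[of y] by linarith+
  have m1: "g a - f a \<le> g b - f b" if "a \<le> b" for a b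
    using DERIV_nonneg_imp_nondecreasing[OF that, of "\<lambda>x. g x - f x"] d1 n1 by blast
  have m2: "g a + f a \<le> g b + f b" if "a \<le> b" for a b
    using DERIV_nonneg_imp_nondecreasing[OF that, of "\<lambda>x. g x + f x"] d2 n2 by blast
  show ?thesis
    using m1[of 0 x] m2[of 0 x] m1[of x 0] m2[of x 0] f(2) g(2) by (cases "0 \<le> x") linarith+
qed

lemma one_minus_cos_le: "\<bar>cos a - 1\<bar> \<le> \<bar>a\<bar>" for a :: real
proof (rule abs_le_by_derivative)
  show "DERIV (\<lambda>x. cos x - 1) x :> - sin x" for x :: real by (auto intro!: derivative_eq_intros)
  show "DERIV (\<lambda>x. x) x :> 1" for x :: real by (auto intro!: derivative_eq_intros)
qed auto

text \<open>The antiderivative of an approximate Dirac mass is an approximate step from \<open>-1/2\<close> to \<open>1/2\<close>.\<close>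

lemma trapezoid_antiderivative:
  assumes n: "n > 0" and K: "\<And>x. DERIV K x :> trapezoid n x" "K 0 = 0"
  shows "\<bar>K x\<bar> \<le> 1 / 2" "x \<ge> 1 / real n \<Longrightarrow> \<bar>2 * K x - 1\<bar> \<le> 1 / real n"
    "x \<le> - 1 / real n \<Longrightarrow> \<bar>2 * K x + 1\<bar> \<le> 1 / real n"
proof -
  have mono: "K a \<le> K b" if "a \<le> b" for a b
    using DERIV_nonneg_imp_nondecreasing[OF that, of K] K trapezoid_bounds by blast
  have odd: "K (- x) = - K x" for x
  proof -
    have "DERIV (\<lambda>x. K x + K (- x)) y :> 0" for y
      by (auto intro!: derivative_eq_intros DERIV_chain2[where f = K] K simp: trapezoid_even)
    then have "K x + K (- x) = K 0 + K (- 0)" by (intro DERIV_isconst_all) blast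
    then show ?thesis using K(2) by simp
  qed
  have r: "1 / real n > 0" using n by simp
  have up: "K (1 / real n) \<le> 1 / 2"
  proof -
    have "DERIV (\<lambda>x. real n / 2 * x - K x) y :> real n / 2 - trapezoid n y" for y
      by (auto intro!: derivative_eq_intros K)
    then have "real n / 2 * 0 - K 0 \<le> real n / 2 * (1 / real n) - K (1 / real n)"
      using trapezoid_bounds(2)[of n] r
      by (intro DERIV_nonneg_imp_nondecreasing[where f = "\<lambda>x. real n / 2 * x - K x"])
         (auto intro!: exI)
    then show ?thesis using K(2) n by simp
  qed
  have lo: "(1 - 1 / real n) / 2 \<le> K (1 / real n)"
  proof -
    let ?a = "(1 - 1 / real n) / real n"
    have a: "0 \<le> ?a" "?a \<le> 1 / real n" using n by (auto simp: field_simps)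
    have "DERIV (\<lambda>x. K x - real n / 2 * x) y :> trapezoid n y - real n / 2" for y
      by (auto intro!: derivative_eq_intros K)
    moreover have "0 \<le> trapezoid n y - real n / 2" if "0 \<le> y" "y \<le> ?a" for y
      using trapezoid_top[OF n, of y] that by simp
    ultimately have "K 0 - real n / 2 * 0 \<le> K ?a - real n / 2 * ?a"
      using a(1) by (intro DERIV_nonneg_imp_nondecreasing[where f = "\<lambda>x. K x - real n / 2 * x"]) blast+
    moreover have "real n / 2 * ?a = (1 - 1 / real n) / 2" using n by simp
    ultimately have "(1 - 1 / real n) / 2 \<le> K ?a" using K(2) by linarith
    then show ?thesis using mono[OF a(2)] by linarith
  qed
  have const: "K x = K (1 / real n)" if "x \<ge> 1 / real n" for x
  proof (rule antisym)
    have "- K (1 / real n) \<le> - K x"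
    proof (rule DERIV_nonneg_imp_nondecreasing[OF that])
      fix y assume y: "1 / real n \<le> y" "y \<le> x"
      have "DERIV (\<lambda>x. - K x) y :> - trapezoid n y" by (auto intro!: derivative_eq_intros K)
      moreover have "trapezoid n y = 0" using y r by (intro trapezoid_zero) auto
      ultimately show "\<exists>d. DERIV (\<lambda>x. - K x) y :> d \<and> 0 \<le> d" by auto
    qed
    then show "K x \<le> K (1 / real n)" by simp
  qed (rule mono[OF that])
  have pos: "\<bar>2 * K x - 1\<bar> \<le> 1 / real n" if "x \<ge> 1 / real n" for x
    using const[OF that] up lo r by (simp add: abs_le_iff)
  show "x \<ge> 1 / real n \<Longrightarrow> \<bar>2 * K x - 1\<bar> \<le> 1 / real n" by (rule pos)
  show "x \<le> - 1 / real n \<Longrightarrow> \<bar>2 * K x + 1\<bar> \<le> 1 / real n"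
    using pos[of "- x"] odd[of x] by (simp add: abs_le_iff)
  have half: "\<bar>K x\<bar> \<le> 1 / 2" if "x \<ge> 0" for x
  proof -
    have "K x \<le> K (max x (1 / real n))" by (rule mono) simp
    also have "\<dots> = K (1 / real n)" by (rule const) simp
    finally show ?thesis using up mono[OF that] K(2) by simp
  qed
  show "\<bar>K x\<bar> \<le> 1 / 2" using half[of x] half[of "- x"] odd[of x] by (cases "0 \<le> x") auto
qed

text \<open>Variation of constants for \<open>\<Psi>'' + \<xi>\<^sup>2 \<Psi> = 2 \<xi> c\<close>, where \<open>c\<close> is the trapezoid approximation of
  the Dirac mass; the limiting solution is \<open>sin (\<xi> \<bar>x\<bar>)\<close>.\<close>

lemma smoothed_sine:
  assumes n: "n > 0"
  obtains \<Psi> \<Psi>' where "\<And>x. DERIV \<Psi> x :> \<Psi>' x" "\<And>x. DERIV \<Psi>' x :> 2 * \<xi> * trapezoid n x - \<xi>\<^sup>2 * \<Psi> x"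
    "\<And>x. \<bar>\<Psi> x\<bar> \<le> 2" "\<And>x. \<bar>\<Psi> x\<bar> \<le> 2 * \<bar>\<xi>\<bar> * \<bar>x\<bar>"
    "\<And>x. \<bar>x\<bar> \<ge> 1 / real n \<Longrightarrow> \<bar>\<Psi> x - sin (\<xi> * \<bar>x\<bar>)\<bar> \<le> (1 + 2 * \<bar>\<xi>\<bar>) / real n"
proof -
  let ?c = "trapezoid n"
  obtain K where K: "\<And>x. DERIV K x :> ?c x" "K 0 = 0"
    using continuous_antiderivative[OF trapezoid_cont[of n]] by metis
  have "continuous_on UNIV (\<lambda>x. ?c x * cos (\<xi> * x))" by (intro continuous_intros trapezoid_cont)
  from continuous_antiderivative[OF this] obtain C where C: "\<And>x. DERIV C x :> ?c x * cos (\<xi> * x)" "C 0 = 0" by metis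
  have "continuous_on UNIV (\<lambda>x. ?c x * sin (\<xi> * x))" by (intro continuous_intros trapezoid_cont)
  from continuous_antiderivative[OF this] obtain S where S: "\<And>x. DERIV S x :> ?c x * sin (\<xi> * x)" "S 0 = 0" by metis
  note K' = trapezoid_antiderivative[OF n K]
  have Cb: "\<bar>C x\<bar> \<le> 1 / 2" for x
  proof -
    have "\<bar>C x\<bar> \<le> \<bar>K x\<bar>"
      by (rule abs_le_by_derivative[OF C K]) (auto simp: abs_mult trapezoid_bounds mult_left_le)
    then show ?thesis using K'(1)[of x] by linarith
  qed
  have Sb: "\<bar>S x\<bar> \<le> 1 / 2" for x
  proof -
    have "\<bar>S x\<bar> \<le> \<bar>K x\<bar>"
      by (rule abs_le_by_derivative[OF S K]) (auto simp: abs_mult trapezoid_bounds mult_left_le)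
    then show ?thesis using K'(1)[of x] by linarith
  qed
  have small: "?c x * \<bar>f x\<bar> \<le> \<bar>\<xi>\<bar> / real n * ?c x" if "\<bar>f x\<bar> \<le> \<bar>\<xi> * x\<bar>" for f :: "real \<Rightarrow> real" and x
  proof (cases "\<bar>x\<bar> \<ge> 1 / real n")
    case True then show ?thesis using trapezoid_zero[OF True] by simp
  next
    case False
    have "\<bar>f x\<bar> \<le> \<bar>\<xi>\<bar> * \<bar>x\<bar>" using that by (simp add: abs_mult)
    also have "\<dots> \<le> \<bar>\<xi>\<bar> * (1 / real n)" using False by (intro mult_left_mono) auto
    finally have "\<bar>f x\<bar> \<le> \<bar>\<xi>\<bar> / real n" by simp
    from mult_left_mono[OF this trapezoid_bounds(1)] show ?thesis by (simp add: mult.commute)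
  qed
  have dK: "DERIV (\<lambda>x. \<bar>\<xi>\<bar> / real n * K x) x :> \<bar>\<xi>\<bar> / real n * ?c x" "\<bar>\<xi>\<bar> / real n * K 0 = 0" for x
    using K(2) n by (auto intro!: derivative_eq_intros K(1))
  have Kn: "\<bar>\<bar>\<xi>\<bar> / real n * K x\<bar> \<le> \<bar>\<xi>\<bar> / real n * (1/2)" for x
    unfolding abs_mult using K'(1)[of x] by (intro mult_mono) auto
  have CK: "\<bar>C x - K x\<bar> \<le> \<bar>\<xi>\<bar> / real n * (1/2)" for x
  proof -
    have d: "DERIV (\<lambda>x. C x - K x) x :> ?c x * cos (\<xi> * x) - ?c x" for x
      by (auto intro!: derivative_eq_intros C K)
    have "\<bar>C x - K x\<bar> \<le> \<bar>\<bar>\<xi>\<bar> / real n * K x\<bar>"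
    proof (rule abs_le_by_derivative[OF d _ dK])
      fix x
      have "?c x * cos (\<xi> * x) - ?c x = ?c x * (cos (\<xi> * x) - 1)" by (simp add: algebra_simps)
      then have "\<bar>?c x * cos (\<xi> * x) - ?c x\<bar> = ?c x * \<bar>cos (\<xi> * x) - 1\<bar>"
        by (simp only: abs_mult abs_of_nonneg[OF trapezoid_bounds(1)])
      then show "\<bar>?c x * cos (\<xi> * x) - ?c x\<bar> \<le> \<bar>\<xi>\<bar> / real n * ?c x"
        using small[of "\<lambda>x. cos (\<xi> * x) - 1" x] one_minus_cos_le[of "\<xi> * x"] by simp
    qed (use C K in simp)
    then show ?thesis using Kn[of x] by linarith
  qed
  have Sn: "\<bar>S x\<bar> \<le> \<bar>\<xi>\<bar> / real n * (1/2)" for x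
  proof -
    have "\<bar>S x\<bar> \<le> \<bar>\<bar>\<xi>\<bar> / real n * K x\<bar>"
    proof (rule abs_le_by_derivative[OF S dK])
      fix x
      have "\<bar>?c x * sin (\<xi> * x)\<bar> = ?c x * \<bar>sin (\<xi> * x)\<bar>"
        by (simp only: abs_mult abs_of_nonneg[OF trapezoid_bounds(1)])
      also have "\<dots> \<le> \<bar>\<xi>\<bar> / real n * ?c x" by (rule small) (rule abs_sin_x_le_abs_x)
      finally show "\<bar>?c x * sin (\<xi> * x)\<bar> \<le> \<bar>\<xi>\<bar> / real n * ?c x" .
    qed
    then show ?thesis using Kn[of x] by linarith
  qed
  let ?P = "\<lambda>x. 2 * (sin (\<xi> * x) * C x - cos (\<xi> * x) * S x)"
  let ?P' = "\<lambda>x. 2 * \<xi> * (cos (\<xi> * x) * C x + sin (\<xi> * x) * S x)"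
  have dP: "DERIV ?P x :> ?P' x" for x
    by (auto intro!: derivative_eq_intros C S simp: algebra_simps)
  have sc: "(cos a)\<^sup>2 * q + (sin a)\<^sup>2 * q = q" for a q :: real
    by (simp flip: distrib_right)
  have dP': "DERIV ?P' x :> 2 * \<xi> * ?c x - \<xi>\<^sup>2 * ?P x" for x
  proof -
    have "DERIV ?P' x :> 2 * \<xi> * ((- sin (\<xi> * x) * \<xi>) * C x + cos (\<xi> * x) * (?c x * cos (\<xi> * x)) +
        ((cos (\<xi> * x) * \<xi>) * S x + sin (\<xi> * x) * (?c x * sin (\<xi> * x))))"
      by (auto intro!: derivative_eq_intros C S simp: algebra_simps)
    moreover have "2 * \<xi> * ((- sin (\<xi> * x) * \<xi>) * C x + cos (\<xi> * x) * (?c x * cos (\<xi> * x)) +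
        ((cos (\<xi> * x) * \<xi>) * S x + sin (\<xi> * x) * (?c x * sin (\<xi> * x)))) = 2 * \<xi> * ?c x - \<xi>\<^sup>2 * ?P x"
    proof -
      have "cos (\<xi> * x) * (?c x * cos (\<xi> * x)) + sin (\<xi> * x) * (?c x * sin (\<xi> * x)) = ?c x"
        using sc[of "\<xi> * x" "?c x"] by (simp add: power2_eq_square mult_ac)
      then show ?thesis by (simp add: algebra_simps power2_eq_square)
    qed
    ultimately show ?thesis by simp
  qed
  have tri: "\<bar>sin a * p - cos a * q\<bar> \<le> \<bar>p\<bar> + \<bar>q\<bar>" "\<bar>cos a * p + sin a * q\<bar> \<le> \<bar>p\<bar> + \<bar>q\<bar>" for a p q :: real
  proof -
    have "\<bar>sin a * p\<bar> \<le> \<bar>p\<bar>" "\<bar>cos a * q\<bar> \<le> \<bar>q\<bar>" "\<bar>cos a * p\<bar> \<le> \<bar>p\<bar>" "\<bar>sin a * q\<bar> \<le> \<bar>q\<bar>"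
      by (auto simp: abs_mult intro!: mult_left_le_one_le)
    then show "\<bar>sin a * p - cos a * q\<bar> \<le> \<bar>p\<bar> + \<bar>q\<bar>" "\<bar>cos a * p + sin a * q\<bar> \<le> \<bar>p\<bar> + \<bar>q\<bar>" by linarith+
  qed
  show ?thesis
  proof (rule that[OF dP dP'])
    show "\<bar>?P x\<bar> \<le> 2" for x
      using order_trans[OF tri(1) add_mono[OF Cb Sb], of "\<xi> * x" x x] by (simp add: abs_mult)
    show "\<bar>?P x\<bar> \<le> 2 * \<bar>\<xi>\<bar> * \<bar>x\<bar>" for x
    proof -
      have "DERIV (\<lambda>x. 2 * \<bar>\<xi>\<bar> * x) y :> 2 * \<bar>\<xi>\<bar>" for y by (auto intro!: derivative_eq_intros)
      note dl = this
      have b: "\<bar>?P' y\<bar> \<le> 2 * \<bar>\<xi>\<bar>" for y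
      proof -
        have "\<bar>?P' y\<bar> = 2 * \<bar>\<xi>\<bar> * \<bar>cos (\<xi> * y) * C y + sin (\<xi> * y) * S y\<bar>" by (simp add: abs_mult)
        also have "\<dots> \<le> 2 * \<bar>\<xi>\<bar> * (1/2 + 1/2)"
          by (rule mult_left_mono[OF order_trans[OF tri(2) add_mono[OF Cb Sb]]]) simp
        finally show "\<bar>?P' y\<bar> \<le> 2 * \<bar>\<xi>\<bar>" by simp
      qed
      have "\<bar>?P x\<bar> \<le> \<bar>2 * \<bar>\<xi>\<bar> * x\<bar>"
        by (rule abs_le_by_derivative[OF dP _ dl _ b]) (use C S in auto)
      then show ?thesis by (simp add: abs_mult)
    qed
    show "\<bar>?P x - sin (\<xi> * \<bar>x\<bar>)\<bar> \<le> (1 + 2 * \<bar>\<xi>\<bar>) / real n" if "\<bar>x\<bar> \<ge> 1 / real n" for x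
    proof -
      define e where "e = (if x \<ge> 0 then 1 else - 1 :: real)"
      have e: "\<bar>2 * C x - e\<bar> \<le> 1 / real n + \<bar>\<xi>\<bar> / real n"
        using K'(2,3)[of x] CK[of x] that by (auto simp: e_def abs_if split: if_splits)
      have "?P x - sin (\<xi> * \<bar>x\<bar>) = sin (\<xi> * x) * (2 * C x - e) - cos (\<xi> * x) * (2 * S x)"
        by (simp add: e_def algebra_simps)
      also have "\<bar>\<dots>\<bar> \<le> \<bar>2 * C x - e\<bar> + \<bar>2 * S x\<bar>" by (rule tri)
      also have "\<dots> \<le> 1 / real n + \<bar>\<xi>\<bar> / real n + \<bar>\<xi>\<bar> / real n" using e Sn[of x] by simp
      finally show ?thesis by (simp add: add_divide_distrib)
    qed
  qed
qed


section \<open>Local time as a limit of occupation integrals\<close>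

locale bm_local_time = brownian_motion +
  fixes L :: "real \<Rightarrow> 'a \<Rightarrow> real"
  assumes lt: "local_time_at_0 M B L"
begin

lemma L_meas: "s \<ge> 0 \<Longrightarrow> L s \<in> borel_measurable M"
  using lt by (auto simp: local_time_at_0_def continuous_process_def)

lemma L_cont: "\<omega> \<in> space M \<Longrightarrow> continuous_on {0..} (\<lambda>s. L s \<omega>)"
  using lt by (auto simp: local_time_at_0_def continuous_process_def)

definition near_zero_time :: "real \<Rightarrow> real \<Rightarrow> 'a \<Rightarrow> real" where
  "near_zero_time e s \<omega> = (LINT u:{0..s}|lborel. indicat_real {-e<..<e} (B u \<omega>))"

lemma L_limit:
  "AE \<omega> in M. \<forall>s\<ge>0. ((\<lambda>e. 1 / (2 * e) * near_zero_time e s \<omega>) \<longlongrightarrow> L s \<omega>) (at_right 0)"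
  using lt by (simp add: local_time_at_0_def near_zero_time_def)

lemma near_zero_integrable:
  assumes "\<omega> \<in> space M"
  shows "set_integrable lborel {0..s} (\<lambda>u. indicat_real {-e<..<e} (B u \<omega>))"
proof -
  have "(\<lambda>u. indicator {0..s} u *\<^sub>R B u \<omega>) \<in> borel_measurable lborel"
    using borel_measurable_continuous_on_indicator[OF _ continuous_on_subset[OF B_cont[OF assms], of "{0..s}"]] by auto
  then have "(\<lambda>u. indicator {0..s} u *\<^sub>R indicat_real {-e<..<e} (indicator {0..s} u *\<^sub>R B u \<omega>)) \<in> borel_measurable lborel"
    by measurable
  moreover have "(\<lambda>u. indicator {0..s} u *\<^sub>R indicat_real {-e<..<e} (indicator {0..s} u *\<^sub>R B u \<omega>)) =
      (\<lambda>u. indicator {0..s} u *\<^sub>R indicat_real {-e<..<e} (B u \<omega>))"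
    by (auto simp: fun_eq_iff indicator_def)
  ultimately have m: "(\<lambda>u. indicator {0..s} u *\<^sub>R indicat_real {-e<..<e} (B u \<omega>)) \<in> borel_measurable lborel" by simp
  show ?thesis
    unfolding set_integrable_def
  proof (rule Bochner_Integration.integrable_bound[OF _ m])
    show "integrable lborel (indicat_real {0..s})"
      by (intro integrable_real_indicator emeasure_bounded_finite) auto
  qed (auto simp: indicator_def)
qed

sublocale trap: occupation M B "trapezoid n" "real n / 2" for n
  by unfold_locales (rule trapezoid_cont trapezoid_bounds)+

lemma trapezoid_squeeze:
  assumes "\<omega> \<in> space M" "n > 0"
  shows "real n / 2 * near_zero_time ((1 - 1 / real n) / real n) s \<omega> \<le> occ (trapezoid n) s \<omega>"
    "occ (trapezoid n) s \<omega> \<le> real n / 2 * near_zero_time (1 / real n) s \<omega>"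
proof -
  have i: "set_integrable lborel {0..s} (\<lambda>u. real n / 2 * indicat_real {-e<..<e} (B u \<omega>))" for e
    by (intro set_integrable_mult_right near_zero_integrable[OF assms(1)])
  show "real n / 2 * near_zero_time ((1 - 1 / real n) / real n) s \<omega> \<le> occ (trapezoid n) s \<omega>"
    unfolding near_zero_time_def occ_def set_integral_mult_right[symmetric]
  proof (rule set_integral_mono[OF i trap.occ_eq_integral(2)[OF assms(1)]])
    fix u
    show "real n / 2 * indicat_real {- ((1 - 1 / real n) / real n)<..<(1 - 1 / real n) / real n} (B u \<omega>) \<le> trapezoid n (B u \<omega>)"
      using trapezoid_top[OF assms(2), of "B u \<omega>"] trapezoid_bounds(1)[of n "B u \<omega>"]
      by (auto simp: indicator_def abs_le_iff)
  qed
  show "occ (trapezoid n) s \<omega> \<le> real n / 2 * near_zero_time (1 / real n) s \<omega>"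
    unfolding near_zero_time_def occ_def set_integral_mult_right[symmetric]
  proof (rule set_integral_mono[OF trap.occ_eq_integral(2)[OF assms(1)] i])
    fix u
    show "trapezoid n (B u \<omega>) \<le> real n / 2 * indicat_real {- (1 / real n)<..<1 / real n} (B u \<omega>)"
      using trapezoid_zero[of n "B u \<omega>"] trapezoid_bounds(2)[of n "B u \<omega>"]
      by (cases "\<bar>B u \<omega>\<bar> \<ge> 1 / real n") (auto simp: indicator_def abs_less_iff not_le)
  qed
qed

text \<open>Outside one null set all pathwise properties of the local time hold simultaneously for all
  times.\<close>

definition good :: "'a \<Rightarrow> bool" where
  "good \<omega> \<longleftrightarrow> B 0 \<omega> = 0 \<and> (\<forall>s\<ge>0. ((\<lambda>e. 1 / (2 * e) * near_zero_time e s \<omega>) \<longlongrightarrow> L s \<omega>) (at_right 0))"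

lemma AE_good: "AE \<omega> in M. good \<omega>"
  using B_zero L_limit by (auto simp: good_def)

lemma occ_tendsto_L:
  assumes "\<omega> \<in> space M" "good \<omega>" "s \<ge> 0"
  shows "(\<lambda>n. occ (trapezoid (n + 2)) s \<omega>) \<longlonglongrightarrow> L s \<omega>"
proof -
  let ?a = "\<lambda>e. 1 / (2 * e) * near_zero_time e s \<omega>"
  have lim: "(?a \<longlongrightarrow> L s \<omega>) (at_right 0)" using assms by (simp add: good_def)
  \<comment> \<open>The shift by \<open>2\<close> makes the inner radius \<open>?e2 n\<close> positive.\<close>
  let ?e1 = "\<lambda>n. 1 / real (n + 2)" and ?e2 = "\<lambda>n. (1 - 1 / real (n + 2)) / real (n + 2)"
  have e1: "?e1 \<longlonglongrightarrow> 0" using LIMSEQ_ignore_initial_segment[OF lim_1_over_n, of 2] by simp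
  then have "(\<lambda>n. (1 - ?e1 n) * ?e1 n) \<longlonglongrightarrow> (1 - 0) * 0" by (intro tendsto_intros)
  then have e2: "?e2 \<longlonglongrightarrow> 0" by simp
  have p: "0 < ?e1 n" "0 < ?e2 n" for n by auto
  have f1: "filterlim ?e1 (at_right 0) sequentially" and f2: "filterlim ?e2 (at_right 0) sequentially"
    using e1 e2 p by (auto simp: filterlim_at intro!: always_eventually)
  have l1: "(\<lambda>n. ?a (?e1 n)) \<longlonglongrightarrow> L s \<omega>" by (rule filterlim_compose[OF lim f1])
  \<comment> \<open>The factor \<open>1 - ?e1 n\<close> corrects the normalization, which belongs to the outer radius.\<close>
  have l2a: "(\<lambda>n. (1 - ?e1 n) * ?a (?e2 n)) \<longlonglongrightarrow> (1 - 0) * L s \<omega>"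
    by (intro tendsto_intros e1 filterlim_compose[OF lim f2])
  have eq: "(1 - ?e1 n) * ?a (?e2 n) = real (n + 2) / 2 * near_zero_time (?e2 n) s \<omega>" for n
  proof -
    have q: "a * (1 / (2 * (a / m))) = m / 2" if "a \<noteq> 0" for a m :: real using that by simp
    have "1 - ?e1 n \<noteq> 0" by simp
    from q[OF this, of "real (n + 2)"] show ?thesis by (metis mult.assoc)
  qed
  have l2: "(\<lambda>n. real (n + 2) / 2 * near_zero_time (?e2 n) s \<omega>) \<longlonglongrightarrow> L s \<omega>"
    using l2a unfolding eq by (simp only: diff_0_right mult_1_left)
  have l1': "(\<lambda>n. real (n + 2) / 2 * near_zero_time (?e1 n) s \<omega>) \<longlonglongrightarrow> L s \<omega>" using l1 by simp
  show ?thesis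
    by (rule tendsto_sandwich[OF _ _ l2 l1']; intro always_eventually allI trapezoid_squeeze assms(1)) auto
qed

text \<open>All properties pass to the limit from the occupation integrals. For the last one, \<open>\<bar>B\<bar>\<close> is bounded
  away from \<open>0\<close> on the interval, so that narrow bumps vanish along the path.\<close>

lemma L_good:
  assumes "\<omega> \<in> space M" "good \<omega>"
  shows "L 0 \<omega> = 0" "0 \<le> s \<Longrightarrow> 0 \<le> L s \<omega>" "0 \<le> r \<Longrightarrow> r \<le> u \<Longrightarrow> L r \<omega> \<le> L u \<omega>"
    "0 \<le> r \<Longrightarrow> r \<le> u \<Longrightarrow> (\<And>v. v \<in> {r..u} \<Longrightarrow> B v \<omega> \<noteq> 0) \<Longrightarrow> L u \<omega> = L r \<omega>"
proof -
  note lim = occ_tendsto_L[OF assms]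
  have "occ (trapezoid (n + 2)) 0 \<omega> = 0" for n
    using trap.occ_eq_integral(1)[OF assms(1), of "n + 2" 0] by simp
  then show "L 0 \<omega> = 0" using lim[of 0] LIMSEQ_unique[OF _ tendsto_const] by force
  show "0 \<le> s \<Longrightarrow> 0 \<le> L s \<omega>"
    by (rule LIMSEQ_le_const[OF lim]) (auto intro: trap.occ_nonneg)
  show "L r \<omega> \<le> L u \<omega>" if "0 \<le> r" "r \<le> u" for r u
    using that by (intro LIMSEQ_le[OF lim lim]) (auto intro!: exI trap.occ_increment assms(1))
  show "L u \<omega> = L r \<omega>" if ru: "0 \<le> r" "r \<le> u" and nz: "\<And>v. v \<in> {r..u} \<Longrightarrow> B v \<omega> \<noteq> 0" for r u
  proof -
    have c: "continuous_on {r..u} (\<lambda>v. \<bar>B v \<omega>\<bar>)"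
      using ru by (intro continuous_intros continuous_on_subset[OF B_cont[OF assms(1)]]) auto
    obtain v where v: "v \<in> {r..u}" "\<And>y. y \<in> {r..u} \<Longrightarrow> \<bar>B v \<omega>\<bar> \<le> \<bar>B y \<omega>\<bar>"
      using continuous_attains_inf[OF compact_Icc _ c] ru by auto
    have d: "\<bar>B v \<omega>\<bar> > 0" using nz[OF v(1)] by simp
    obtain N :: nat where N: "1 / \<bar>B v \<omega>\<bar> < real N" using reals_Archimedean2 by blast
    have "occ (trapezoid (n + 2)) u \<omega> = occ (trapezoid (n + 2)) r \<omega>" if "n \<ge> N" for n
    proof -
      have "1 / real (n + 2) \<le> \<bar>B v \<omega>\<bar>"
      proof -
        have "1 / \<bar>B v \<omega>\<bar> < real (n + 2)" using N that by simp
        then show ?thesis using d by (simp add: field_simps)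
      qed
      then have z: "trapezoid (n + 2) (B y \<omega>) = 0" if "y \<in> {r..u}" for y
        using v(2)[OF that] by (intro trapezoid_zero) linarith
      have "(\<lambda>v. trapezoid (n + 2) (B v \<omega>)) integrable_on {0..u}"
        by (intro integrable_continuous_interval continuous_on_subset[OF trap.cB_cont[OF assms(1)]]) auto
      then have "occ (trapezoid (n + 2)) u \<omega> = occ (trapezoid (n + 2)) r \<omega> + integral {r..u} (\<lambda>v. trapezoid (n + 2) (B v \<omega>))"
        using Henstock_Kurzweil_Integration.integral_combine[OF ru] trap.occ_eq_integral(1)[OF assms(1)] by metis
      also have "integral {r..u} (\<lambda>v. trapezoid (n + 2) (B v \<omega>)) = integral {r..u} (\<lambda>v. 0)"
        by (rule Henstock_Kurzweil_Integration.integral_cong) (rule z)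
      finally show ?thesis by simp
    qed
    then have "\<forall>\<^sub>F n in sequentially. occ (trapezoid (n + 2)) u \<omega> = occ (trapezoid (n + 2)) r \<omega>"
      by (auto simp: eventually_sequentially)
    then have "(\<lambda>n. occ (trapezoid (n + 2)) r \<omega>) \<longlonglongrightarrow> L u \<omega>"
      using lim[of u] ru by (simp add: tendsto_cong)
    then show ?thesis using lim[of r] ru LIMSEQ_unique by blast
  qed
qed

text \<open>The density of \<open>B u\<close> is bounded by a constant multiple of \<open>1 / sqrt u\<close>, and the bump has mass at
  most \<open>1\<close>. The bound is uniform in \<open>n\<close>.\<close>

lemma expected_trapezoid:
  assumes "u > 0" "n > 0"
  shows "(\<integral>\<omega>. trapezoid n (B u \<omega>) \<partial>M) \<le> 1 / sqrt u"
proof -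
  let ?r = "1 / (real n * sqrt u)"
  have su: "sqrt u > 0" using assms by simp
  have "(\<integral>\<omega>. trapezoid n (B u \<omega>) \<partial>M) = (\<integral>z. trapezoid n (sqrt u * z) \<partial>std_normal_distribution)"
    by (rule B_law[OF assms(1) trap.c_meas])
  also have "\<dots> = (\<integral>z. std_normal_density z * trapezoid n (sqrt u * z) \<partial>lborel)"
    by (subst integral_density) (auto intro!: measurable_compose[OF _ trap.c_meas])
  also have "\<dots> \<le> (\<integral>z. real n / 2 * indicator {-?r..?r} z \<partial>lborel)"
  proof (rule integral_mono')
    show "integrable lborel (\<lambda>z. real n / 2 * indicator {-?r..?r} z)"
      by (intro integrable_mult_right integrable_real_indicator emeasure_bounded_finite) auto
    fix z
    have d: "std_normal_density z \<le> 1"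
    proof -
      have "1 / sqrt (2 * pi) \<le> 1" using pi_ge_two by (simp add: divide_le_eq real_le_rsqrt)
      moreover have "exp (- z\<^sup>2 / 2) \<le> 1" by simp
      ultimately have "1 / sqrt (2 * pi) * exp (- z\<^sup>2 / 2) \<le> 1 * 1" by (intro mult_mono) auto
      then show ?thesis by (simp add: std_normal_density_def)
    qed
    show "std_normal_density z * trapezoid n (sqrt u * z) \<le> real n / 2 * indicator {-?r..?r} z"
    proof (cases "z \<in> {-?r..?r}")
      case True
      then show ?thesis using mult_mono[OF d trapezoid_bounds(2)[of n "sqrt u * z"]] trapezoid_bounds(1)[of n "sqrt u * z"] by simp
    next
      case False
      then have "\<bar>z\<bar> > ?r" by auto
      then have "1 / real n \<le> \<bar>sqrt u * z\<bar>" using su assms(2) by (simp add: abs_mult field_simps)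
      then show ?thesis using trapezoid_zero False by simp
    qed
  qed (auto simp: trapezoid_bounds)
  also have "\<dots> = real n / 2 * (2 * ?r)" using assms by simp
  also have "\<dots> = 1 / sqrt u" using assms by simp
  finally show ?thesis .
qed

end


section \<open>The martingale of the reflected motion and its local time\<close>

context bm_local_time
begin

text \<open>Feynman-Kac with potential \<open>k c\<close> for \<open>g(x) = \<xi> cos (\<xi> x) + k \<Psi>(x)\<close>, where \<open>\<Psi>\<close> is the smoothed
  sine. As \<open>g'' / 2 - k c g = -\<xi>\<^sup>2 g / 2 + k c (\<xi> - g)\<close> and \<open>\<xi> - g\<close> is of order \<open>1 / n\<close> on the
  support of \<open>c\<close>, the function \<open>\<phi> n\<close> satisfies \<open>\<phi>' = -\<xi>\<^sup>2 \<phi> / 2\<close> up to an error of this order.\<close>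

lemma pitman_martingale:
  assumes su: "0 \<le> s" "s < u" and k: "0 \<le> k"
    and H: "H \<in> borel_measurable (history M B s)" "\<And>\<omega>. \<omega> \<in> space M \<Longrightarrow> \<bar>H \<omega>\<bar> \<le> cH"
  shows "(\<integral>\<omega>. H \<omega> * pitman_fun \<xi> k \<bar>B u \<omega>\<bar> (L u \<omega>) \<partial>M) =
     exp (- \<xi>\<^sup>2 * (u - s) / 2) * (\<integral>\<omega>. H \<omega> * pitman_fun \<xi> k \<bar>B s \<omega>\<bar> (L s \<omega>) \<partial>M)"
proof -
  let ?G = "\<lambda>x l. exp (- k * l) * (\<xi> * cos (\<xi> * x) + k * sin (\<xi> * \<bar>x\<bar>))"
  have G: "pitman_fun \<xi> k \<bar>x\<bar> l = ?G x l" for x l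
    by (cases "x \<ge> 0") (simp_all add: pitman_fun_def)
  have cH: "0 \<le> cH" using H(2) not_empty by force
  have Hm[measurable]: "H \<in> borel_measurable M"
    using H(1) sets_history_subset_events[of B M s, OF B_meas] by (auto simp: measurable_def)
  have occm[measurable]: "occ (trapezoid n) r \<in> borel_measurable M" for n r
    using trap.occ_adapted[of n r] sets_history_subset_events[of B M r, OF B_meas] by (auto simp: measurable_def)
  define D where "D = \<bar>\<xi>\<bar> + k * 2"
  have D0: "0 \<le> D" using k by (simp add: D_def)
  have "\<forall>n. \<exists>\<Psi> \<Psi>'. (\<forall>x. DERIV \<Psi> x :> \<Psi>' x) \<and>
     (\<forall>x. DERIV \<Psi>' x :> 2 * \<xi> * trapezoid (n + 2) x - \<xi>\<^sup>2 * \<Psi> x) \<and>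
     (\<forall>x. \<bar>\<Psi> x\<bar> \<le> 2) \<and> (\<forall>x. \<bar>\<Psi> x\<bar> \<le> 2 * \<bar>\<xi>\<bar> * \<bar>x\<bar>) \<and>
     (\<forall>x. \<bar>x\<bar> \<ge> 1 / real (n + 2) \<longrightarrow> \<bar>\<Psi> x - sin (\<xi> * \<bar>x\<bar>)\<bar> \<le> (1 + 2 * \<bar>\<xi>\<bar>) / real (n + 2))"
  proof
    fix n
    show "\<exists>\<Psi> \<Psi>'. (\<forall>x. DERIV \<Psi> x :> \<Psi>' x) \<and>
     (\<forall>x. DERIV \<Psi>' x :> 2 * \<xi> * trapezoid (n + 2) x - \<xi>\<^sup>2 * \<Psi> x) \<and>
     (\<forall>x. \<bar>\<Psi> x\<bar> \<le> 2) \<and> (\<forall>x. \<bar>\<Psi> x\<bar> \<le> 2 * \<bar>\<xi>\<bar> * \<bar>x\<bar>) \<and>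
     (\<forall>x. \<bar>x\<bar> \<ge> 1 / real (n + 2) \<longrightarrow> \<bar>\<Psi> x - sin (\<xi> * \<bar>x\<bar>)\<bar> \<le> (1 + 2 * \<bar>\<xi>\<bar>) / real (n + 2))"
      by (rule smoothed_sine[of "n + 2" \<xi>], simp, blast)
  qed
  then obtain \<Psi> \<Psi>' where \<Psi>: "\<And>n x. DERIV (\<Psi> n) x :> \<Psi>' n x"
     "\<And>n x. DERIV (\<Psi>' n) x :> 2 * \<xi> * trapezoid (n + 2) x - \<xi>\<^sup>2 * \<Psi> n x"
     "\<And>n x. \<bar>\<Psi> n x\<bar> \<le> 2" "\<And>n x. \<bar>\<Psi> n x\<bar> \<le> 2 * \<bar>\<xi>\<bar> * \<bar>x\<bar>"
     "\<And>n x. \<bar>x\<bar> \<ge> 1 / real (n + 2) \<Longrightarrow> \<bar>\<Psi> n x - sin (\<xi> * \<bar>x\<bar>)\<bar> \<le> (1 + 2 * \<bar>\<xi>\<bar>) / real (n + 2)"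
    by metis
  define g where "g n x = \<xi> * cos (\<xi> * x) + k * \<Psi> n x" for n x
  define g' where "g' n x = - \<xi>\<^sup>2 * sin (\<xi> * x) + k * \<Psi>' n x" for n x
  define g'' where "g'' n x = - \<xi>\<^sup>2 * g n x + 2 * k * \<xi> * trapezoid (n + 2) x" for n x
  have gb: "\<bar>g n x\<bar> \<le> D" for n x
  proof -
    have "\<bar>g n x\<bar> \<le> \<bar>\<xi>\<bar> * \<bar>cos (\<xi> * x)\<bar> + k * \<bar>\<Psi> n x\<bar>"
      unfolding g_def using abs_triangle_ineq[of "\<xi> * cos (\<xi> * x)" "k * \<Psi> n x"] k by (simp add: abs_mult)
    also have "\<dots> \<le> \<bar>\<xi>\<bar> * 1 + k * 2" using k \<Psi>(3) by (intro add_mono mult_left_mono) auto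
    finally show ?thesis by (simp add: D_def)
  qed
  have FK: "feynman_kac M B (trapezoid (n + 2)) (real (n + 2) / 2) (g n) (g' n) (g'' n) D (\<xi>\<^sup>2 * D + 2 * k * \<bar>\<xi>\<bar> * (real (n + 2) / 2)) k" for n
  proof (unfold_locales)
    show "DERIV (g n) x :> g' n x" for x
      unfolding g_def[abs_def] g'_def
      by (auto intro!: derivative_eq_intros \<Psi>(1) simp: power2_eq_square)
    show "DERIV (g' n) x :> g'' n x" for x
      unfolding g''_def g'_def[abs_def] g_def
      by (auto intro!: derivative_eq_intros \<Psi>(2) simp: power2_eq_square algebra_simps)
    have "continuous_on UNIV (\<Psi> n)"
      using \<Psi>(1) by (auto simp: continuous_on_eq_continuous_at intro: DERIV_isCont)
    then show "continuous_on UNIV (g'' n)"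
      unfolding g''_def g_def by (intro continuous_intros trapezoid_cont) auto
    show "\<bar>g'' n x\<bar> \<le> \<xi>\<^sup>2 * D + 2 * k * \<bar>\<xi>\<bar> * (real (n + 2) / 2)" for x
    proof -
      have "\<bar>g'' n x\<bar> \<le> \<xi>\<^sup>2 * \<bar>g n x\<bar> + 2 * k * \<bar>\<xi>\<bar> * trapezoid (n + 2) x"
        unfolding g''_def using abs_triangle_ineq[of "- \<xi>\<^sup>2 * g n x" "2 * k * \<xi> * trapezoid (n + 2) x"] k
          trapezoid_bounds(1)[of "n + 2" x] by (simp add: abs_mult)
      also have "\<dots> \<le> \<xi>\<^sup>2 * D + 2 * k * \<bar>\<xi>\<bar> * (real (n + 2) / 2)"
        using k by (intro add_mono mult_left_mono gb trapezoid_bounds) auto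
      finally show ?thesis .
    qed
  qed (rule gb k)+
  have gm[measurable]: "g n \<in> borel_measurable borel" for n
  proof -
    interpret feynman_kac M B "trapezoid (n + 2)" "real (n + 2) / 2" "g n" "g' n" "g'' n" D "\<xi>\<^sup>2 * D + 2 * k * \<bar>\<xi>\<bar> * (real (n + 2) / 2)" k by (rule FK)
    show ?thesis by (rule meas0)
  qed
  let ?w = "\<lambda>n r \<omega>. exp (- k * occ (trapezoid (n + 2)) r \<omega>)"
  define \<phi> where "\<phi> n r = (\<integral>\<omega>. H \<omega> * ?w n r \<omega> * g n (B r \<omega>) \<partial>M)" for n r
  define err where "err n r = (\<integral>\<omega>. H \<omega> * ?w n r \<omega> * (k * trapezoid (n + 2) (B r \<omega>) * (\<xi> - g n (B r \<omega>))) \<partial>M)" for n r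
  have wb: "0 \<le> ?w n r \<omega>" "?w n r \<omega> \<le> 1" for n r \<omega>
    using trap.occ_nonneg[of "n + 2" r \<omega>] k by auto
  have Hwb: "\<bar>H \<omega> * ?w n r \<omega>\<bar> \<le> cH" if "\<omega> \<in> space M" for n r \<omega>
    using mult_mono[OF H(2)[OF that] wb(2)[of n r \<omega>]] cH wb(1)[of n r \<omega>] by (simp add: abs_mult)
  have kernel: "\<bar>trapezoid (n + 2) x * (\<xi> - g n x)\<bar> \<le> trapezoid (n + 2) x * ((\<xi>\<^sup>2 + 2 * k * \<bar>\<xi>\<bar>) / real (n + 2))" for n x
  proof (cases "\<bar>x\<bar> \<ge> 1 / real (n + 2)")
    case True then show ?thesis by (simp add: trapezoid_zero)
  next
    case False
    have "\<xi> - g n x = - (\<xi> * (cos (\<xi> * x) - 1)) - k * \<Psi> n x" by (simp add: g_def algebra_simps)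
    then have "\<bar>\<xi> - g n x\<bar> \<le> \<bar>\<xi>\<bar> * \<bar>cos (\<xi> * x) - 1\<bar> + k * \<bar>\<Psi> n x\<bar>"
      using abs_triangle_ineq4[of "- (\<xi> * (cos (\<xi> * x) - 1))" "k * \<Psi> n x"] k by (simp only: abs_mult abs_minus_cancel abs_of_nonneg)
    also have "\<dots> \<le> \<bar>\<xi>\<bar> * (\<bar>\<xi>\<bar> * \<bar>x\<bar>) + k * (2 * \<bar>\<xi>\<bar> * \<bar>x\<bar>)"
      using one_minus_cos_le[of "\<xi> * x"] \<Psi>(4)[of n x] k by (intro add_mono mult_left_mono) (auto simp: abs_mult)
    also have "\<dots> = (\<xi>\<^sup>2 + 2 * k * \<bar>\<xi>\<bar>) * \<bar>x\<bar>" by (simp add: power2_eq_square distrib_right flip: mult.assoc)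
    also have "\<dots> \<le> (\<xi>\<^sup>2 + 2 * k * \<bar>\<xi>\<bar>) * (1 / real (n + 2))"
      using False k by (intro mult_left_mono) auto
    finally have "\<bar>\<xi> - g n x\<bar> \<le> (\<xi>\<^sup>2 + 2 * k * \<bar>\<xi>\<bar>) / real (n + 2)" by simp
    then show ?thesis unfolding abs_mult abs_of_nonneg[OF trapezoid_bounds(1)]
      by (intro mult_left_mono trapezoid_bounds)
  qed
  define E where "E = cH * k * (\<xi>\<^sup>2 + 2 * k * \<bar>\<xi>\<bar>)"
  have E0: "0 \<le> E" using cH k by (simp add: E_def)
  have errb: "\<bar>err n r\<bar> \<le> E / real (n + 2) / sqrt r" if r: "0 < r" for n r
  proof -
    have [measurable]: "B r \<in> borel_measurable M" using r by (intro B_meas) auto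
    note [measurable] = trap.c_meas
    let ?b = "E / real (n + 2)"
    have pt: "\<bar>H \<omega> * ?w n r \<omega> * (k * trapezoid (n + 2) (B r \<omega>) * (\<xi> - g n (B r \<omega>)))\<bar> \<le> ?b * trapezoid (n + 2) (B r \<omega>)" if "\<omega> \<in> space M" for \<omega>
    proof -
      have "\<bar>H \<omega> * ?w n r \<omega> * (k * trapezoid (n + 2) (B r \<omega>) * (\<xi> - g n (B r \<omega>)))\<bar> =
          \<bar>H \<omega> * ?w n r \<omega>\<bar> * (k * \<bar>trapezoid (n + 2) (B r \<omega>) * (\<xi> - g n (B r \<omega>))\<bar>)"
        using k by (simp add: abs_mult)
      also have "\<dots> \<le> cH * (k * (trapezoid (n + 2) (B r \<omega>) * ((\<xi>\<^sup>2 + 2 * k * \<bar>\<xi>\<bar>) / real (n + 2))))"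
        by (intro mult_mono Hwb[OF that] mult_left_mono kernel k cH) (use k in auto)
      also have "\<dots> = ?b * trapezoid (n + 2) (B r \<omega>)" by (simp add: E_def)
      finally show ?thesis .
    qed
    have it: "integrable M (\<lambda>\<omega>. ?b * trapezoid (n + 2) (B r \<omega>))"
    proof (intro integrable_mult_right integrable_const_bound[of _ "real (n + 2) / 2"] AE_I2)
      show "norm (trapezoid (n + 2) (B r \<omega>)) \<le> real (n + 2) / 2" for \<omega>
        by (simp only: real_norm_def abs_of_nonneg[OF trapezoid_bounds(1)] trapezoid_bounds(2))
    qed measurable
    have ii: "integrable M (\<lambda>\<omega>. H \<omega> * ?w n r \<omega> * (k * trapezoid (n + 2) (B r \<omega>) * (\<xi> - g n (B r \<omega>))))"
    proof (rule Bochner_Integration.integrable_bound[OF it _ AE_I2])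
      fix \<omega> assume "\<omega> \<in> space M"
      from order_trans[OF pt[OF this] abs_ge_self]
      show "norm (H \<omega> * ?w n r \<omega> * (k * trapezoid (n + 2) (B r \<omega>) * (\<xi> - g n (B r \<omega>)))) \<le> norm (?b * trapezoid (n + 2) (B r \<omega>))"
        unfolding real_norm_def .
    qed measurable
    have "\<bar>err n r\<bar> \<le> (\<integral>\<omega>. \<bar>H \<omega> * ?w n r \<omega> * (k * trapezoid (n + 2) (B r \<omega>) * (\<xi> - g n (B r \<omega>)))\<bar> \<partial>M)"
      unfolding err_def by (rule integral_abs_bound)
    also have "\<dots> \<le> (\<integral>\<omega>. ?b * trapezoid (n + 2) (B r \<omega>) \<partial>M)"
      by (intro integral_mono it pt integrable_abs ii)
    also have "\<dots> = ?b * (\<integral>\<omega>. trapezoid (n + 2) (B r \<omega>) \<partial>M)" by simp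
    also have "\<dots> \<le> ?b * (1 / sqrt r)"
      using E0 r by (intro mult_left_mono expected_trapezoid) auto
    finally show ?thesis by simp
  qed
  have deriv: "((\<lambda>r. exp (\<xi>\<^sup>2 * r / 2) * \<phi> n r) has_real_derivative exp (\<xi>\<^sup>2 * r / 2) * err n r) (at r)" if r: "s < r" for n r
  proof -
    interpret FK: feynman_kac M B "trapezoid (n + 2)" "real (n + 2) / 2" "g n" "g' n" "g'' n" D "\<xi>\<^sup>2 * D + 2 * k * \<bar>\<xi>\<bar> * (real (n + 2) / 2)" k by (rule FK)
    have [measurable]: "B r \<in> borel_measurable M" using r su by (intro B_meas) auto
    note [measurable] = trap.c_meas
    have "(\<integral>\<omega>. H \<omega> * ?w n r \<omega> * (g'' n (B r \<omega>) / 2 - k * trapezoid (n + 2) (B r \<omega>) * g n (B r \<omega>)) \<partial>M) = - \<xi>\<^sup>2 / 2 * \<phi> n r + err n r"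
    proof -
      have i1: "integrable M (\<lambda>\<omega>. - \<xi>\<^sup>2 / 2 * (H \<omega> * ?w n r \<omega> * g n (B r \<omega>)))"
      proof (intro integrable_mult_right integrable_const_bound[of _ "cH * D"] AE_I2)
        fix \<omega> assume "\<omega> \<in> space M"
        then show "norm (H \<omega> * ?w n r \<omega> * g n (B r \<omega>)) \<le> cH * D"
          unfolding real_norm_def abs_mult[of "H \<omega> * ?w n r \<omega>"] by (intro mult_mono Hwb gb cH) auto
      qed measurable
      have i2: "integrable M (\<lambda>\<omega>. H \<omega> * ?w n r \<omega> * (k * trapezoid (n + 2) (B r \<omega>) * (\<xi> - g n (B r \<omega>))))"
      proof (intro integrable_const_bound[of _ "cH * (k * (real (n + 2) / 2 * (\<bar>\<xi>\<bar> + D)))"] AE_I2)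
        fix \<omega> assume w: "\<omega> \<in> space M"
        have "\<bar>k * trapezoid (n + 2) (B r \<omega>) * (\<xi> - g n (B r \<omega>))\<bar> = k * (trapezoid (n + 2) (B r \<omega>) * \<bar>\<xi> - g n (B r \<omega>)\<bar>)"
          using k by (simp add: abs_mult trapezoid_bounds)
        also have "\<dots> \<le> k * (real (n + 2) / 2 * (\<bar>\<xi>\<bar> + D))"
          using gb[of n "B r \<omega>"] k by (intro mult_left_mono mult_mono trapezoid_bounds) auto
        finally show "norm (H \<omega> * ?w n r \<omega> * (k * trapezoid (n + 2) (B r \<omega>) * (\<xi> - g n (B r \<omega>)))) \<le> cH * (k * (real (n + 2) / 2 * (\<bar>\<xi>\<bar> + D)))"
          unfolding real_norm_def abs_mult[of "H \<omega> * ?w n r \<omega>"] using w by (intro mult_mono Hwb cH) auto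
      qed measurable
      show ?thesis
        unfolding \<phi>_def err_def integral_mult_right_zero[symmetric] Bochner_Integration.integral_add[OF i1 i2, symmetric]
        by (intro Bochner_Integration.integral_cong refl) (simp add: g''_def algebra_simps add_divide_distrib diff_divide_distrib)
    qed
    with FK.feynman_kac_derivative[OF su(1) r H]
    have "(\<phi> n has_real_derivative - \<xi>\<^sup>2 / 2 * \<phi> n r + err n r) (at r)" by (simp add: \<phi>_def[abs_def])
    then show ?thesis by (auto intro!: derivative_eq_intros simp: algebra_simps)
  qed
  define \<phi>' where "\<phi>' r = (\<integral>\<omega>. H \<omega> * ?G (B r \<omega>) (L r \<omega>) \<partial>M)" for r
  have Gb: "\<bar>?G x l\<bar> \<le> D" if "0 \<le> l" for x l
  proof -
    have "\<bar>\<xi> * cos (\<xi> * x) + k * sin (\<xi> * \<bar>x\<bar>)\<bar> \<le> \<bar>\<xi>\<bar> * \<bar>cos (\<xi> * x)\<bar> + k * \<bar>sin (\<xi> * \<bar>x\<bar>)\<bar>"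
      using abs_triangle_ineq[of "\<xi> * cos (\<xi> * x)" "k * sin (\<xi> * \<bar>x\<bar>)"] k by (simp add: abs_mult)
    also have "\<dots> \<le> \<bar>\<xi>\<bar> * 1 + k * 2"
      using k abs_sin_le_one[of "\<xi> * \<bar>x\<bar>"] by (intro add_mono mult_left_mono) (auto intro: order_trans[OF abs_sin_le_one])
    finally have "\<bar>\<xi> * cos (\<xi> * x) + k * sin (\<xi> * \<bar>x\<bar>)\<bar> \<le> D" by (simp add: D_def)
    then have "exp (- k * l) * \<bar>\<xi> * cos (\<xi> * x) + k * sin (\<xi> * \<bar>x\<bar>)\<bar> \<le> 1 * D"
      using that k by (intro mult_mono) auto
    then show ?thesis by (simp add: abs_mult)
  qed
  have lim: "(\<lambda>n. \<phi> n r) \<longlonglongrightarrow> \<phi>' r" if r: "0 \<le> r" for r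
    unfolding \<phi>_def \<phi>'_def
  proof (rule integral_dominated_convergence[where w = "\<lambda>_. cH * D"])
    have [measurable]: "B r \<in> borel_measurable M" "L r \<in> borel_measurable M" using r by (auto intro!: B_meas L_meas)
    show "(\<lambda>\<omega>. H \<omega> * ?G (B r \<omega>) (L r \<omega>)) \<in> borel_measurable M" by measurable
    show "(\<lambda>\<omega>. H \<omega> * ?w n r \<omega> * g n (B r \<omega>)) \<in> borel_measurable M" for n by measurable
    show "AE \<omega> in M. norm (H \<omega> * ?w n r \<omega> * g n (B r \<omega>)) \<le> cH * D" for n
      unfolding real_norm_def abs_mult[of "H _ * ?w n r _"] by (intro AE_I2 mult_mono Hwb gb cH) auto
    show "AE \<omega> in M. (\<lambda>n. H \<omega> * ?w n r \<omega> * g n (B r \<omega>)) \<longlonglongrightarrow> H \<omega> * ?G (B r \<omega>) (L r \<omega>)"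
      using AE_good AE_space
    proof eventually_elim
      case (elim \<omega>)
      have "(\<lambda>n. \<Psi> n x) \<longlonglongrightarrow> sin (\<xi> * \<bar>x\<bar>)" for x
      proof (cases "x = 0")
        case True
        then have "\<Psi> n x = 0" for n using \<Psi>(4)[of n 0] by simp
        then show ?thesis using True by simp
      next
        case False
        obtain N :: nat where N: "1 / \<bar>x\<bar> < real N" using reals_Archimedean2 by blast
        have "norm (\<Psi> n x - sin (\<xi> * \<bar>x\<bar>)) \<le> (1 + 2 * \<bar>\<xi>\<bar>) * (1 / real (n + 2))" if "n \<ge> N" for n
        proof -
          have "1 / \<bar>x\<bar> < real (n + 2)" using N that by simp
          then have "1 / real (n + 2) \<le> \<bar>x\<bar>" using False by (simp add: field_simps)
          from \<Psi>(5)[OF this] show ?thesis by simp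
        qed
        then have ev: "\<forall>\<^sub>F n in sequentially. norm (\<Psi> n x - sin (\<xi> * \<bar>x\<bar>)) \<le> (1 + 2 * \<bar>\<xi>\<bar>) * (1 / real (n + 2))"
          by (auto simp: eventually_sequentially)
        have "(\<lambda>n. (1 + 2 * \<bar>\<xi>\<bar>) * (1 / real (n + 2))) \<longlonglongrightarrow> (1 + 2 * \<bar>\<xi>\<bar>) * 0"
          by (intro tendsto_mult tendsto_const LIMSEQ_ignore_initial_segment[OF lim_1_over_n])
        then have "(\<lambda>n. (1 + 2 * \<bar>\<xi>\<bar>) * (1 / real (n + 2))) \<longlonglongrightarrow> 0" by simp
        from Lim_null_comparison[OF ev this] show ?thesis by (simp add: LIM_zero_iff)
      qed
      moreover have "(\<lambda>n. occ (trapezoid (n + 2)) r \<omega>) \<longlonglongrightarrow> L r \<omega>"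
        using elim r by (intro occ_tendsto_L) auto
      ultimately have "(\<lambda>n. H \<omega> * ?w n r \<omega> * g n (B r \<omega>)) \<longlonglongrightarrow> H \<omega> * exp (- k * L r \<omega>) * (\<xi> * cos (\<xi> * B r \<omega>) + k * sin (\<xi> * \<bar>B r \<omega>\<bar>))"
        unfolding g_def by (intro tendsto_intros)
      then show ?case by (simp add: mult.assoc)
    qed
  qed simp
  \<comment> \<open>The error bound is integrable but not bounded near time \<open>0\<close>; it is used on \<open>[r, u]\<close> with \<open>r > s\<close>.\<close>
  have eq: "exp (\<xi>\<^sup>2 * u / 2) * \<phi>' u = exp (\<xi>\<^sup>2 * r / 2) * \<phi>' r" if r: "s < r" "r < u" for r
  proof -
    let ?\<psi> = "\<lambda>n q. exp (\<xi>\<^sup>2 * q / 2) * \<phi> n q"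
    let ?C = "(u - r) * (exp (\<xi>\<^sup>2 * u / 2) * (E / sqrt r))"
    have r0: "0 < r" using r su by simp
    have b: "norm (?\<psi> n u - ?\<psi> n r) \<le> ?C * (1 / real (n + 2))" for n
    proof -
      have "\<exists>z>r. z < u \<and> ?\<psi> n u - ?\<psi> n r = (u - r) * (exp (\<xi>\<^sup>2 * z / 2) * err n z)"
        by (rule MVT2[OF r(2)]) (rule deriv, use r(1) in linarith)
      then obtain z where z: "r < z" "z < u" "?\<psi> n u - ?\<psi> n r = (u - r) * (exp (\<xi>\<^sup>2 * z / 2) * err n z)"
        by blast
      have "\<bar>err n z\<bar> \<le> E / real (n + 2) / sqrt z" using z r0 by (intro errb) auto
      also have "\<dots> \<le> E / real (n + 2) / sqrt r"
        using z r0 E0 by (intro divide_left_mono) auto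
      finally have "\<bar>err n z\<bar> \<le> E / real (n + 2) / sqrt r" .
      then have "(u - r) * (exp (\<xi>\<^sup>2 * z / 2) * \<bar>err n z\<bar>) \<le> (u - r) * (exp (\<xi>\<^sup>2 * u / 2) * (E / real (n + 2) / sqrt r))"
        using z r by (intro mult_left_mono mult_mono) (auto intro!: mult_left_mono)
      then show ?thesis unfolding z(3) using r by (simp add: abs_mult mult_ac)
    qed
    have "(\<lambda>n. ?C * (1 / real (n + 2))) \<longlonglongrightarrow> ?C * 0"
      by (intro tendsto_mult tendsto_const LIMSEQ_ignore_initial_segment[OF lim_1_over_n])
    then have "(\<lambda>n. ?C * (1 / real (n + 2))) \<longlonglongrightarrow> 0" by simp
    from Lim_null_comparison[OF always_eventually[OF allI[OF b]] this]
    have "(\<lambda>n. ?\<psi> n u - ?\<psi> n r) \<longlonglongrightarrow> 0" .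
    moreover have "(\<lambda>n. ?\<psi> n u - ?\<psi> n r) \<longlonglongrightarrow> exp (\<xi>\<^sup>2 * u / 2) * \<phi>' u - exp (\<xi>\<^sup>2 * r / 2) * \<phi>' r"
      using r0 r by (intro tendsto_intros lim) auto
    ultimately show ?thesis using LIMSEQ_unique by fastforce
  qed
  \<comment> \<open>The derivative is known only after time \<open>s\<close>; continuity of the paths extends the identity to \<open>s\<close>.\<close>
  define r where "r j = s + (u - s) / real (j + 2)" for j :: nat
  have rj: "s < r j" "r j < u" for j
  proof -
    show "s < r j" using su by (simp add: r_def)
    have "(u - s) / real (j + 2) < (u - s) / 1"
      using su by (intro divide_strict_left_mono) auto
    then show "r j < u" by (simp add: r_def)
  qed
  have "(\<lambda>j. s + (u - s) * (1 / real (j + 2))) \<longlonglongrightarrow> s + (u - s) * 0"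
    by (intro tendsto_intros tendsto_mult tendsto_const LIMSEQ_ignore_initial_segment[OF lim_1_over_n])
  then have rl: "r \<longlonglongrightarrow> s" by (simp add: r_def[abs_def])
  have "(\<lambda>j. \<phi>' (r j)) \<longlonglongrightarrow> \<phi>' s"
    unfolding \<phi>'_def
  proof (rule integral_dominated_convergence[where w = "\<lambda>_. cH * D"])
    have [measurable]: "B s \<in> borel_measurable M" "L s \<in> borel_measurable M" using su by (auto intro!: B_meas L_meas)
    show "(\<lambda>\<omega>. H \<omega> * ?G (B s \<omega>) (L s \<omega>)) \<in> borel_measurable M" by measurable
    show "(\<lambda>\<omega>. H \<omega> * ?G (B (r j) \<omega>) (L (r j) \<omega>)) \<in> borel_measurable M" for j
    proof -
      have "0 \<le> r j" using rj(1)[of j] su by simp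
      then have [measurable]: "B (r j) \<in> borel_measurable M" "L (r j) \<in> borel_measurable M" by (auto intro!: B_meas L_meas)
      show ?thesis by measurable
    qed
    show "AE \<omega> in M. norm (H \<omega> * ?G (B (r j) \<omega>) (L (r j) \<omega>)) \<le> cH * D" for j
      using AE_good AE_space
    proof eventually_elim
      case (elim \<omega>)
      have "0 \<le> r j" using rj(1)[of j] su by simp
      then have "0 \<le> L (r j) \<omega>" using L_good(2)[of \<omega> "r j"] elim by simp
      from mult_mono[OF H(2)[OF elim(2)] Gb[OF this, of "B (r j) \<omega>"]] show ?case
        using cH by (simp add: abs_mult)
    qed
    show "AE \<omega> in M. (\<lambda>j. H \<omega> * ?G (B (r j) \<omega>) (L (r j) \<omega>)) \<longlonglongrightarrow> H \<omega> * ?G (B s \<omega>) (L s \<omega>)"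
    proof (rule AE_I2)
      fix \<omega> assume w: "\<omega> \<in> space M"
      have ev: "\<forall>\<^sub>F j in sequentially. r j \<in> {0..}" using rj(1) su by (auto intro!: always_eventually less_imp_le order_trans[OF su(1)])
      have "(\<lambda>j. B (r j) \<omega>) \<longlonglongrightarrow> B s \<omega>"
        using su by (intro continuous_on_tendsto_compose[OF B_cont[OF w] rl _ ev]) auto
      moreover have "(\<lambda>j. L (r j) \<omega>) \<longlonglongrightarrow> L s \<omega>"
        using su by (intro continuous_on_tendsto_compose[OF L_cont[OF w] rl _ ev]) auto
      ultimately show "(\<lambda>j. H \<omega> * ?G (B (r j) \<omega>) (L (r j) \<omega>)) \<longlonglongrightarrow> H \<omega> * ?G (B s \<omega>) (L s \<omega>)"
        by (intro tendsto_intros)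
    qed
  qed simp
  then have "(\<lambda>j. exp (\<xi>\<^sup>2 * r j / 2) * \<phi>' (r j)) \<longlonglongrightarrow> exp (\<xi>\<^sup>2 * s / 2) * \<phi>' s"
    by (intro tendsto_intros rl) auto
  moreover have "(\<lambda>j. exp (\<xi>\<^sup>2 * r j / 2) * \<phi>' (r j)) = (\<lambda>j. exp (\<xi>\<^sup>2 * u / 2) * \<phi>' u)"
    using eq[OF rj] by simp
  ultimately have "exp (\<xi>\<^sup>2 * u / 2) * \<phi>' u = exp (\<xi>\<^sup>2 * s / 2) * \<phi>' s"
    using LIMSEQ_unique[OF tendsto_const] by metis
  moreover have "exp (- \<xi>\<^sup>2 * (u - s) / 2) = exp (\<xi>\<^sup>2 * s / 2) / exp (\<xi>\<^sup>2 * u / 2)"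
    by (simp add: algebra_simps diff_divide_distrib flip: exp_diff)
  ultimately have "exp (\<xi>\<^sup>2 * u / 2) * \<phi>' u = exp (\<xi>\<^sup>2 * u / 2) * (exp (- \<xi>\<^sup>2 * (u - s) / 2) * \<phi>' s)"
    by simp
  then have "\<phi>' u = exp (- \<xi>\<^sup>2 * (u - s) / 2) * \<phi>' s"
    by (metis exp_not_eq_zero mult_left_cancel)
  then show ?thesis unfolding \<phi>'_def G .
qed

end


section \<open>Rotation invariance and the projection of the sphere\<close>

text \<open>Lebesgue measure, hence every density that depends on the norm alone, is invariant under
  orthogonal maps.\<close>

lemma distr_lborel_orthogonal:
  fixes T :: "real ^ 3 \<Rightarrow> real ^ 3"
  assumes T: "orthogonal_transformation T"
  shows "distr lborel borel T = lborel"
proof (rule lborel_eqI[symmetric])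
  have lin: "linear T" using T by (rule orthogonal_transformation_linear)
  have Tm[measurable]: "T \<in> borel_measurable borel"
    by (intro borel_measurable_continuous_onI linear_continuous_on linear_conv_bounded_linear[THEN iffD1] lin)
  have bij: "bij T" using T by (rule orthogonal_transformation_bij)
  have Ti: "orthogonal_transformation (inv T)" using T by (rule orthogonal_transformation_inv)
  fix l u :: "real ^ 3" assume le: "\<And>b. b \<in> Basis \<Longrightarrow> l \<bullet> b \<le> u \<bullet> b"
  have pre: "T -` box l u = inv T ` box l u" using bij by (rule bij_vimage_eq_inv_image)
  have mb: "box l u \<in> lmeasurable" by simp
  have "T -` box l u \<in> sets borel" using measurable_sets[OF Tm, of "box l u"] by simp
  then have "emeasure lborel (T -` box l u) = emeasure lebesgue (T -` box l u)" by simp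
  also have "\<dots> = ennreal (measure lebesgue (inv T ` box l u))"
    unfolding pre using measurable_orthogonal_image[OF Ti mb] by (simp add: emeasure_eq_ennreal_measure fmeasurable_def less_top)
  also have "\<dots> = ennreal (measure lebesgue (box l u))"
    using measure_orthogonal_image[OF Ti mb] by simp
  also have "\<dots> = (\<Prod>b\<in>Basis. (u - l) \<bullet> b)"
    using le by (simp add: measure_lborel_box_eq)
  finally show "emeasure (distr lborel borel T) (box l u) = (\<Prod>b\<in>Basis. (u - l) \<bullet> b)"
    by (simp add: emeasure_distr)
qed simp

text \<open>Invariance under all orthogonal maps, reflections included.\<close>

definition rotation_invariant :: "(real ^ 3) measure \<Rightarrow> bool" where
  "rotation_invariant \<mu> \<longleftrightarrow> (\<forall>T. orthogonal_transformation T \<longrightarrow> distr \<mu> borel T = \<mu>)"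

lemma orthogonal_measurable:
  assumes "orthogonal_transformation (T :: real ^ 3 \<Rightarrow> real ^ 3)"
  shows "T \<in> borel_measurable borel"
  using assms by (intro borel_measurable_continuous_onI linear_continuous_on)
    (simp add: linear_conv_bounded_linear[symmetric] orthogonal_transformation_linear)

lemma rotation_invariant_radial_density:
  fixes f :: "real \<Rightarrow> real"
  assumes [measurable]: "f \<in> borel_measurable borel"
  shows "rotation_invariant (density lborel (\<lambda>x. ennreal (f (norm x))))"
  unfolding rotation_invariant_def
proof (intro allI impI)
  fix T :: "real ^ 3 \<Rightarrow> real ^ 3" assume T: "orthogonal_transformation T"
  note [measurable] = orthogonal_measurable[OF T]
  show "distr (density lborel (\<lambda>x. ennreal (f (norm x)))) borel T = density lborel (\<lambda>x. ennreal (f (norm x)))"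
  proof (rule measure_eqI)
    fix A assume "A \<in> sets (distr (density lborel (\<lambda>x. ennreal (f (norm x)))) borel T)"
    then have [measurable]: "A \<in> sets borel" by simp
    have "T -` A \<in> sets borel" using measurable_sets[OF orthogonal_measurable[OF T], of A] by simp
    then have "emeasure (distr (density lborel (\<lambda>x. ennreal (f (norm x)))) borel T) A =
        (\<integral>\<^sup>+x. ennreal (f (norm x)) * indicator (T -` A) x \<partial>lborel)"
      by (simp add: emeasure_distr emeasure_density)
    also have "\<dots> = (\<integral>\<^sup>+x. ennreal (f (norm (T x))) * indicator A (T x) \<partial>lborel)"
      using T by (simp add: orthogonal_transformation_norm indicator_def)
    also have "\<dots> = (\<integral>\<^sup>+x. ennreal (f (norm x)) * indicator A x \<partial>distr lborel borel T)"
      by (subst nn_integral_distr) auto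
    also have "\<dots> = emeasure (density lborel (\<lambda>x. ennreal (f (norm x)))) A"
      unfolding distr_lborel_orthogonal[OF T] by (simp add: emeasure_density)
    finally show "emeasure (distr (density lborel (\<lambda>x. ennreal (f (norm x)))) borel T) A = emeasure (density lborel (\<lambda>x. ennreal (f (norm x)))) A" .
  qed simp
qed

lemma Basis_vec3: "(Basis :: (real ^ 3) set) = range (\<lambda>i. axis i 1)"
  by (auto simp: Basis_vec_def)

lemma (in prob_space) independent_normals_law:
  fixes D :: "'a \<Rightarrow> real ^ 3"
  assumes ind: "indep_vars (\<lambda>_. borel) (\<lambda>i \<omega>. D \<omega> $ i) UNIV"
    and d: "\<And>i. distributed M lborel (\<lambda>\<omega>. D \<omega> $ i) (normal_density 0 \<sigma>)"
  shows "distr M borel D = density lborel (\<lambda>x. ennreal (\<Prod>i\<in>UNIV. normal_density 0 \<sigma> (x $ i)))"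
proof -
  let ?nd = "normal_density 0 \<sigma>"
  let ?\<nu> = "density lborel (\<lambda>x::real^3. ennreal (\<Prod>i\<in>UNIV. ?nd (x $ i)))"
  have Dm[measurable]: "D \<in> borel_measurable M"
    using distributed_measurable[OF d]
    by (subst borel_measurable_euclidean_space) (auto simp: Basis_vec3 inner_axis)
  have fm[measurable]: "(\<lambda>x::real^3. ennreal (\<Prod>i\<in>UNIV. ?nd (x $ i))) \<in> borel_measurable lborel"
    by measurable
  have inj: "inj (\<lambda>i::3. axis i (1::real))" by (auto simp: inj_def axis_eq_axis)
  have box: "emeasure (distr M borel D) (box l u) = emeasure ?\<nu> (box l u)" for l u
  proof -
    have bx: "x \<in> box l u \<longleftrightarrow> (\<forall>i\<in>UNIV. x $ i \<in> {l $ i<..<u $ i})" for x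
      by (auto simp: mem_box_cart)
    have "emeasure (distr M borel D) (box l u) = emeasure M (\<Inter>i\<in>UNIV. (\<lambda>\<omega>. D \<omega> $ i) -` {l $ i<..<u $ i} \<inter> space M)"
      by (subst emeasure_distr) (auto simp: bx intro!: arg_cong2[where f = emeasure])
    also have "\<dots> = ennreal (\<Prod>i\<in>UNIV. prob ((\<lambda>\<omega>. D \<omega> $ i) -` {l $ i<..<u $ i} \<inter> space M))"
      unfolding emeasure_eq_measure by (subst indep_varsD_finite[OF ind]) auto
    also have "\<dots> = (\<Prod>i\<in>UNIV. emeasure M ((\<lambda>\<omega>. D \<omega> $ i) -` {l $ i<..<u $ i} \<inter> space M))"
      by (simp add: prod_ennreal[symmetric] emeasure_eq_measure)
    also have "\<dots> = (\<Prod>i\<in>UNIV. \<integral>\<^sup>+x. ennreal (?nd x) * indicator {l $ i<..<u $ i} x \<partial>lborel)"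
      by (intro prod.cong refl distributed_emeasure[OF d]) simp
    also have "\<dots> = (\<Prod>b\<in>Basis. \<integral>\<^sup>+x. ennreal (?nd x * indicator {l \<bullet> b<..<u \<bullet> b} x) \<partial>lborel)"
      unfolding Basis_vec3 prod.reindex[OF inj] by (simp add: inner_axis ennreal_mult'' ennreal_indicator)
    also have "\<dots> = (\<integral>\<^sup>+x. (\<Prod>b\<in>Basis. ennreal (?nd (x \<bullet> b) * indicator {l \<bullet> b<..<u \<bullet> b} (x \<bullet> b))) \<partial>(lborel :: (real^3) measure))"
      by (subst nn_integral_lborel_prod[symmetric]) auto
    also have "\<dots> = (\<integral>\<^sup>+x. ennreal (\<Prod>i\<in>UNIV. ?nd (x $ i)) * indicator (box l u) x \<partial>lborel)"
    proof (intro nn_integral_cong)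
      fix x :: "real ^ 3"
      have "(\<Prod>b\<in>Basis. ennreal (?nd (x \<bullet> b) * indicator {l \<bullet> b<..<u \<bullet> b} (x \<bullet> b))) =
         (\<Prod>i\<in>UNIV. ennreal (?nd (x $ i) * indicator {l $ i<..<u $ i} (x $ i)))"
        unfolding Basis_vec3 prod.reindex[OF inj] by (simp add: inner_axis)
      also have "\<dots> = ennreal ((\<Prod>i\<in>UNIV. ?nd (x $ i)) * (\<Prod>i\<in>UNIV. indicator {l $ i<..<u $ i} (x $ i)))"
        by (subst prod_ennreal) (auto simp: prod.distrib)
      also have "(\<Prod>i\<in>UNIV. indicator {l $ i<..<u $ i} (x $ i)) = indicat_real (box l u) x"
        unfolding indicator_def bx by (auto simp: prod_zero_iff)
      finally show "(\<Prod>b\<in>Basis. ennreal (?nd (x \<bullet> b) * indicator {l \<bullet> b<..<u \<bullet> b} (x \<bullet> b))) =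
         ennreal (\<Prod>i\<in>UNIV. ?nd (x $ i)) * indicator (box l u) x"
        by (simp add: ennreal_mult'' ennreal_indicator)
    qed
    also have "\<dots> = emeasure ?\<nu> (box l u)" by (subst emeasure_density) auto
    finally show ?thesis .
  qed
  interpret D: prob_space "distr M borel D" by (rule prob_space_distr[OF Dm])
  show ?thesis
  proof (rule measure_eqI_generator_eq[where E = "range (\<lambda>(a, b). box a b)" and \<Omega> = UNIV and A = "\<lambda>n. box (- (real n *\<^sub>R One)) (real n *\<^sub>R One)"])
    show "Int_stable (range (\<lambda>(a, b). box a b :: (real^3) set))"
      by (auto simp: Int_stable_def box_Int_box)
    show "sets (distr M borel D) = sigma_sets UNIV (range (\<lambda>(a, b). box a b))"
      "sets ?\<nu> = sigma_sets UNIV (range (\<lambda>(a, b). box a b))"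
      by (simp_all add: borel_eq_box)
    show "(\<Union>n. box (- (real n *\<^sub>R One)) (real n *\<^sub>R One)) = (UNIV :: (real^3) set)"
      by (rule UN_box_eq_UNIV)
    show "emeasure (distr M borel D) (box (- (real n *\<^sub>R One)) (real n *\<^sub>R One)) \<noteq> \<infinity>" for n
      by simp
  qed (use box in auto)
qed

text \<open>The product of the three densities depends on the squared norm only.\<close>

lemma (in prob_space) independent_normals_rotation_invariant:
  fixes D :: "'a \<Rightarrow> real ^ 3"
  assumes ind: "indep_vars (\<lambda>_. borel) (\<lambda>i \<omega>. D \<omega> $ i) UNIV"
    and d: "\<And>i. distributed M lborel (\<lambda>\<omega>. D \<omega> $ i) (normal_density 0 \<sigma>)"
  shows "rotation_invariant (distr M borel D)"
proof -
  let ?f = "\<lambda>r. (1 / sqrt (2 * pi * \<sigma>\<^sup>2)) ^ 3 * exp (- r\<^sup>2 / (2 * \<sigma>\<^sup>2))"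
  have "(\<Prod>i\<in>UNIV. normal_density 0 \<sigma> (x $ i)) = ?f (norm x)" for x :: "real ^ 3"
  proof -
    have n: "(norm x)\<^sup>2 = (x $ 1)\<^sup>2 + (x $ 2)\<^sup>2 + (x $ 3)\<^sup>2"
      unfolding power2_norm_eq_inner inner_vec_def sum_3 by (simp add: power2_eq_square)
    have "(\<Prod>i\<in>UNIV. normal_density 0 \<sigma> (x $ i)) = normal_density 0 \<sigma> (x $ 1) * normal_density 0 \<sigma> (x $ 2) * normal_density 0 \<sigma> (x $ 3)"
      unfolding UNIV_3 by simp
    also have "\<dots> = (1 / sqrt (2 * pi * \<sigma>\<^sup>2)) ^ 3 * (exp (- (x $ 1)\<^sup>2 / (2 * \<sigma>\<^sup>2)) * exp (- (x $ 2)\<^sup>2 / (2 * \<sigma>\<^sup>2)) * exp (- (x $ 3)\<^sup>2 / (2 * \<sigma>\<^sup>2)))"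
      by (simp add: normal_density_def power3_eq_cube)
    also have "exp (- (x $ 1)\<^sup>2 / (2 * \<sigma>\<^sup>2)) * exp (- (x $ 2)\<^sup>2 / (2 * \<sigma>\<^sup>2)) * exp (- (x $ 3)\<^sup>2 / (2 * \<sigma>\<^sup>2)) = exp (- (norm x)\<^sup>2 / (2 * \<sigma>\<^sup>2))"
      unfolding n by (simp add: diff_divide_distrib flip: exp_add)
    finally show ?thesis .
  qed
  then have "distr M borel D = density lborel (\<lambda>x. ennreal (?f (norm x)))"
    using independent_normals_law[OF ind d] by simp
  moreover have "rotation_invariant (density lborel (\<lambda>x. ennreal (?f (norm x))))"
    by (rule rotation_invariant_radial_density) measurable
  ultimately show ?thesis by simp
qed

text \<open>The integrand is \<open>1 / sqrt (1 + k)\<close> times the normal density of variance \<open>1 / (1 + k)\<close>.\<close>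

lemma gaussian_square_laplace:
  assumes "0 \<le> k"
  shows "(\<integral>z. exp (- k * z\<^sup>2 / 2) \<partial>std_normal_distribution) = 1 / sqrt (1 + k)"
proof -
  let ?\<sigma> = "1 / sqrt (1 + k)"
  have s: "?\<sigma>\<^sup>2 = 1 / (1 + k)" "sqrt (1 + k) > 0" using assms by (auto simp: power_divide)
  have "std_normal_density z * exp (- k * z\<^sup>2 / 2) = ?\<sigma> * normal_density 0 ?\<sigma> z" for z
  proof -
    have "- z\<^sup>2 / 2 + - k * z\<^sup>2 / 2 = - z\<^sup>2 / (2 * ?\<sigma>\<^sup>2)" unfolding s by (simp add: field_simps)
    then have "exp (- z\<^sup>2 / 2) * exp (- k * z\<^sup>2 / 2) = exp (- z\<^sup>2 / (2 * ?\<sigma>\<^sup>2))" by (simp flip: exp_add)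
    moreover have "1 / sqrt (2 * pi) = ?\<sigma> * (1 / sqrt (2 * pi * ?\<sigma>\<^sup>2))"
      using s(2) unfolding s(1) by (simp add: real_sqrt_mult real_sqrt_divide)
    ultimately show ?thesis by (simp add: std_normal_density_def normal_density_def)
  qed
  then have "(\<integral>z. exp (- k * z\<^sup>2 / 2) \<partial>std_normal_distribution) = (\<integral>z. ?\<sigma> * normal_density 0 ?\<sigma> z \<partial>lborel)"
    by (subst integral_density) auto
  also have "\<dots> = ?\<sigma>" using s(2) by simp
  finally show ?thesis .
qed

lemma moments_determine_cdf:
  fixes Y1 :: "'a \<Rightarrow> real" and Y2 :: "'b \<Rightarrow> real"
  assumes P: "prob_space P1" "prob_space P2"
    and Y1[measurable]: "Y1 \<in> borel_measurable P1" and Y2[measurable]: "Y2 \<in> borel_measurable P2"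
    and r: "\<And>x. x \<in> space P1 \<Longrightarrow> Y1 x \<in> {0..1}" "\<And>x. x \<in> space P2 \<Longrightarrow> Y2 x \<in> {0..1}"
    and eq: "\<And>k. (\<integral>x. Y1 x ^ k \<partial>P1) = (\<integral>x. Y2 x ^ k \<partial>P2)"
  shows "measure P1 {x\<in>space P1. Y1 x \<le> a} = measure P2 {x\<in>space P2. Y2 x \<le> a}"
proof -
  interpret P1: prob_space P1 by (rule P(1))
  interpret P2: prob_space P2 by (rule P(2))
  have [measurable]: "ramp a j \<in> borel_measurable borel" for a j
    by (rule borel_measurable_continuous_onI[OF ramp_continuous])
  have ramps: "(\<integral>x. ramp a (Suc j) (Y1 x) \<partial>P1) = (\<integral>x. ramp a (Suc j) (Y2 x) \<partial>P2)" for j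
    using moments_determine_integrals[of P1 "\<lambda>_. 1" P2 "\<lambda>_. 1", OF _ _ Y1 Y2 r _ ramp_continuous] eq by simp
  have "(\<lambda>j. \<integral>x. ramp a (Suc j) (Y1 x) \<partial>P1) \<longlonglongrightarrow> (\<integral>x. indicator {..a} (Y1 x) \<partial>P1)"
    by (rule integral_dominated_convergence[where w = "\<lambda>_. 1"];
        (intro AE_I2 ramp_tendsto, unfold real_norm_def, rule ramp_bounded)?; (intro AE_I2 ramp_tendsto)?; simp?)
  moreover have "(\<lambda>j. \<integral>x. ramp a (Suc j) (Y2 x) \<partial>P2) \<longlonglongrightarrow> (\<integral>x. indicator {..a} (Y2 x) \<partial>P2)"
    by (rule integral_dominated_convergence[where w = "\<lambda>_. 1"];
        (intro AE_I2 ramp_tendsto, unfold real_norm_def, rule ramp_bounded)?; (intro AE_I2 ramp_tendsto)?; simp?)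
  ultimately have "(\<integral>x. indicator {..a} (Y1 x) \<partial>P1) = (\<integral>x. indicat_real {..a} (Y2 x) \<partial>P2)"
    unfolding ramps by (rule LIMSEQ_unique)
  moreover have "(\<integral>x. indicat_real {..a} (Y1 x) \<partial>P1) = (\<integral>x. indicator {x\<in>space P1. Y1 x \<le> a} x \<partial>P1)"
    by (intro Bochner_Integration.integral_cong) (auto simp: indicator_def)
  moreover have "(\<integral>x. indicat_real {..a} (Y2 x) \<partial>P2) = (\<integral>x. indicator {x\<in>space P2. Y2 x \<le> a} x \<partial>P2)"
    by (intro Bochner_Integration.integral_cong) (auto simp: indicator_def)
  ultimately show ?thesis by (simp add: Int_absorb2)
qed

lemma unit_lborel_cdf:
  assumes "0 \<le> a" "a \<le> 1"
  shows "measure unit_lborel {v\<in>space unit_lborel. v \<le> a} = a"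
proof -
  have "{v\<in>space unit_lborel. v \<le> a} = {0..a}" using assms by (auto simp: space_restrict_space)
  then have "measure unit_lborel {v\<in>space unit_lborel. v \<le> a} = measure lborel {0..a}"
    using assms by (simp add: measure_restrict_space)
  then show ?thesis using assms by simp
qed

lemma unit_lborel_power: "(\<integral>v. v ^ k \<partial>unit_lborel) = 1 / (1 + real k)"
proof -
  have "(\<integral>v. v ^ k \<partial>unit_lborel) = 1 ^ Suc k / real (Suc k) - 0 ^ Suc k / real (Suc k)"
    by (rule unit_lborel_integral_FTC)
       (auto intro!: derivative_eq_intros continuous_intros simp del: of_nat_Suc power_Suc)
  then show ?thesis by simp
qed

locale gauss3 = prob_space M for M :: "'a measure" +
  fixes Z :: "'a \<Rightarrow> real ^ 3"
  assumes ind: "indep_vars (\<lambda>_. borel) (\<lambda>i \<omega>. Z \<omega> $ i) UNIV"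
    and law: "\<And>i. distributed M lborel (\<lambda>\<omega>. Z \<omega> $ i) std_normal_density"
begin

lemma Zi_meas[measurable]: "(\<lambda>\<omega>. Z \<omega> $ i) \<in> borel_measurable M"
  using distributed_measurable[OF law] by simp

lemma Z_meas[measurable]: "Z \<in> borel_measurable M"
  by (subst borel_measurable_euclidean_space) (auto simp: Basis_vec3 inner_axis)

lemma Z_invariant: "rotation_invariant (distr M borel Z)"
  by (rule independent_normals_rotation_invariant[OF ind law])

lemma Zi_law: "distr M borel (\<lambda>\<omega>. Z \<omega> $ i) = std_normal_distribution"
proof -
  have "distr M borel (\<lambda>\<omega>. Z \<omega> $ i) = distr M lborel (\<lambda>\<omega>. Z \<omega> $ i)" by (rule distr_cong) auto
  then show ?thesis using distributed_distr_eq_density[OF law] by simp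
qed

text \<open>A decreasing function of the squared distance \<open>Z\<^sub>2\<^sup>2 + Z\<^sub>3\<^sup>2\<close> from the first axis.\<close>

definition planar :: "'a \<Rightarrow> real" where
  "planar \<omega> = exp (- (Z \<omega> $ 2)\<^sup>2 / 2) * exp (- (Z \<omega> $ 3)\<^sup>2 / 2)"

lemma planar_meas[measurable]: "planar \<in> borel_measurable M"
  unfolding planar_def by measurable

lemma planar_range: "planar \<omega> \<in> {0..1}"
  by (auto simp: planar_def intro!: mult_le_one)

text \<open>The square of the planar part is exponentially distributed, that is,
  \<open>exp (- (Z\<^sub>2\<^sup>2 + Z\<^sub>3\<^sup>2) / 2)\<close> is uniform: its moments are \<open>(1 / sqrt (1 + k))\<^sup>2\<close>.\<close>

lemma planar_cdf:
  assumes "0 \<le> a" "a \<le> 1"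
  shows "prob {\<omega>\<in>space M. planar \<omega> \<le> a} = a"
proof -
  interpret U: prob_space unit_lborel by (rule prob_space_unit_lborel)
  have "expectation (\<lambda>\<omega>. planar \<omega> ^ k) = (\<integral>v. v ^ k \<partial>unit_lborel)" for k
  proof -
    let ?f = "\<lambda>x::real. exp (- real k * x\<^sup>2 / 2)"
    have 23: "indep_vars (\<lambda>_. borel) (\<lambda>i \<omega>. ?f (Z \<omega> $ i)) {2, 3}"
      by (rule indep_vars_compose2[OF indep_vars_subset[OF ind]]) auto
    have int: "integrable M (\<lambda>\<omega>. ?f (Z \<omega> $ i))" for i
      by (rule integrable_const_bound[of _ 1]) auto
    have "planar \<omega> ^ k = (\<Prod>i\<in>{2, 3}. ?f (Z \<omega> $ i))" for \<omega>
      by (simp add: planar_def power_mult_distrib flip: exp_of_nat_mult)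
    then have "expectation (\<lambda>\<omega>. planar \<omega> ^ k) = (\<Prod>i\<in>{2, 3}. expectation (\<lambda>\<omega>. ?f (Z \<omega> $ i)))"
      using indep_vars_lebesgue_integral[OF _ 23 int] by simp
    also have "\<dots> = (\<Prod>i\<in>{2, 3::3}. (\<integral>z. ?f z \<partial>std_normal_distribution))"
    proof (rule prod.cong[OF refl])
      show "expectation (\<lambda>\<omega>. ?f (Z \<omega> $ i)) = (\<integral>z. ?f z \<partial>std_normal_distribution)" for i
        unfolding Zi_law[of i, symmetric] by (rule integral_distr[symmetric]) auto
    qed
    also have "\<dots> = 1 / (1 + real k)"
      by (subst gaussian_square_laplace) (auto simp: power_divide simp flip: power2_eq_square)
    finally show ?thesis by (simp add: unit_lborel_power)
  qed
  then have "prob {\<omega>\<in>space M. planar \<omega> \<le> a} = measure unit_lborel {v\<in>space unit_lborel. v \<le> a}"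
    by (intro moments_determine_cdf prob_space_axioms U.prob_space_axioms planar_meas planar_range)
       (auto simp: space_restrict_space measurable_restrict_space1)
  then show ?thesis using unit_lborel_cdf[OF assms] by simp
qed

lemma indep_first_planar: "indep_var borel (\<lambda>\<omega>. Z \<omega> $ 1) borel planar"
proof -
  let ?P = "\<lambda>I. PiM I (\<lambda>_::3. borel :: real measure)"
  have 1: "indep_var (?P {1}) (\<lambda>\<omega>. restrict (\<lambda>i. Z \<omega> $ i) {1}) (?P {2, 3}) (\<lambda>\<omega>. restrict (\<lambda>i. Z \<omega> $ i) {2, 3})"
    by (rule indep_var_restrict[OF ind]) auto
  have m1: "(\<lambda>x. x 1) \<in> borel_measurable (?P {1})" by (rule measurable_component_singleton) simp
  have [measurable]: "(\<lambda>x. x 2) \<in> borel_measurable (?P {2, 3})" "(\<lambda>x. x 3) \<in> borel_measurable (?P {2, 3})"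
    by (rule measurable_component_singleton, simp)+
  have m2: "(\<lambda>x. exp (- (x 2)\<^sup>2 / 2) * exp (- (x 3)\<^sup>2 / 2)) \<in> borel_measurable (?P {2, 3})" by measurable
  from indep_var_compose[OF 1 m1 m2] show ?thesis by (simp add: o_def planar_def[abs_def])
qed

text \<open>The cone around the first axis in terms of two independent variables.\<close>

lemma ratio_event:
  assumes "0 < v" "v < 1"
  shows "\<bar>Z \<omega> $ 1\<bar> \<le> v * norm (Z \<omega>) \<longleftrightarrow> planar \<omega> \<le> exp (- (1 / v\<^sup>2 - 1) * (Z \<omega> $ 1)\<^sup>2 / 2)"
proof -
  let ?q = "(Z \<omega> $ 2)\<^sup>2 + (Z \<omega> $ 3)\<^sup>2"
  have n: "(norm (Z \<omega>))\<^sup>2 = (Z \<omega> $ 1)\<^sup>2 + ?q"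
    unfolding power2_norm_eq_inner inner_vec_def sum_3 by (simp add: power2_eq_square)
  have "\<bar>Z \<omega> $ 1\<bar> \<le> v * norm (Z \<omega>) \<longleftrightarrow> (Z \<omega> $ 1)\<^sup>2 \<le> (v * norm (Z \<omega>))\<^sup>2"
    using assms abs_le_square_iff[of "Z \<omega> $ 1" "v * norm (Z \<omega>)"] by simp
  also have "\<dots> \<longleftrightarrow> (Z \<omega> $ 1)\<^sup>2 \<le> v\<^sup>2 * ((Z \<omega> $ 1)\<^sup>2 + ?q)" by (simp only: power_mult_distrib n)
  also have "\<dots> \<longleftrightarrow> (1 / v\<^sup>2 - 1) * (Z \<omega> $ 1)\<^sup>2 \<le> ?q" using assms by (simp add: field_simps)
  also have "\<dots> \<longleftrightarrow> exp (- ?q / 2) \<le> exp (- (1 / v\<^sup>2 - 1) * (Z \<omega> $ 1)\<^sup>2 / 2)"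
  proof -
    have "x \<le> q \<longleftrightarrow> - q / 2 \<le> - x / 2" for x q :: real by auto
    then show ?thesis unfolding exp_le_cancel_iff mult_minus_left by blast
  qed
  also have "exp (- ?q / 2) = planar \<omega>" by (simp add: planar_def add_divide_distrib diff_divide_distrib flip: exp_add)
  finally show ?thesis .
qed

text \<open>Given \<open>Z\<^sub>1 = z\<close>, the event has probability \<open>exp (-(1 / v\<^sup>2 - 1) z\<^sup>2 / 2)\<close>, as \<open>planar\<close> is
  uniform; the Gaussian mean of this is \<open>1 / sqrt (1 / v\<^sup>2) = v\<close>.\<close>

lemma ratio_cdf:
  assumes v: "0 < v" "v < 1"
  shows "prob {\<omega>\<in>space M. \<bar>Z \<omega> $ 1\<bar> \<le> v * norm (Z \<omega>)} = v"
proof -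
  let ?c = "1 / v\<^sup>2 - 1" and ?g = "\<lambda>z. exp (- (1 / v\<^sup>2 - 1) * z\<^sup>2 / 2)"
  have c: "0 \<le> ?c" using v by (simp add: power_le_one)
  interpret S: prob_space std_normal_distribution using real_dist_normal_dist by (simp add: real_distribution_def)
  interpret P: prob_space "distr M borel planar" by (rule prob_space_distr) simp
  interpret SP: pair_prob_space "std_normal_distribution" "distr M borel planar" ..
  have J: "std_normal_distribution \<Otimes>\<^sub>M distr M borel planar = distr M (borel \<Otimes>\<^sub>M borel) (\<lambda>\<omega>. (Z \<omega> $ 1, planar \<omega>))"
    using indep_first_planar unfolding indep_var_distribution_eq Zi_law by simp
  let ?A = "{p :: real \<times> real. snd p \<le> ?g (fst p)}"
  have "{p \<in> space (borel \<Otimes>\<^sub>M borel). snd p \<le> ?g (fst p)} \<in> sets (borel \<Otimes>\<^sub>M borel)" by measurable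
  then have A[measurable]: "?A \<in> sets (borel \<Otimes>\<^sub>M borel)" by (simp add: space_pair_measure)
  have "prob {\<omega>\<in>space M. \<bar>Z \<omega> $ 1\<bar> \<le> v * norm (Z \<omega>)} = prob {\<omega>\<in>space M. planar \<omega> \<le> ?g (Z \<omega> $ 1)}"
    unfolding ratio_event[OF v] ..
  also have "\<dots> = measure (distr M (borel \<Otimes>\<^sub>M borel) (\<lambda>\<omega>. (Z \<omega> $ 1, planar \<omega>))) ?A"
  proof -
    have m: "(\<lambda>\<omega>. (Z \<omega> $ 1, planar \<omega>)) \<in> M \<rightarrow>\<^sub>M borel \<Otimes>\<^sub>M borel" by measurable
    show ?thesis unfolding measure_distr[OF m A] by (intro arg_cong2[where f = measure]) auto
  qed
  also have "\<dots> = (\<integral>p. indicator ?A p \<partial>(std_normal_distribution \<Otimes>\<^sub>M distr M borel planar))"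
    unfolding J by (simp add: space_pair_measure)
  also have "\<dots> = (\<integral>z. \<integral>q. indicator ?A (z, q) \<partial>distr M borel planar \<partial>std_normal_distribution)"
  proof (rule SP.integral_fst'[symmetric])
    have "?A \<in> sets (std_normal_distribution \<Otimes>\<^sub>M distr M borel planar)"
      using A by (simp cong: sets_pair_measure_cong)
    then show "integrable (std_normal_distribution \<Otimes>\<^sub>M distr M borel planar) (indicat_real ?A)"
      by (intro integrable_real_indicator) (auto simp: less_top[symmetric])
  qed
  also have "\<dots> = (\<integral>z. ?g z \<partial>std_normal_distribution)"
  proof (rule Bochner_Integration.integral_cong[OF refl])
    fix z
    have "(\<integral>q. indicat_real ?A (z, q) \<partial>distr M borel planar) = (\<integral>\<omega>. indicator ?A (z, planar \<omega>) \<partial>M)"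
      by (rule integral_distr) auto
    also have "\<dots> = (\<integral>\<omega>. indicator {\<omega>\<in>space M. planar \<omega> \<le> ?g z} \<omega> \<partial>M)"
      by (intro Bochner_Integration.integral_cong) (auto simp: indicator_def)
    also have "\<dots> = ?g z"
    proof -
      have "0 \<le> ?c * z\<^sup>2" using c by (intro mult_nonneg_nonneg) auto
      moreover have "- x / 2 \<le> 0" if "0 \<le> x" for x :: real using that by simp
      ultimately have "?g z \<le> 1" unfolding exp_le_one_iff mult_minus_left by blast
      from planar_cdf[OF exp_ge_zero this] show ?thesis by (simp add: Int_absorb2)
    qed
    finally show "(\<integral>q. indicat_real ?A (z, q) \<partial>distr M borel planar) = ?g z" .
  qed
  also have "\<dots> = v" using gaussian_square_laplace[OF c] v by (simp add: real_sqrt_divide)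
  finally show ?thesis .
qed

text \<open>Archimedes: the projection of a uniform point of the sphere to an axis is uniform.\<close>

lemma ratio_law: "distr M borel (\<lambda>\<omega>. \<bar>Z \<omega> $ 1\<bar> / norm (Z \<omega>)) = distr unit_lborel borel (\<lambda>v. v)"
proof -
  interpret U: prob_space unit_lborel by (rule prob_space_unit_lborel)
  have Um[measurable]: "(\<lambda>v. v) \<in> borel_measurable unit_lborel" by (simp add: measurable_restrict_space1)
  have r1: "\<bar>Z \<omega> $ 1\<bar> / norm (Z \<omega>) \<le> v \<longleftrightarrow> \<bar>Z \<omega> $ 1\<bar> \<le> v * norm (Z \<omega>)" if "0 \<le> v" for \<omega> v
    using that by (cases "Z \<omega> = 0") (auto simp: divide_le_eq)
  have le1: "\<bar>Z \<omega> $ 1\<bar> \<le> norm (Z \<omega>)" for \<omega> by (rule component_le_norm_cart)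
  have c1: "cdf (distr M borel (\<lambda>\<omega>. \<bar>Z \<omega> $ 1\<bar> / norm (Z \<omega>))) v = prob {\<omega>\<in>space M. \<bar>Z \<omega> $ 1\<bar> / norm (Z \<omega>) \<le> v}" for v
    unfolding cdf_def by (subst measure_distr) (auto intro!: arg_cong2[where f = measure])
  have c2: "cdf (distr unit_lborel borel (\<lambda>v. v)) v = measure unit_lborel {x\<in>space unit_lborel. x \<le> v}" for v
    unfolding cdf_def by (subst measure_distr) (auto intro!: arg_cong2[where f = measure])
  have "cdf (distr M borel (\<lambda>\<omega>. \<bar>Z \<omega> $ 1\<bar> / norm (Z \<omega>))) v = cdf (distr unit_lborel borel (\<lambda>v. v)) v" for v
  proof -
    consider "v < 0" | "v = 0" | "0 < v" "v < 1" | "1 \<le> v" by linarith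
    then show ?thesis
    proof cases
      case 1
      then have "{\<omega>\<in>space M. \<bar>Z \<omega> $ 1\<bar> / norm (Z \<omega>) \<le> v} = {}" "{x\<in>space unit_lborel. x \<le> v} = {}"
        by (auto simp: not_le space_restrict_space intro: less_le_trans)
      then show ?thesis unfolding c1 c2 by (metis measure_empty)
    next
      case 2
      have "prob {\<omega>\<in>space M. \<bar>Z \<omega> $ 1\<bar> / norm (Z \<omega>) \<le> 0} \<le> e" if "0 < e" "e < 1" for e
      proof -
        have "prob {\<omega>\<in>space M. \<bar>Z \<omega> $ 1\<bar> / norm (Z \<omega>) \<le> 0} \<le> prob {\<omega>\<in>space M. \<bar>Z \<omega> $ 1\<bar> \<le> e * norm (Z \<omega>)}"
        proof (rule finite_measure_mono)
          show "{\<omega>\<in>space M. \<bar>Z \<omega> $ 1\<bar> / norm (Z \<omega>) \<le> 0} \<subseteq> {\<omega>\<in>space M. \<bar>Z \<omega> $ 1\<bar> \<le> e * norm (Z \<omega>)}"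
            unfolding r1[OF less_imp_le[OF that(1)], symmetric] using that(1) by fastforce
        qed measurable
        then show ?thesis using ratio_cdf[OF that] by simp
      qed
      note small = this
      have "prob {\<omega>\<in>space M. \<bar>Z \<omega> $ 1\<bar> / norm (Z \<omega>) \<le> 0} \<le> 0" (is "?p \<le> 0")
      proof (rule ccontr)
        assume "\<not> ?p \<le> 0"
        then obtain e where "0 < e" "e < ?p" "e < 1" using field_lbound_gt_zero[of ?p 1] by auto
        with small[of e] show False by linarith
      qed
      then show ?thesis unfolding c1 c2 2 unit_lborel_cdf[OF order_refl zero_le_one]
        using measure_nonneg by (intro antisym)
    next
      case 3
      then show ?thesis unfolding c1 c2 using ratio_cdf[OF 3] unit_lborel_cdf[of v] r1[of v] by simp
    next
      case 4
      have "\<bar>Z \<omega> $ 1\<bar> / norm (Z \<omega>) \<le> v" for \<omega>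
      proof -
        have "\<bar>Z \<omega> $ 1\<bar> \<le> 1 * norm (Z \<omega>)" using le1[of \<omega>] by simp
        also have "\<dots> \<le> v * norm (Z \<omega>)" using 4 by (intro mult_right_mono) auto
        finally show ?thesis using 4 by (subst r1) auto
      qed
      moreover have "x \<le> v" if "x \<in> space unit_lborel" for x using that 4 by (auto simp: space_restrict_space)
      ultimately have "{\<omega>\<in>space M. \<bar>Z \<omega> $ 1\<bar> / norm (Z \<omega>) \<le> v} = space M" "{x\<in>space unit_lborel. x \<le> v} = space unit_lborel"
        by auto
      then show ?thesis unfolding c1 c2 using prob_space U.prob_space by metis
    qed
  qed
  moreover have "real_distribution (distr M borel (\<lambda>\<omega>. \<bar>Z \<omega> $ 1\<bar> / norm (Z \<omega>)))"
    by (rule real_distribution_distr) simp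
  moreover have "real_distribution (distr unit_lborel borel (\<lambda>v. v))"
    by (rule U.real_distribution_distr) simp
  ultimately show ?thesis by (intro cdf_unique ext)
qed

lemma ratio_integral:
  fixes f :: "real \<Rightarrow> real"
  assumes "f \<in> borel_measurable borel"
  shows "(\<integral>\<omega>. f (\<bar>Z \<omega> $ 1\<bar> / norm (Z \<omega>)) \<partial>M) = (\<integral>v. f v \<partial>unit_lborel)"
proof -
  have "(\<integral>\<omega>. f (\<bar>Z \<omega> $ 1\<bar> / norm (Z \<omega>)) \<partial>M) = (\<integral>x. f x \<partial>distr M borel (\<lambda>\<omega>. \<bar>Z \<omega> $ 1\<bar> / norm (Z \<omega>)))"
    using assms by (intro integral_distr[symmetric]) auto
  also have "\<dots> = (\<integral>v. f v \<partial>unit_lborel)"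
    unfolding ratio_law using assms by (intro integral_distr) (auto simp: measurable_restrict_space1)
  finally show ?thesis .
qed

end


section \<open>The martingale of the three-dimensional motion\<close>

lemma sin_std_normal: "(\<integral>z. sin (a * z) \<partial>std_normal_distribution) = 0"
proof -
  interpret S: real_distribution std_normal_distribution by (rule real_dist_normal_dist)
  have "(\<integral>z. iexp (a * z) \<partial>std_normal_distribution) = complex_of_real (exp (- a\<^sup>2 / 2))"
    using char_std_normal_distribution by (simp add: char_def fun_eq_iff)
  then have "Im (\<integral>z. iexp (a * z) \<partial>std_normal_distribution) = 0" by simp
  moreover have "Im (\<integral>z. iexp (a * z) \<partial>std_normal_distribution) = (\<integral>z. Im (iexp (a * z)) \<partial>std_normal_distribution)"
    by (rule integral_Im[symmetric], rule S.integrable_iexp) auto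
  ultimately show ?thesis by (simp add: Im_exp)
qed

lemma cos_shift_std_normal:
  "(\<integral>z. cos (x + a * z) \<partial>std_normal_distribution) = exp (- a\<^sup>2 / 2) * cos x"
proof -
  interpret S: real_distribution std_normal_distribution by (rule real_dist_normal_dist)
  have i: "integrable std_normal_distribution (\<lambda>z. cos (a * z))" "integrable std_normal_distribution (\<lambda>z. sin (a * z))"
    by (rule S.integrable_const_bound[of _ 1]; simp)+
  show ?thesis using i by (simp add: cos_add cos_std_normal sin_std_normal)
qed

text \<open>Under a rotation invariant weighted law of \<open>W\<close>, the conditional law of \<open>\<bar>W\<^sup>1\<bar> / \<bar>W\<bar>\<close> given \<open>\<bar>W\<bar>\<close> is
  uniform. The function \<open>f(\<bar>W\<bar>, \<bar>W \<bullet> z\<bar> / \<bar>z\<bar>)\<close> is integrated over \<open>W\<close> and over an independent Gaussian \<open>z\<close>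
  in both orders: for fixed \<open>z\<close> a rotation moves \<open>z\<close> to the first axis, and for fixed \<open>W\<close> a rotation
  moves \<open>W\<close> there, which leaves the ratio for the Gaussian vector.\<close>

lemma (in gauss3) rotation_mixture:
  fixes W :: "'b \<Rightarrow> real ^ 3" and h :: "'b \<Rightarrow> real" and f :: "real \<Rightarrow> real \<Rightarrow> real"
  assumes N: "prob_space N" and W[measurable]: "W \<in> borel_measurable N"
    and h[measurable]: "h \<in> borel_measurable N" and hb: "\<And>\<omega>. \<bar>h \<omega>\<bar> \<le> 1"
    and inv: "\<And>T g. orthogonal_transformation T \<Longrightarrow> g \<in> borel_measurable borel \<Longrightarrow> (\<And>x. \<bar>g x\<bar> \<le> c) \<Longrightarrow>
       (\<integral>\<omega>. h \<omega> * g (T (W \<omega>)) \<partial>N) = (\<integral>\<omega>. h \<omega> * g (W \<omega>) \<partial>N)"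
    and f[measurable]: "(\<lambda>p. f (fst p) (snd p)) \<in> borel_measurable (borel \<Otimes>\<^sub>M borel)" and fb: "\<And>r x. \<bar>f r x\<bar> \<le> c"
  shows "(\<integral>\<omega>. h \<omega> * f (norm (W \<omega>)) \<bar>W \<omega> $ 1\<bar> \<partial>N) =
     (\<integral>\<omega>. h \<omega> * (\<integral>v. f (norm (W \<omega>)) (norm (W \<omega>) * v) \<partial>unit_lborel) \<partial>N)"
proof -
  let ?\<gamma> = "distr M borel Z"
  interpret N: prob_space N by (rule N)
  interpret G: prob_space ?\<gamma> by (rule prob_space_distr) simp
  interpret P: pair_prob_space N ?\<gamma> ..
  have fm: "(\<lambda>x. f (a x) (b x)) \<in> borel_measurable L" if [measurable]: "a \<in> borel_measurable L" "b \<in> borel_measurable L" for a b and L :: "'c measure"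
  proof -
    have "(\<lambda>x. (a x, b x)) \<in> L \<rightarrow>\<^sub>M borel \<Otimes>\<^sub>M borel" by measurable
    from measurable_compose[OF this f] show ?thesis by simp
  qed
  let ?F = "\<lambda>\<omega> z. h \<omega> * f (norm (W \<omega>)) (\<bar>W \<omega> \<bullet> z\<bar> / norm z)"
  have fF: "(\<lambda>p. f (norm (W (fst p))) (\<bar>W (fst p) \<bullet> snd p\<bar> / norm (snd p))) \<in> borel_measurable (N \<Otimes>\<^sub>M ?\<gamma>)"
  proof -
    have "(\<lambda>p. norm (W (fst p))) \<in> borel_measurable (N \<Otimes>\<^sub>M ?\<gamma>)" by measurable
    moreover have "(\<lambda>p. \<bar>W (fst p) \<bullet> snd p\<bar> / norm (snd p)) \<in> borel_measurable (N \<Otimes>\<^sub>M ?\<gamma>)" by measurable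
    ultimately have "(\<lambda>x. (norm (W (fst x)), \<bar>W (fst x) \<bullet> snd x\<bar> / norm (snd x))) \<in> N \<Otimes>\<^sub>M ?\<gamma> \<rightarrow>\<^sub>M borel \<Otimes>\<^sub>M borel" by measurable
    from measurable_compose[OF this f] show ?thesis by simp
  qed
  have int: "integrable (N \<Otimes>\<^sub>M ?\<gamma>) (case_prod ?F)"
  proof (rule P.integrable_const_bound[of _ "1 * c"])
    show "AE p in N \<Otimes>\<^sub>M ?\<gamma>. norm (case_prod ?F p) \<le> 1 * c"
      unfolding real_norm_def case_prod_beta abs_mult by (intro AE_I2 mult_mono hb fb) auto
    show "case_prod ?F \<in> borel_measurable (N \<Otimes>\<^sub>M ?\<gamma>)"
      unfolding case_prod_beta using fF by measurable
  qed
  have inner1: "(\<integral>\<omega>. ?F \<omega> z \<partial>N) = (\<integral>\<omega>. h \<omega> * f (norm (W \<omega>)) \<bar>W \<omega> $ 1\<bar> \<partial>N)" if "z \<noteq> 0" for z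
  proof -
    have "norm (z /\<^sub>R norm z) = 1" "norm (axis 1 1 :: real ^ 3) = 1" using that by auto
    then obtain T :: "real ^ 3 \<Rightarrow> real ^ 3" where T: "orthogonal_transformation T" "T (z /\<^sub>R norm z) = axis 1 1"
      by (rule orthogonal_transformation_exists_1)
    have e: "f (norm w) (\<bar>w \<bullet> z\<bar> / norm z) = f (norm (T w)) \<bar>T w $ 1\<bar>" for w
    proof -
      have "T w $ 1 = T w \<bullet> T (z /\<^sub>R norm z)" unfolding T(2) by (simp add: inner_axis)
      also have "\<dots> = w \<bullet> (z /\<^sub>R norm z)" using T(1) by (simp add: orthogonal_transformation_def)
      finally show ?thesis using T(1) that by (simp add: orthogonal_transformation_norm abs_mult divide_inverse mult.commute)
    qed
    have gm: "(\<lambda>x::real^3. f (norm x) \<bar>x $ 1\<bar>) \<in> borel_measurable borel"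
    proof -
      have "(\<lambda>x::real^3. (norm x, \<bar>x $ 1\<bar>)) \<in> borel \<rightarrow>\<^sub>M borel \<Otimes>\<^sub>M borel" by measurable
      from measurable_compose[OF this f] show ?thesis by simp
    qed
    show ?thesis unfolding e by (rule inv[OF T(1) gm fb])
  qed
  have inner2: "(\<integral>z. ?F \<omega> z \<partial>?\<gamma>) = h \<omega> * (\<integral>v. f (norm (W \<omega>)) (norm (W \<omega>) * v) \<partial>unit_lborel)" for \<omega>
  proof -
    let ?w = "W \<omega>"
    obtain T :: "real ^ 3 \<Rightarrow> real ^ 3" where T: "orthogonal_transformation T" "T ?w = norm ?w *\<^sub>R axis 1 1"
      by (rule orthogonal_transformation_exists[of ?w "norm ?w *\<^sub>R axis 1 1"]) auto
    have e: "\<bar>?w \<bullet> z\<bar> / norm z = norm ?w * (\<bar>T z $ 1\<bar> / norm (T z))" for z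
    proof -
      have "?w \<bullet> z = T ?w \<bullet> T z" using T(1) by (simp add: orthogonal_transformation_def)
      also have "\<dots> = norm ?w * T z $ 1" unfolding T(2) by (simp add: inner_axis')
      finally show ?thesis using T(1) by (simp add: orthogonal_transformation_norm abs_mult)
    qed
    have fw: "(\<lambda>x. f (norm ?w) (norm ?w * x)) \<in> borel_measurable borel"
    proof -
      have "(\<lambda>x. (norm ?w, norm ?w * x)) \<in> borel \<rightarrow>\<^sub>M borel \<Otimes>\<^sub>M borel" by measurable
      from measurable_compose[OF this f] show ?thesis by simp
    qed
    let ?k = "\<lambda>x::real^3. f (norm ?w) (norm ?w * (\<bar>x $ 1\<bar> / norm x))"
    have km: "?k \<in> borel_measurable borel"
    proof -
      have "(\<lambda>x::real^3. \<bar>x $ 1\<bar> / norm x) \<in> borel_measurable borel" by measurable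
      from measurable_compose[OF this fw] show ?thesis by simp
    qed
    have "(\<integral>z. ?F \<omega> z \<partial>?\<gamma>) = h \<omega> * (\<integral>z. ?k (T z) \<partial>?\<gamma>)" unfolding e by simp
    also have "(\<integral>z. ?k (T z) \<partial>?\<gamma>) = (\<integral>z. ?k z \<partial>distr ?\<gamma> borel T)"
      using orthogonal_measurable[OF T(1)] km by (intro integral_distr[symmetric]) auto
    also have "\<dots> = (\<integral>z. ?k z \<partial>?\<gamma>)" using Z_invariant T(1) by (simp add: rotation_invariant_def)
    also have "\<dots> = (\<integral>\<omega>. ?k (Z \<omega>) \<partial>M)" using km by (intro integral_distr) auto
    also have "\<dots> = (\<integral>v. f (norm ?w) (norm ?w * v) \<partial>unit_lborel)"
      using ratio_integral[OF fw] by simp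
    finally show ?thesis .
  qed
  have nz: "AE z in ?\<gamma>. z \<noteq> 0"
  proof -
    have "AE x in distr M borel (\<lambda>\<omega>. Z \<omega> $ 1). x \<noteq> 0"
      unfolding Zi_law by (subst AE_density) (auto intro: AE_mp[OF AE_lborel_singleton[of 0]])
    then have "AE \<omega> in M. Z \<omega> $ 1 \<noteq> 0" by (subst (asm) AE_distr_iff) auto
    then have "AE \<omega> in M. Z \<omega> \<noteq> 0" by eventually_elim auto
    then show ?thesis by (subst AE_distr_iff) auto
  qed
  have "(\<integral>\<omega>. h \<omega> * f (norm (W \<omega>)) \<bar>W \<omega> $ 1\<bar> \<partial>N) = (\<integral>z. (\<integral>\<omega>. h \<omega> * f (norm (W \<omega>)) \<bar>W \<omega> $ 1\<bar> \<partial>N) \<partial>?\<gamma>)"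
    using G.prob_space by simp
  also have "\<dots> = (\<integral>z. \<integral>\<omega>. ?F \<omega> z \<partial>N \<partial>?\<gamma>)"
  proof (rule integral_cong_AE)
    show "AE z in ?\<gamma>. (\<integral>\<omega>. h \<omega> * f (norm (W \<omega>)) \<bar>W \<omega> $ 1\<bar> \<partial>N) = (\<integral>\<omega>. ?F \<omega> z \<partial>N)"
      using nz by eventually_elim (rule inner1[symmetric])
    show "(\<lambda>z. \<integral>\<omega>. ?F \<omega> z \<partial>N) \<in> borel_measurable ?\<gamma>"
      using P.integrable_snd[OF int] by (rule borel_measurable_integrable)
  qed simp
  also have "\<dots> = (\<integral>\<omega>. \<integral>z. ?F \<omega> z \<partial>?\<gamma> \<partial>N)" by (rule P.Fubini_integral[OF int])
  finally show ?thesis unfolding inner2 .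
qed

locale brownian3 =
  fixes N :: "'b measure" and W :: "real \<Rightarrow> 'b \<Rightarrow> real ^ 3"
  assumes bm3: "standard_BM3 N W"
begin

lemma coordinate_bm: "brownian_motion N (\<lambda>s \<omega>. W s \<omega> $ i)"
  using bm3 by (simp add: brownian_motion_def standard_BM3_def)

sublocale prob_space N
proof -
  interpret brownian_motion N "\<lambda>s \<omega>. W s \<omega> $ 1" by (rule coordinate_bm)
  show "prob_space N" by (rule prob_space_axioms)
qed

sublocale c: brownian_motion N "\<lambda>s \<omega>. W s \<omega> $ i" for i
  by (rule coordinate_bm)

lemma W_meas: "s \<ge> 0 \<Longrightarrow> W s \<in> borel_measurable N"
  using c.B_meas by (subst borel_measurable_euclidean_space) (auto simp: Basis_vec3 inner_axis)

lemma W_zero: "AE \<omega> in N. W 0 \<omega> = 0"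
proof -
  have "AE \<omega> in N. \<forall>i. W 0 \<omega> $ i = 0" using c.B_zero by (simp add: AE_all_countable)
  then show ?thesis by eventually_elim (simp add: vec_eq_iff)
qed

lemma W_cont: "\<omega> \<in> space N \<Longrightarrow> continuous_on {0..} (\<lambda>s. W s \<omega>)"
proof -
  assume w: "\<omega> \<in> space N"
  have "continuous_on {0..} (\<lambda>s. \<chi> i. W s \<omega> $ i)"
    using c.B_cont[OF w] by (intro continuous_on_vec_lambda)
  then show ?thesis by simp
qed

lemma paths_indep: "indep_vars (\<lambda>_. PiM {0..} (\<lambda>_. borel)) (\<lambda>i \<omega>. \<lambda>s\<in>{0..}. W s \<omega> $ i) UNIV"
  using bm3 by (simp add: standard_BM3_def)

text \<open>The past of all three coordinates. It is generated by their separate pasts because independence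
  of the coordinates is a statement about the latter.\<close>

definition past :: "real \<Rightarrow> 'b measure" where
  "past s = sigma (space N) (\<Union>i. sets (history N (\<lambda>s \<omega>. W s \<omega> $ i) s))"

lemma history_sub_events: "sets (history N (\<lambda>s \<omega>. W s \<omega> $ i) s) \<subseteq> events"
  by (rule sets_history_subset_events) (rule c.B_meas)

lemma past_gen: "(\<Union>i. sets (history N (\<lambda>s \<omega>. W s \<omega> $ i) s)) \<subseteq> Pow (space N)"
  using sets.sets_into_space[of _ "history N (\<lambda>s \<omega>. W s \<omega> $ _) s"] by (auto simp: subset_eq)

lemma space_past[simp]: "space (past s) = space N"
  by (simp add: past_def past_gen space_measure_of)

lemma sets_past: "sets (past s) = sigma_sets (space N) (\<Union>i. sets (history N (\<lambda>s \<omega>. W s \<omega> $ i) s))"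
  by (simp add: past_def past_gen sets_measure_of)

lemma past_sub: "sets (past s) \<subseteq> events"
  unfolding sets_past using history_sub_events by (intro sets.sigma_sets_subset) auto

lemma W_past: "r \<in> {0..s} \<Longrightarrow> W r \<in> borel_measurable (past s)"
proof -
  assume r: "r \<in> {0..s}"
  have "(\<lambda>\<omega>. W r \<omega> $ i) \<in> borel_measurable (past s)" for i
    using measurable_history[OF r, of "\<lambda>s \<omega>. W s \<omega> $ i" N]
    unfolding measurable_def by (auto simp: sets_past intro!: sigma_sets.Basic)
  then show ?thesis by (subst borel_measurable_euclidean_space) (auto simp: Basis_vec3 inner_axis)
qed

text \<open>Past and increment of one coordinate are independent, and the coordinates are; hence the six
  sigma-algebras of pasts and increments are, and they may be grouped into past and increment.\<close>

lemma indep_past_increment: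
  assumes su: "0 \<le> s" "s \<le> u"
  shows "indep_set (sets (past s)) {(\<lambda>\<omega>. W u \<omega> - W s \<omega>) -` C \<inter> space N | C. C \<in> sets borel}"
proof -
  let ?D = "\<lambda>i \<omega>. W u \<omega> $ i - W s \<omega> $ i"
  define E where "E j = (if snd j then sets (history N (\<lambda>s \<omega>. W s \<omega> $ fst j) s) else {?D (fst j) -` C \<inter> space N | C. C \<in> sets borel})" for j :: "3 \<times> bool"
  have Dm: "?D i \<in> borel_measurable N" for i using c.B_meas su by (intro borel_measurable_diff) auto
  let ?p = "\<lambda>i \<omega>. \<lambda>s\<in>{0..}. W s \<omega> $ i"
  let ?PM = "PiM {0..} (\<lambda>_. borel :: real measure)"
  let ?S = "\<lambda>i. {?p i -` A \<inter> space N | A. A \<in> sets ?PM}"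
  have comp: "(\<lambda>x. x r) \<in> borel_measurable ?PM" if "0 \<le> r" for r
    using that by (intro measurable_component_singleton) auto
  have ES: "E (i, b) \<subseteq> ?S i" for i b
  proof (cases b)
    case True
    have m: "(\<lambda>x. \<lambda>r\<in>{0..s}. x r) \<in> ?PM \<rightarrow>\<^sub>M PiM {0..s} (\<lambda>_. borel)"
      by (intro measurable_restrict comp) auto
    show ?thesis
    proof
      fix a assume "a \<in> E (i, b)"
      then obtain A where A: "A \<in> sets (PiM {0..s} (\<lambda>_. borel))" "a = (\<lambda>\<omega>. \<lambda>r\<in>{0..s}. W r \<omega> $ i) -` A \<inter> space N"
        using True by (auto simp: E_def sets_history)
      have "a = ?p i -` ((\<lambda>x. \<lambda>r\<in>{0..s}. x r) -` A \<inter> space ?PM) \<inter> space N"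
      proof -
        have "(\<lambda>r\<in>{0..s}. ?p i \<omega> r) = (\<lambda>r\<in>{0..s}. W r \<omega> $ i)" for \<omega> by (auto simp: restrict_def)
        moreover have "?p i \<omega> \<in> space ?PM" for \<omega> by (simp add: space_PiM)
        ultimately show ?thesis unfolding A(2) by auto
      qed
      then show "a \<in> ?S i" using measurable_sets[OF m A(1)] by blast
    qed
  next
    case False
    have m: "(\<lambda>x. x u - x s) \<in> borel_measurable ?PM" using su by (intro borel_measurable_diff comp) auto
    show ?thesis
    proof
      fix a assume "a \<in> E (i, b)"
      then obtain C where C: "C \<in> sets borel" "a = ?D i -` C \<inter> space N" using False by (auto simp: E_def)
      have "a = ?p i -` ((\<lambda>x. x u - x s) -` C \<inter> space ?PM) \<inter> space N"
        using su by (auto simp: C(2) space_PiM)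
      then show "a \<in> ?S i" using measurable_sets[OF m C(1)] by blast
    qed
  qed
  have Eev: "E j \<subseteq> events" for j
    using history_sub_events measurable_sets[OF Dm] by (auto simp: E_def)
  have Esp: "space N \<in> E j" for j
  proof (cases "snd j")
    case True then show ?thesis using sets.top[of "history N (\<lambda>s \<omega>. W s \<omega> $ fst j) s"] by (simp add: E_def)
  next
    case False then show ?thesis by (auto simp: E_def intro!: exI[of _ UNIV])
  qed
  have "indep_sets E UNIV"
  proof (subst indep_sets_finite)
    show "\<forall>A\<in>Pi UNIV E. prob (\<Inter>j\<in>UNIV. A j) = (\<Prod>j\<in>UNIV. prob (A j))"
    proof
      fix A assume A: "A \<in> Pi UNIV E"
      have SI: "indep_sets ?S UNIV" using paths_indep by (simp add: indep_vars_def2)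
      have Sint: "A (i, True) \<inter> A (i, False) \<in> ?S i" for i
      proof -
        have "A (i, True) \<in> ?S i" "A (i, False) \<in> ?S i" using A ES by blast+
        then obtain X Y where "X \<in> sets ?PM" "A (i, True) = ?p i -` X \<inter> space N" "Y \<in> sets ?PM" "A (i, False) = ?p i -` Y \<inter> space N"
          by blast
        then show ?thesis by (intro CollectI exI[of _ "X \<inter> Y"]) auto
      qed
      have "(\<Inter>j\<in>UNIV. A j) = (\<Inter>i\<in>UNIV. A (i, True) \<inter> A (i, False))"
      proof safe
        fix x i b assume "x \<in> (\<Inter>i\<in>UNIV. A (i, True) \<inter> A (i, False))"
        then show "x \<in> A (i, b)" by (cases b) auto
      qed auto
      also have "prob \<dots> = (\<Prod>i\<in>UNIV. prob (A (i, True) \<inter> A (i, False)))"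
        by (rule indep_setsD[OF SI]) (use Sint in auto)
      also have "\<dots> = (\<Prod>i\<in>UNIV. \<Prod>b\<in>UNIV. prob (A (i, b)))"
      proof (rule prod.cong[OF refl])
        fix i
        have "A (i, True) \<in> sets (history N (\<lambda>s \<omega>. W s \<omega> $ i) s)" "A (i, False) \<in> {?D i -` C \<inter> space N | C. C \<in> sets borel}"
        proof -
          have "A (i, True) \<in> E (i, True)" "A (i, False) \<in> E (i, False)" using A by auto
          then show "A (i, True) \<in> sets (history N (\<lambda>s \<omega>. W s \<omega> $ i) s)" "A (i, False) \<in> {?D i -` C \<inter> space N | C. C \<in> sets borel}"
            unfolding E_def by (simp_all only: snd_conv fst_conv if_True if_False)
        qed
        then have "prob (A (i, True) \<inter> A (i, False)) = prob (A (i, True)) * prob (A (i, False))"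
          using c.indep_history_increment[OF su, of i] unfolding indep_sets2_eq by blast
        then show "prob (A (i, True) \<inter> A (i, False)) = (\<Prod>b\<in>UNIV. prob (A (i, b)))" by (simp add: UNIV_bool)
      qed
      also have "\<dots> = (\<Prod>j\<in>UNIV. prob (A j))" by (simp add: prod.cartesian_product)
      finally show "prob (\<Inter>j\<in>UNIV. A j) = (\<Prod>j\<in>UNIV. prob (A j))" .
    qed
  qed (use Eev Esp in auto)
  moreover have "(\<Union>b\<in>UNIV. UNIV \<times> {b}) = (UNIV :: (3 \<times> bool) set)" by auto
  ultimately have "indep_sets E (\<Union>b\<in>UNIV. UNIV \<times> {b})" by simp
  moreover have "Int_stable (E j)" for j
  proof (cases "snd j")
    case True then show ?thesis by (auto simp: E_def Int_stable_def)
  next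
    case False
    show ?thesis
    proof (rule Int_stableI)
      fix a b assume "a \<in> E j" "b \<in> E j"
      then obtain C C' where "C \<in> sets borel" "a = ?D (fst j) -` C \<inter> space N" "C' \<in> sets borel" "b = ?D (fst j) -` C' \<inter> space N"
        using False by (auto simp: E_def)
      then show "a \<inter> b \<in> E j" using False by (auto simp: E_def intro!: exI[of _ "C \<inter> C'"])
    qed
  qed
  ultimately have ind: "indep_sets (\<lambda>b. sigma_sets (space N) (\<Union>j\<in>UNIV \<times> {b}. E j)) UNIV"
    by (intro indep_sets_collect_sigma) (auto simp: disjoint_family_on_def)
  let ?G = "sigma (space N) (\<Union>j\<in>UNIV \<times> {False}. E j)"
  have Gs: "sets ?G = sigma_sets (space N) (\<Union>j\<in>UNIV \<times> {False}. E j)" "space ?G = space N"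
    using Eev sets.sets_into_space by (auto intro!: sets_measure_of space_measure_of simp: subset_eq) blast+
  have DG: "(\<lambda>\<omega>. W u \<omega> - W s \<omega>) \<in> borel_measurable ?G"
  proof -
    have "?D i \<in> borel_measurable ?G" for i
    proof (rule measurableI)
      fix C :: "real set" assume "C \<in> sets borel"
      then have "?D i -` C \<inter> space N \<in> E (i, False)" by (auto simp: E_def)
      then have "?D i -` C \<inter> space N \<in> (\<Union>j\<in>UNIV \<times> {False}. E j)" by blast
      then show "?D i -` C \<inter> space ?G \<in> sets ?G" unfolding Gs by (rule sigma_sets.Basic)
    qed simp
    then show ?thesis by (subst borel_measurable_euclidean_space) (auto simp: Basis_vec3 inner_axis)
  qed
  show ?thesis
    unfolding indep_sets2_eq
  proof (intro conjI ballI past_sub)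
    have dm: "(\<lambda>\<omega>. W u \<omega> - W s \<omega>) \<in> borel_measurable N" using su by (intro borel_measurable_diff W_meas) auto
    show "{(\<lambda>\<omega>. W u \<omega> - W s \<omega>) -` C \<inter> space N | C. C \<in> sets borel} \<subseteq> events"
      using measurable_sets[OF dm] by auto
    fix a b assume a: "a \<in> sets (past s)" and "b \<in> {(\<lambda>\<omega>. W u \<omega> - W s \<omega>) -` C \<inter> space N | C. C \<in> sets borel}"
    then obtain C where C: "C \<in> sets borel" "b = (\<lambda>\<omega>. W u \<omega> - W s \<omega>) -` C \<inter> space N" by blast
    have "(\<Union>j\<in>UNIV \<times> {True}. E j) = (\<Union>i. E (i, True))" by blast
    also have "\<dots> = (\<Union>i. sets (history N (\<lambda>s \<omega>. W s \<omega> $ i) s))" by (simp add: E_def)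
    finally have "a \<in> sigma_sets (space N) (\<Union>j\<in>UNIV \<times> {True}. E j)" using a by (simp add: sets_past)
    moreover have "b \<in> sigma_sets (space N) (\<Union>j\<in>UNIV \<times> {False}. E j)"
      using measurable_sets[OF DG C(1)] unfolding Gs C(2) .
    ultimately show "prob (a \<inter> b) = prob a * prob b"
      using indep_setsD[OF ind, of UNIV "\<lambda>x. if x then a else b"] by (simp add: UNIV_bool Int_commute mult.commute)
  qed
qed

lemma increments_indep:
  assumes "0 \<le> s" "s \<le> u"
  shows "indep_vars (\<lambda>_. borel) (\<lambda>i \<omega>. (W u \<omega> - W s \<omega>) $ i) UNIV"
proof -
  have m: "(\<lambda>x. x u - x s) \<in> borel_measurable (PiM {0..} (\<lambda>_. borel :: real measure))"
    using assms by (intro borel_measurable_diff measurable_component_singleton) auto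
  have "indep_vars (\<lambda>_. borel) (\<lambda>i \<omega>. (\<lambda>x. x u - x s) (\<lambda>s\<in>{0..}. W s \<omega> $ i)) UNIV"
    by (rule indep_vars_compose2[OF paths_indep]) (rule m)
  then show ?thesis using assms by simp
qed

lemma increment_law:
  assumes "0 \<le> s" "s < u"
  shows "distributed N lborel (\<lambda>\<omega>. (W u \<omega> - W s \<omega>) $ i) (normal_density 0 (sqrt (u - s)))"
  using c.B_incr[OF assms, of i] by simp

lemma increment_rotation_invariant:
  assumes "0 \<le> s" "s < u"
  shows "rotation_invariant (distr N borel (\<lambda>\<omega>. W u \<omega> - W s \<omega>))"
  using independent_normals_rotation_invariant[OF increments_indep[OF assms(1) less_imp_le[OF assms(2)]] increment_law[OF assms]] .

sublocale unit: gauss3 N "\<lambda>\<omega>. W 1 \<omega> - W 0 \<omega>"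
proof unfold_locales
  show "indep_vars (\<lambda>_. borel) (\<lambda>i \<omega>. (W 1 \<omega> - W 0 \<omega>) $ i) UNIV" by (rule increments_indep) auto
  show "distributed N lborel (\<lambda>\<omega>. (W 1 \<omega> - W 0 \<omega>) $ i) std_normal_density" for i
    using increment_law[of 0 1 i] by simp
qed

definition radial_event :: "real set \<Rightarrow> (real \<Rightarrow> real set) \<Rightarrow> 'b \<Rightarrow> real" where
  "radial_event K A = indicator {\<omega>\<in>space N. \<forall>i\<in>K. norm (W i \<omega>) \<in> A i}"

lemma radial_event_past:
  assumes "finite K" "K \<subseteq> {0..m}" "\<And>i. i \<in> K \<Longrightarrow> A i \<in> sets borel"
  shows "radial_event K A \<in> borel_measurable (past m)"
proof -
  have "{\<omega>\<in>space (past m). \<forall>i\<in>K. norm (W i \<omega>) \<in> A i} \<in> sets (past m)"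
  proof (intro sets.sets_Collect_finite_All assms(1))
    fix i assume "i \<in> K"
    then have [measurable]: "W i \<in> borel_measurable (past m)" "A i \<in> sets borel" using assms W_past by auto
    show "{\<omega>\<in>space (past m). norm (W i \<omega>) \<in> A i} \<in> sets (past m)" by measurable
  qed
  then show ?thesis unfolding radial_event_def by (intro borel_measurable_indicator) simp
qed

lemma radial_event_measurable:
  assumes "finite K" "K \<subseteq> {0..}" "\<And>i. i \<in> K \<Longrightarrow> A i \<in> sets borel"
  shows "radial_event K A \<in> borel_measurable N"
proof -
  have sub: "K \<subseteq> {0..Max (insert 0 K)}" using assms by auto
  have "radial_event K A \<in> borel_measurable (past (Max (insert 0 K)))"
    by (rule radial_event_past[OF assms(1) sub]) (rule assms(3))
  then show ?thesis using past_sub by (auto simp: measurable_def)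
qed

lemma radial_event_range: "\<bar>radial_event K A \<omega>\<bar> \<le> 1"
  by (simp add: radial_event_def indicator_def)

lemma past_increment_integral:
  fixes f :: "real ^ 3 \<Rightarrow> real ^ 3 \<Rightarrow> real"
  assumes su: "0 \<le> s" "s < u" and h: "h \<in> borel_measurable (past s)" "\<And>\<omega>. \<bar>h \<omega>\<bar> \<le> 1"
    and f: "(\<lambda>p. f (fst p) (snd p)) \<in> borel_measurable (borel \<Otimes>\<^sub>M borel)" and fb: "\<And>x z. \<bar>f x z\<bar> \<le> c"
  shows "(\<integral>\<omega>. h \<omega> * f (W s \<omega>) (W u \<omega> - W s \<omega>) \<partial>N) =
     (\<integral>\<omega>. h \<omega> * (\<integral>z. f (W s \<omega>) z \<partial>distr N borel (\<lambda>\<omega>. W u \<omega> - W s \<omega>)) \<partial>N)"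
proof -
  let ?D = "\<lambda>\<omega>. W u \<omega> - W s \<omega>"
  note [measurable] = h(1)
  have Ws[measurable]: "W s \<in> borel_measurable (past s)" using su by (intro W_past) auto
  have D: "?D \<in> N \<rightarrow>\<^sub>M borel" using su by (intro borel_measurable_diff W_meas) auto
  have m: "(\<lambda>p. h (fst p) * f (W s (fst p)) (snd p)) \<in> borel_measurable (past s \<Otimes>\<^sub>M borel)"
  proof -
    have "(\<lambda>p. (W s (fst p), snd p)) \<in> past s \<Otimes>\<^sub>M borel \<rightarrow>\<^sub>M borel \<Otimes>\<^sub>M borel" by measurable
    from measurable_compose[OF this f] have [measurable]: "(\<lambda>p. f (W s (fst p)) (snd p)) \<in> borel_measurable (past s \<Otimes>\<^sub>M borel)" by simp
    show ?thesis by measurable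
  qed
  have b: "\<bar>h (fst p) * f (W s (fst p)) (snd p)\<bar> \<le> 1 * c" for p
    unfolding abs_mult by (intro mult_mono h(2) fb) auto
  have "(\<integral>\<omega>. h \<omega> * f (W s \<omega>) (W u \<omega> - W s \<omega>) \<partial>N) = (\<integral>\<omega>. (\<lambda>p. h (fst p) * f (W s (fst p)) (snd p)) (\<omega>, ?D \<omega>) \<partial>N)"
    by simp
  also have "\<dots> = (\<integral>\<omega>. (\<integral>z. (\<lambda>p. h (fst p) * f (W s (fst p)) (snd p)) (\<omega>, z) \<partial>distr N borel ?D) \<partial>N)"
    by (rule indep_set_integral[OF space_past past_sub D indep_past_increment[OF su(1) less_imp_le[OF su(2)]] m b])
  finally show ?thesis by simp
qed

text \<open>Rotating the whole path does not change the radial part, and a Gaussian increment is invariant.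
  So the law of \<open>W m\<close> restricted to an event of the radial past is invariant.\<close>

lemma weighted_rotation:
  assumes "finite K" "K \<subseteq> {0..m}" "0 \<le> m" "\<And>i. i \<in> K \<Longrightarrow> A i \<in> sets borel"
    and T: "orthogonal_transformation T" and f: "f \<in> borel_measurable borel" "\<And>x. \<bar>f x\<bar> \<le> c"
  shows "(\<integral>\<omega>. radial_event K A \<omega> * f (T (W m \<omega>)) \<partial>N) = (\<integral>\<omega>. radial_event K A \<omega> * f (W m \<omega>) \<partial>N)"
  using assms
proof (induction K arbitrary: m A f rule: finite_linorder_max_induct)
  note Tm = orthogonal_measurable[OF T]
  have lin: "linear T" using T by (rule orthogonal_transformation_linear)
  have lift: "(\<integral>\<omega>. h \<omega> * f (T (W m \<omega>)) \<partial>N) = (\<integral>\<omega>. h \<omega> * f (W m \<omega>) \<partial>N)"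
    if b: "0 \<le> b" "b \<le> m" and h: "h \<in> borel_measurable (past b)" "\<And>\<omega>. \<bar>h \<omega>\<bar> \<le> 1"
      and at_b: "\<And>g. g \<in> borel_measurable borel \<Longrightarrow> (\<And>x. \<bar>g x\<bar> \<le> c) \<Longrightarrow> (\<integral>\<omega>. h \<omega> * g (T (W b \<omega>)) \<partial>N) = (\<integral>\<omega>. h \<omega> * g (W b \<omega>) \<partial>N)"
      and f: "f \<in> borel_measurable borel" "\<And>x. \<bar>f x\<bar> \<le> c"
    for b m and h :: "'b \<Rightarrow> real" and f :: "real ^ 3 \<Rightarrow> real"
  proof (cases "b = m")
    case True then show ?thesis using at_b[OF f] by simp
  next
    case False
    then have bm: "b < m" using b by simp
    let ?\<gamma> = "distr N borel (\<lambda>\<omega>. W m \<omega> - W b \<omega>)"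
    have "(\<lambda>\<omega>. W m \<omega> - W b \<omega>) \<in> borel_measurable N" using b by (intro borel_measurable_diff W_meas) auto
    then interpret G: prob_space ?\<gamma> by (rule prob_space_distr)
    let ?F = "\<lambda>w. \<integral>z. f (w + z) \<partial>?\<gamma>"
    have inv: "distr ?\<gamma> borel T = ?\<gamma>"
      using increment_rotation_invariant[OF b(1) bm] T by (simp add: rotation_invariant_def)
    note [measurable] = f(1) Tm
    have Fm: "?F \<in> borel_measurable borel"
    proof -
      have "(\<lambda>(w, z). f (w + z)) \<in> borel_measurable (borel \<Otimes>\<^sub>M ?\<gamma>)" by measurable
      then show ?thesis by (rule G.borel_measurable_lebesgue_integral)
    qed
    have Fb: "\<bar>?F w\<bar> \<le> c" for w
    proof -
      have "0 \<le> c" using f(2)[of 0] by linarith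
      have "\<bar>?F w\<bar> \<le> (\<integral>z. \<bar>f (w + z)\<bar> \<partial>?\<gamma>)" by (rule integral_abs_bound)
      also have "\<dots> \<le> (\<integral>z. c \<partial>?\<gamma>)" using f(2) \<open>0 \<le> c\<close> by (intro integral_mono G.integrable_const_bound[of _ c]) auto
      finally show ?thesis using G.prob_space by simp
    qed
    have "(\<integral>\<omega>. h \<omega> * f (T (W m \<omega>)) \<partial>N) = (\<integral>\<omega>. h \<omega> * (\<lambda>x z. f (T x + T z)) (W b \<omega>) (W m \<omega> - W b \<omega>) \<partial>N)"
      by (simp flip: linear_add[OF lin])
    also have "\<dots> = (\<integral>\<omega>. h \<omega> * (\<integral>z. f (T (W b \<omega>) + T z) \<partial>?\<gamma>) \<partial>N)"
      by (rule past_increment_integral[OF b(1) bm h]) (measurable, rule f(2))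
    also have "(\<lambda>\<omega>. h \<omega> * (\<integral>z. f (T (W b \<omega>) + T z) \<partial>?\<gamma>)) = (\<lambda>\<omega>. h \<omega> * ?F (T (W b \<omega>)))"
    proof
      fix \<omega>
      have "(\<integral>z. f (T (W b \<omega>) + T z) \<partial>?\<gamma>) = (\<integral>z. f (T (W b \<omega>) + z) \<partial>distr ?\<gamma> borel T)"
        by (rule integral_distr[symmetric]) auto
      then show "h \<omega> * (\<integral>z. f (T (W b \<omega>) + T z) \<partial>?\<gamma>) = h \<omega> * ?F (T (W b \<omega>))" unfolding inv by simp
    qed
    also have "(\<integral>\<omega>. h \<omega> * ?F (T (W b \<omega>)) \<partial>N) = (\<integral>\<omega>. h \<omega> * ?F (W b \<omega>) \<partial>N)" by (rule at_b[OF Fm Fb])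
    also have "\<dots> = (\<integral>\<omega>. h \<omega> * (\<lambda>x z. f (x + z)) (W b \<omega>) (W m \<omega> - W b \<omega>) \<partial>N)"
      by (rule past_increment_integral[OF b(1) bm h, symmetric]) (measurable, rule f(2))
    finally show ?thesis by simp
  qed
  {
    case empty
    show ?case
    proof (rule lift[of 0 m "radial_event {} A" f])
      show "(\<integral>\<omega>. radial_event {} A \<omega> * g (T (W 0 \<omega>)) \<partial>N) = (\<integral>\<omega>. radial_event {} A \<omega> * g (W 0 \<omega>) \<partial>N)"
        if [measurable]: "g \<in> borel_measurable borel" for g
      proof (rule integral_cong_AE)
        have [measurable]: "W 0 \<in> borel_measurable N" "radial_event {} A \<in> borel_measurable N" "T \<in> borel_measurable borel"
          by (auto intro!: W_meas radial_event_measurable Tm)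
        show "(\<lambda>\<omega>. radial_event {} A \<omega> * g (T (W 0 \<omega>))) \<in> borel_measurable N"
          "(\<lambda>\<omega>. radial_event {} A \<omega> * g (W 0 \<omega>)) \<in> borel_measurable N" by measurable
        show "AE \<omega> in N. radial_event {} A \<omega> * g (T (W 0 \<omega>)) = radial_event {} A \<omega> * g (W 0 \<omega>)"
          using W_zero by eventually_elim (simp add: linear_0[OF lin])
      qed
    qed (use empty in \<open>auto intro!: radial_event_past radial_event_range\<close>)
  next
    case (insert b K)
    have bm: "0 \<le> b" "b \<le> m" using insert.prems by auto
    have Kb: "K \<subseteq> {0..b}"
    proof
      fix x assume "x \<in> K"
      then show "x \<in> {0..b}" using insert.hyps(2) insert.prems(1) by (auto intro: less_imp_le)
    qed
    note b = bm Kb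
    show ?case
    proof (rule lift[OF b(1,2) _ radial_event_range])
      show "radial_event (insert b K) A \<in> borel_measurable (past b)"
        using insert b by (intro radial_event_past) auto
      fix g :: "real ^ 3 \<Rightarrow> real" assume g: "g \<in> borel_measurable borel" "\<And>x. \<bar>g x\<bar> \<le> c"
      let ?g = "\<lambda>x. indicator (A b) (norm x) * g x"
      note [measurable] = g(1)
      have [measurable]: "A b \<in> sets borel" using insert by auto
      have c0: "0 \<le> c" using g(2)[of 0] by linarith
      have "(\<integral>\<omega>. radial_event K A \<omega> * ?g (T (W b \<omega>)) \<partial>N) = (\<integral>\<omega>. radial_event K A \<omega> * ?g (W b \<omega>) \<partial>N)"
      proof (rule insert.IH)
        show "\<bar>?g x\<bar> \<le> c" for x using g(2)[of x] c0 by (auto simp: indicator_def)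
      qed (use insert b in \<open>auto simp: T\<close>)
      moreover have "radial_event (insert b K) A \<omega> = radial_event K A \<omega> * indicator (A b) (norm (W b \<omega>))" for \<omega>
        by (auto simp: radial_event_def indicator_def)
      ultimately show "(\<integral>\<omega>. radial_event (insert b K) A \<omega> * g (T (W b \<omega>)) \<partial>N) = (\<integral>\<omega>. radial_event (insert b K) A \<omega> * g (W b \<omega>) \<partial>N)"
        using T by (simp add: orthogonal_transformation_norm mult.assoc)
    qed (rule insert.prems)+
  }
qed

text \<open>Both sides are averages over the uniform ratio \<open>v\<close> at given radius \<open>r\<close>, and
  \<open>F(r v, r - r v)\<close> is the derivative in \<open>v\<close> of \<open>exp (-k (r - r v)) sin (\<xi> r v) / r\<close>, whose increment over
  \<open>[0, 1]\<close> does not depend on \<open>k\<close>.\<close>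

lemma pitman_to_cos:
  assumes K: "finite K" "K \<subseteq> {0..m}" "0 \<le> m" "\<And>i. i \<in> K \<Longrightarrow> A i \<in> sets borel" and k: "0 \<le> k"
  shows "(\<integral>\<omega>. radial_event K A \<omega> * pitman_fun \<xi> k \<bar>W m \<omega> $ 1\<bar> (norm (W m \<omega>) - \<bar>W m \<omega> $ 1\<bar>) \<partial>N) =
     \<xi> * (\<integral>\<omega>. radial_event K A \<omega> * cos (\<xi> * W m \<omega> $ 1) \<partial>N)"
proof -
  \<comment> \<open>The maximum only keeps \<open>?f\<close> bounded for arbitrary arguments; it is inactive since \<open>\<bar>W\<^sup>1\<bar> \<le> \<bar>W\<bar>\<close>.\<close>
  let ?h = "radial_event K A" and ?f = "\<lambda>r x. pitman_fun \<xi> k x (max 0 (r - x))"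
  have "K \<subseteq> {0..}" using K by auto
  note mix = unit.rotation_mixture[OF prob_space_axioms W_meas[OF K(3)] radial_event_measurable[OF K(1) this K(4)] radial_event_range weighted_rotation[OF K]]
  have "(\<integral>\<omega>. ?h \<omega> * pitman_fun \<xi> k \<bar>W m \<omega> $ 1\<bar> (norm (W m \<omega>) - \<bar>W m \<omega> $ 1\<bar>) \<partial>N) = (\<integral>\<omega>. ?h \<omega> * ?f (norm (W m \<omega>)) \<bar>W m \<omega> $ 1\<bar> \<partial>N)"
    using component_le_norm_cart[of "W m _" 1] by (simp add: max_def)
  also have "\<dots> = (\<integral>\<omega>. ?h \<omega> * (\<integral>v. ?f (norm (W m \<omega>)) (norm (W m \<omega>) * v) \<partial>unit_lborel) \<partial>N)"
  proof (rule mix[where c = "\<bar>\<xi>\<bar> + k"])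
    show "(\<lambda>p. ?f (fst p) (snd p)) \<in> borel_measurable (borel \<Otimes>\<^sub>M borel)" unfolding pitman_fun_def by measurable
    fix r x :: real
    have "\<bar>\<xi> * cos (\<xi> * x) + k * sin (\<xi> * x)\<bar> \<le> \<bar>\<xi>\<bar> * \<bar>cos (\<xi> * x)\<bar> + k * \<bar>sin (\<xi> * x)\<bar>"
      using abs_triangle_ineq[of "\<xi> * cos (\<xi> * x)" "k * sin (\<xi> * x)"] k by (simp add: abs_mult)
    also have "\<dots> \<le> \<bar>\<xi>\<bar> * 1 + k * 1" using k by (intro add_mono mult_left_mono) auto
    finally have "exp (- k * max 0 (r - x)) * \<bar>\<xi> * cos (\<xi> * x) + k * sin (\<xi> * x)\<bar> \<le> 1 * (\<bar>\<xi>\<bar> + k)"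
      using k by (intro mult_mono) auto
    then show "\<bar>?f r x\<bar> \<le> \<bar>\<xi>\<bar> + k" by (simp add: pitman_fun_def abs_mult)
  qed
  also have "(\<lambda>\<omega>. ?h \<omega> * (\<integral>v. ?f (norm (W m \<omega>)) (norm (W m \<omega>) * v) \<partial>unit_lborel)) =
     (\<lambda>\<omega>. ?h \<omega> * (\<integral>v. \<xi> * cos (\<xi> * (norm (W m \<omega>) * v)) \<partial>unit_lborel))"
  proof -
    have "(\<integral>v. ?f r (r * v) \<partial>unit_lborel) = (\<integral>v. \<xi> * cos (\<xi> * (r * v)) \<partial>unit_lborel)" if r: "0 \<le> r" for r
    proof (cases "r = 0")
      case True then show ?thesis by (simp add: pitman_fun_def)
    next
      case False
      have "(\<integral>v. ?f r (r * v) \<partial>unit_lborel) = (\<integral>v. exp (- k * (r - r * v)) * (\<xi> * cos (\<xi> * (r * v)) + k * sin (\<xi> * (r * v))) \<partial>unit_lborel)"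
        using r by (intro Bochner_Integration.integral_cong refl) (auto simp: pitman_fun_def space_restrict_space max_def mult_left_le)
      also have "\<dots> = exp (- k * (r - r * 1)) * sin (\<xi> * (r * 1)) / r - exp (- k * (r - r * 0)) * sin (\<xi> * (r * 0)) / r"
        using False by (intro unit_lborel_integral_FTC[where F = "\<lambda>v. exp (- k * (r - r * v)) * sin (\<xi> * (r * v)) / r"])
           (auto intro!: derivative_eq_intros continuous_intros simp: field_simps)
      also have "\<dots> = sin (\<xi> * (r * 1)) / r - sin (\<xi> * (r * 0)) / r" by simp
      also have "\<dots> = (\<integral>v. \<xi> * cos (\<xi> * (r * v)) \<partial>unit_lborel)"
        using False by (intro unit_lborel_integral_FTC[where F = "\<lambda>v. sin (\<xi> * (r * v)) / r", symmetric])
           (auto intro!: derivative_eq_intros continuous_intros)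
      finally show ?thesis .
    qed
    then show ?thesis by simp
  qed
  also have "(\<integral>\<omega>. ?h \<omega> * (\<integral>v. \<xi> * cos (\<xi> * (norm (W m \<omega>) * v)) \<partial>unit_lborel) \<partial>N) = (\<integral>\<omega>. ?h \<omega> * (\<xi> * cos (\<xi> * \<bar>W m \<omega> $ 1\<bar>)) \<partial>N)"
  proof (rule mix[where f = "\<lambda>r x. \<xi> * cos (\<xi> * x)" and c = "\<bar>\<xi>\<bar>", symmetric])
    show "\<bar>\<xi> * cos (\<xi> * x)\<bar> \<le> \<bar>\<xi>\<bar>" for x by (simp add: abs_mult mult_left_le)
    have "(\<lambda>p::real \<times> real. \<xi> * cos (\<xi> * snd p)) \<in> borel_measurable (borel \<Otimes>\<^sub>M borel)" by measurable
    then show "(\<lambda>p::real \<times> real. \<xi> * cos (\<xi> * snd p)) \<in> borel_measurable (borel \<Otimes>\<^sub>M borel)" .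
  qed assumption
  also have "\<dots> = (\<integral>\<omega>. \<xi> * (?h \<omega> * cos (\<xi> * W m \<omega> $ 1)) \<partial>N)"
  proof (intro Bochner_Integration.integral_cong refl)
    fix \<omega>
    have "cos (\<xi> * \<bar>W m \<omega> $ 1\<bar>) = cos (\<xi> * W m \<omega> $ 1)" by (cases "W m \<omega> $ 1 \<ge> 0") auto
    then show "?h \<omega> * (\<xi> * cos (\<xi> * \<bar>W m \<omega> $ 1\<bar>)) = \<xi> * (?h \<omega> * cos (\<xi> * W m \<omega> $ 1))" by simp
  qed
  finally show ?thesis by simp
qed

lemma cos_martingale:
  assumes K: "finite K" "K \<subseteq> {0..m}" "\<And>i. i \<in> K \<Longrightarrow> A i \<in> sets borel" and mu: "0 \<le> m" "m < u"
  shows "(\<integral>\<omega>. radial_event K A \<omega> * cos (\<xi> * W u \<omega> $ 1) \<partial>N) =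
     exp (- \<xi>\<^sup>2 * (u - m) / 2) * (\<integral>\<omega>. radial_event K A \<omega> * cos (\<xi> * W m \<omega> $ 1) \<partial>N)"
proof -
  let ?h = "radial_event K A" and ?\<gamma> = "distr N borel (\<lambda>\<omega>. W u \<omega> - W m \<omega>)"
  have dm: "(\<lambda>\<omega>. W u \<omega> - W m \<omega>) \<in> borel_measurable N" using mu by (intro borel_measurable_diff W_meas) auto
  have shift: "(\<integral>z. cos (\<xi> * x $ 1 + \<xi> * z $ 1) \<partial>?\<gamma>) = exp (- \<xi>\<^sup>2 * (u - m) / 2) * cos (\<xi> * x $ 1)" for x :: "real ^ 3"
  proof -
    have "(\<integral>z. cos (\<xi> * x $ 1 + \<xi> * z $ 1) \<partial>?\<gamma>) = (\<integral>\<omega>. cos (\<xi> * x $ 1 + \<xi> * (W u \<omega> $ 1 - W m \<omega> $ 1)) \<partial>N)"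
      by (subst integral_distr[OF dm]) auto
    also have "\<dots> = (\<integral>y. cos (\<xi> * x $ 1 + \<xi> * y) \<partial>distr N borel (\<lambda>\<omega>. W u \<omega> $ 1 - W m \<omega> $ 1))"
      using mu c.B_meas by (intro integral_distr[symmetric]) auto
    also have "\<dots> = (\<integral>z. cos (\<xi> * x $ 1 + (\<xi> * sqrt (u - m)) * z) \<partial>std_normal_distribution)"
      unfolding c.increment_std_normal[OF mu] by (subst integral_distr) (auto simp: mult.assoc)
    also have "\<dots> = exp (- \<xi>\<^sup>2 * (u - m) / 2) * cos (\<xi> * x $ 1)"
      unfolding cos_shift_std_normal using mu by (simp add: power_mult_distrib)
    finally show ?thesis .
  qed
  have "(\<integral>\<omega>. ?h \<omega> * cos (\<xi> * W u \<omega> $ 1) \<partial>N) = (\<integral>\<omega>. ?h \<omega> * (\<lambda>x z. cos (\<xi> * x $ 1 + \<xi> * z $ 1)) (W m \<omega>) (W u \<omega> - W m \<omega>) \<partial>N)"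
    by (simp add: algebra_simps)
  also have "\<dots> = (\<integral>\<omega>. ?h \<omega> * (\<integral>z. cos (\<xi> * W m \<omega> $ 1 + \<xi> * z $ 1) \<partial>?\<gamma>) \<partial>N)"
  proof (rule past_increment_integral[OF mu _ radial_event_range, where c = 1])
    show "?h \<in> borel_measurable (past m)" by (rule radial_event_past[OF K(1,2)]) (rule K(3))
    have n: "(\<lambda>x::real^3. x $ 1) \<in> borel_measurable borel" by measurable
    note [measurable] = measurable_compose[OF measurable_fst n] measurable_compose[OF measurable_snd n]
    show "(\<lambda>p::(real^3) \<times> (real^3). cos (\<xi> * fst p $ 1 + \<xi> * snd p $ 1)) \<in> borel_measurable (borel \<Otimes>\<^sub>M borel)"
      by measurable
  qed simp
  also have "\<dots> = (\<integral>\<omega>. exp (- \<xi>\<^sup>2 * (u - m) / 2) * (?h \<omega> * cos (\<xi> * W m \<omega> $ 1)) \<partial>N)"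
    unfolding shift by (simp add: mult.left_commute)
  finally show ?thesis by simp
qed

lemma bessel_martingale:
  assumes K: "finite K" "K \<subseteq> {0..m}" "\<And>i. i \<in> K \<Longrightarrow> A i \<in> sets borel" and mu: "0 \<le> m" "m < u" and k: "0 \<le> k"
  shows "(\<integral>\<omega>. radial_event K A \<omega> * pitman_fun \<xi> k \<bar>W u \<omega> $ 1\<bar> (norm (W u \<omega>) - \<bar>W u \<omega> $ 1\<bar>) \<partial>N) =
     exp (- \<xi>\<^sup>2 * (u - m) / 2) * (\<integral>\<omega>. radial_event K A \<omega> * pitman_fun \<xi> k \<bar>W m \<omega> $ 1\<bar> (norm (W m \<omega>) - \<bar>W m \<omega> $ 1\<bar>) \<partial>N)"
proof -
  have "K \<subseteq> {0..u}" "0 \<le> u" using K mu by auto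
  then show ?thesis
    using K mu k by (simp add: pitman_to_cos cos_martingale[OF K mu] mult.left_commute)
qed

end


section \<open>From martingales to laws of processes\<close>

text \<open>What the two pairs have in common. Only events of the sum process enter the martingale identity,
  and nonnegativity is required at every point; the second component may therefore have to be
  modified on a null set before the locale applies.\<close>

locale pitman_pair = prob_space M for M :: "'a measure" +
  fixes X L :: "real \<Rightarrow> 'a \<Rightarrow> real"
  assumes X_meas: "0 \<le> s \<Longrightarrow> X s \<in> borel_measurable M" and L_meas: "0 \<le> s \<Longrightarrow> L s \<in> borel_measurable M"
    and X_nonneg: "0 \<le> X s \<omega>" and L_nonneg: "0 \<le> L s \<omega>"
    and start: "AE \<omega> in M. X 0 \<omega> = 0 \<and> L 0 \<omega> = 0"
    and X_int: "0 \<le> s \<Longrightarrow> integrable M (X s)"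
    and martingale: "finite K \<Longrightarrow> K \<subseteq> {0..m} \<Longrightarrow> 0 \<le> m \<Longrightarrow> m < u \<Longrightarrow> (\<And>i. i \<in> K \<Longrightarrow> A i \<in> sets borel) \<Longrightarrow> 0 < k \<Longrightarrow>
      (\<integral>\<omega>. indicator {\<omega>\<in>space M. \<forall>i\<in>K. X i \<omega> + L i \<omega> \<in> A i} \<omega> * pitman_fun \<xi> k (X u \<omega>) (L u \<omega>) \<partial>M) =
      exp (- \<xi>\<^sup>2 * (u - m) / 2) *
      (\<integral>\<omega>. indicator {\<omega>\<in>space M. \<forall>i\<in>K. X i \<omega> + L i \<omega> \<in> A i} \<omega> * pitman_fun \<xi> k (X m \<omega>) (L m \<omega>) \<partial>M)"
begin

definition hits :: "real set \<Rightarrow> (real \<Rightarrow> real set) \<Rightarrow> 'a set" where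
  "hits K A = {\<omega>\<in>space M. \<forall>i\<in>K. X i \<omega> + L i \<omega> \<in> A i}"

text \<open>The event is kept as a restriction of the measure rather than as a conditioning, which avoids
  a case distinction for null events.\<close>

definition weighted :: "real set \<Rightarrow> (real \<Rightarrow> real set) \<Rightarrow> 'a measure" where
  "weighted K A = density M (indicator (hits K A))"

definition law :: "real set \<Rightarrow> (real \<Rightarrow> real set) \<Rightarrow> real \<Rightarrow> (real \<times> real) measure" where
  "law K A s = distr (weighted K A) borel (\<lambda>\<omega>. (X s \<omega>, L s \<omega>))"

lemma hits_sets:
  assumes "finite K" "K \<subseteq> {0..}" "\<And>i. i \<in> K \<Longrightarrow> A i \<in> sets borel"
  shows "hits K A \<in> events"
  unfolding hits_def
proof (intro sets.sets_Collect_finite_All assms(1))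
  fix i assume "i \<in> K"
  then have [measurable]: "X i \<in> borel_measurable M" "L i \<in> borel_measurable M" "A i \<in> sets borel"
    using assms X_meas L_meas by auto
  show "{\<omega>\<in>space M. X i \<omega> + L i \<omega> \<in> A i} \<in> events" by measurable
qed

lemma pair_meas: "0 \<le> s \<Longrightarrow> (\<lambda>\<omega>. (X s \<omega>, L s \<omega>)) \<in> borel_measurable M"
  using X_meas L_meas by auto

lemma emeasure_law:
  assumes "finite K" "K \<subseteq> {0..}" "\<And>i. i \<in> K \<Longrightarrow> A i \<in> sets borel" "0 \<le> s" "C \<in> sets borel"
  shows "emeasure (law K A s) C = emeasure M {\<omega>\<in>space M. (\<forall>i\<in>K. X i \<omega> + L i \<omega> \<in> A i) \<and> (X s \<omega>, L s \<omega>) \<in> C}"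
proof -
  have h: "hits K A \<in> events" by (rule hits_sets[OF assms(1,2)]) (rule assms(3))
  have m: "(\<lambda>\<omega>. (X s \<omega>, L s \<omega>)) \<in> weighted K A \<rightarrow>\<^sub>M borel" using pair_meas[OF assms(4)] by (simp add: weighted_def)
  have c: "(\<lambda>\<omega>. (X s \<omega>, L s \<omega>)) -` C \<inter> space M \<in> events" using measurable_sets[OF pair_meas[OF assms(4)] assms(5)] .
  have "emeasure (law K A s) C = emeasure (density M (indicator (hits K A))) ((\<lambda>\<omega>. (X s \<omega>, L s \<omega>)) -` C \<inter> space M)"
    unfolding law_def emeasure_distr[OF m assms(5)] by (simp add: weighted_def)
  also have "\<dots> = emeasure M (hits K A \<inter> ((\<lambda>\<omega>. (X s \<omega>, L s \<omega>)) -` C \<inter> space M))"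
    using h c by (subst emeasure_density) (auto simp flip: indicator_inter_arith intro!: nn_integral_indicator)
  also have "hits K A \<inter> ((\<lambda>\<omega>. (X s \<omega>, L s \<omega>)) -` C \<inter> space M) =
      {\<omega>\<in>space M. (\<forall>i\<in>K. X i \<omega> + L i \<omega> \<in> A i) \<and> (X s \<omega>, L s \<omega>) \<in> C}" by (auto simp: hits_def)
  finally show ?thesis .
qed

lemma weighted_integral:
  fixes f :: "'a \<Rightarrow> real"
  assumes "finite K" "K \<subseteq> {0..}" "\<And>i. i \<in> K \<Longrightarrow> A i \<in> sets borel" and f: "f \<in> borel_measurable M"
  shows "(\<integral>\<omega>. f \<omega> \<partial>weighted K A) = (\<integral>\<omega>. indicator (hits K A) \<omega> * f \<omega> \<partial>M)"
proof -
  have h: "hits K A \<in> events" by (rule hits_sets[OF assms(1,2)]) (rule assms(3))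
  have "weighted K A = density M (\<lambda>\<omega>. ennreal (indicator (hits K A) \<omega>))" by (simp add: weighted_def ennreal_indicator)
  then show ?thesis using h f by (simp add: integral_density)
qed

lemma nonneg_pair_weighted:
  assumes "finite K" "K \<subseteq> {0..}" "\<And>i. i \<in> K \<Longrightarrow> A i \<in> sets borel" "0 \<le> s"
  shows "nonneg_pair (weighted K A) (X s) (L s)"
proof -
  have h: "hits K A \<in> events" by (rule hits_sets[OF assms(1,2)]) (rule assms(3))
  have eq: "weighted K A = density M (\<lambda>\<omega>. ennreal (indicator (hits K A) \<omega>))" by (simp add: weighted_def ennreal_indicator)
  interpret F: finite_measure "weighted K A"
  proof
    have "emeasure (weighted K A) (space M) = emeasure M (hits K A)"
      using h by (simp add: weighted_def emeasure_density cong: nn_integral_cong)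
    then show "emeasure (weighted K A) (space (weighted K A)) \<noteq> \<infinity>" by (simp add: weighted_def)
  qed
  show ?thesis
  proof unfold_locales
    show "integrable (weighted K A) (X s)"
      unfolding eq using h X_meas[OF assms(4)] X_int[OF assms(4)]
      by (simp add: integrable_density integrable_real_mult_indicator mult.commute)
  qed (use X_meas L_meas X_nonneg L_nonneg assms in \<open>auto simp: weighted_def\<close>)
qed

end

lemma pitman_fun_meas: "(\<lambda>p. pitman_fun \<xi> k (fst p) (snd p)) \<in> borel_measurable (borel :: (real \<times> real) measure)"
  unfolding pitman_fun_def by (intro borel_measurable_continuous_onI continuous_intros)

text \<open>The martingale identity transports the joint law of the sum process and the pair from the last
  observation time to a later one, because the functions \<open>pitman_fun\<close> determine a law.\<close>

lemma pitman_pair_laws: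
  assumes P: "pitman_pair M X L" and P': "pitman_pair N X' L'"
    and K: "finite K" "K \<subseteq> {0..}" and A: "\<And>i. i \<in> K \<Longrightarrow> A i \<in> sets borel"
  shows "pitman_pair.law M X L K A (Max (insert 0 K)) = pitman_pair.law N X' L' K A (Max (insert 0 K))"
proof -
  interpret P: pitman_pair M X L by (rule P)
  interpret P': pitman_pair N X' L' by (rule P')
  have advance: "P.law K A u = P'.law K A u"
    if K: "finite K" "K \<subseteq> {0..m}" "0 \<le> m" "m \<le> u" and A: "\<And>i. i \<in> K \<Longrightarrow> A i \<in> sets borel" and eq: "P.law K A m = P'.law K A m"
    for K A m u
  proof (cases "m = u")
    case False
    then have mu: "m < u" using that by simp
    have u0: "0 \<le> u" and K0: "K \<subseteq> {0..}" using K by auto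
    note KA = K(1) K0 A
    have fm: "(\<lambda>\<omega>. pitman_fun \<xi> k (X s \<omega>) (L s \<omega>)) \<in> borel_measurable M" if "0 \<le> s" for \<xi> k s
      using measurable_compose[OF P.pair_meas[OF that] pitman_fun_meas] by simp
    have fm': "(\<lambda>\<omega>. pitman_fun \<xi> k (X' s \<omega>) (L' s \<omega>)) \<in> borel_measurable N" if "0 \<le> s" for \<xi> k s
      using measurable_compose[OF P'.pair_meas[OF that] pitman_fun_meas] by simp
    have pm: "(\<lambda>\<omega>. (X m \<omega>, L m \<omega>)) \<in> P.weighted K A \<rightarrow>\<^sub>M borel" and pm': "(\<lambda>\<omega>. (X' m \<omega>, L' m \<omega>)) \<in> P'.weighted K A \<rightarrow>\<^sub>M borel"
      using P.pair_meas[OF K(3)] P'.pair_meas[OF K(3)] by (auto simp: P.weighted_def P'.weighted_def)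
    show ?thesis
      unfolding P.law_def P'.law_def
    proof (rule pitman_fun_determines_law[OF P.nonneg_pair_weighted[OF K(1) K0 A u0] P'.nonneg_pair_weighted[OF K(1) K0 A u0]])
      fix \<xi> k :: real assume k: "0 < k"
      have "(\<integral>\<omega>. pitman_fun \<xi> k (X u \<omega>) (L u \<omega>) \<partial>P.weighted K A) = exp (- \<xi>\<^sup>2 * (u - m) / 2) * (\<integral>\<omega>. pitman_fun \<xi> k (X m \<omega>) (L m \<omega>) \<partial>P.weighted K A)"
        using P.weighted_integral[OF KA fm[OF u0]] P.weighted_integral[OF KA fm[OF K(3)]] P.martingale[OF K(1,2,3) mu A k]
        by (simp add: P.hits_def)
      also have "(\<integral>\<omega>. pitman_fun \<xi> k (X m \<omega>) (L m \<omega>) \<partial>P.weighted K A) = (\<integral>p. pitman_fun \<xi> k (fst p) (snd p) \<partial>P.law K A m)"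
        unfolding P.law_def by (subst integral_distr[OF pm pitman_fun_meas]) simp
      also have "\<dots> = (\<integral>\<omega>. pitman_fun \<xi> k (X' m \<omega>) (L' m \<omega>) \<partial>P'.weighted K A)"
        unfolding eq P'.law_def by (subst integral_distr[OF pm' pitman_fun_meas]) simp
      also have "exp (- \<xi>\<^sup>2 * (u - m) / 2) * \<dots> = (\<integral>\<omega>. pitman_fun \<xi> k (X' u \<omega>) (L' u \<omega>) \<partial>P'.weighted K A)"
        using P'.weighted_integral[OF KA fm'[OF u0]] P'.weighted_integral[OF KA fm'[OF K(3)]] P'.martingale[OF K(1,2,3) mu A k]
        by (simp add: P'.hits_def)
      finally show "(\<integral>\<omega>. pitman_fun \<xi> k (X u \<omega>) (L u \<omega>) \<partial>P.weighted K A) = (\<integral>\<omega>. pitman_fun \<xi> k (X' u \<omega>) (L' u \<omega>) \<partial>P'.weighted K A)" .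
    qed
  qed (use eq in simp)
  show ?thesis using K A
  proof (induction K arbitrary: A rule: finite_linorder_max_induct)
    case empty
    show ?case
    proof (rule measure_eqI)
      fix C assume "C \<in> sets (P.law {} A (Max (insert 0 {})))"
      then have C: "C \<in> sets borel" by (simp add: P.law_def)
      have m: "Measurable.pred M (\<lambda>\<omega>. (X 0 \<omega>, L 0 \<omega>) \<in> C)" "Measurable.pred N (\<lambda>\<omega>. (X' 0 \<omega>, L' 0 \<omega>) \<in> C)"
        using P.pair_meas[of 0] P'.pair_meas[of 0] C by measurable
      have "emeasure M {\<omega>\<in>space M. (X 0 \<omega>, L 0 \<omega>) \<in> C} = (if (0, 0) \<in> C then 1 else 0)"
      proof -
        have "emeasure M {\<omega>\<in>space M. (X 0 \<omega>, L 0 \<omega>) \<in> C} = emeasure M {\<omega>\<in>space M. (0::real, 0::real) \<in> C}"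
          using m by (intro emeasure_eq_AE eventually_mono[OF P.start]) auto
        then show ?thesis by (auto simp: P.emeasure_space_1)
      qed
      moreover have "emeasure N {\<omega>\<in>space N. (X' 0 \<omega>, L' 0 \<omega>) \<in> C} = (if (0, 0) \<in> C then 1 else 0)"
      proof -
        have "emeasure N {\<omega>\<in>space N. (X' 0 \<omega>, L' 0 \<omega>) \<in> C} = emeasure N {\<omega>\<in>space N. (0::real, 0::real) \<in> C}"
          using m by (intro emeasure_eq_AE eventually_mono[OF P'.start]) auto
        then show ?thesis by (auto simp: P'.emeasure_space_1)
      qed
      ultimately show "emeasure (P.law {} A (Max (insert 0 {}))) C = emeasure (P'.law {} A (Max (insert 0 {}))) C"
        using C P.emeasure_law[of "{}" A 0 C] P'.emeasure_law[of "{}" A 0 C] by simp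
    qed (simp add: P.law_def P'.law_def)
  next
    case (insert b K)
    let ?m = "Max (insert 0 K)"
    have K0: "K \<subseteq> {0..}" and b0: "0 \<le> b" and Ab: "A b \<in> sets borel" and AK: "\<And>i. i \<in> K \<Longrightarrow> A i \<in> sets borel"
      using insert.prems by auto
    have Km: "K \<subseteq> {0..?m}" "0 \<le> ?m" "?m \<le> b" using insert.hyps K0 b0 by (auto simp: less_imp_le)
    have mb: "Max (insert 0 (insert b K)) = b"
      using insert.hyps b0 by (intro Max_eqI) (auto intro: less_imp_le)
    have law: "P.law K A b = P'.law K A b"
      by (rule advance[OF insert.hyps(1) Km AK insert.IH[OF K0 AK]])
    \<comment> \<open>The condition at the new time \<open>b\<close> concerns only the pair at time \<open>b\<close>.\<close>
    let ?S = "{p :: real \<times> real. fst p + snd p \<in> A b}"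
    have "(\<lambda>p::real \<times> real. fst p + snd p) \<in> borel_measurable borel"
      by (intro borel_measurable_continuous_onI continuous_intros)
    from measurable_sets[OF this Ab] have S: "?S \<in> sets borel" by (simp add: vimage_def)
    show ?case unfolding mb
    proof (rule measure_eqI)
      fix C assume "C \<in> sets (P.law (insert b K) A b)"
      then have C: "C \<in> sets borel" by (simp add: P.law_def)
      have i: "finite (insert b K)" "insert b K \<subseteq> {0..}" using insert by auto
      have "emeasure (P.law (insert b K) A b) C = emeasure (P.law K A b) (C \<inter> ?S)"
        by (simp only: P.emeasure_law[where A = A, OF i insert.prems(2) b0 C] P.emeasure_law[where A = A, OF insert.hyps(1) K0 AK b0 sets.Int[OF C S]])
           (intro arg_cong2[where f = emeasure] refl, auto)
      also have "\<dots> = emeasure (P'.law K A b) (C \<inter> ?S)" unfolding law ..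
      also have "\<dots> = emeasure (P'.law (insert b K) A b) C"
        by (simp only: P'.emeasure_law[where A = A, OF i insert.prems(2) b0 C] P'.emeasure_law[where A = A, OF insert.hyps(1) K0 AK b0 sets.Int[OF C S]])
           (intro arg_cong2[where f = emeasure] refl, auto)
      finally show "emeasure (P.law (insert b K) A b) C = emeasure (P'.law (insert b K) A b) C" .
    qed (simp add: P.law_def P'.law_def)
  qed
qed

text \<open>The sum process on \<open>[0,t]\<close> together with the final value of the second process, which is
  stored under the index \<open>-1\<close>.\<close>

definition observation :: "real \<Rightarrow> (real \<Rightarrow> 'a \<Rightarrow> real) \<Rightarrow> (real \<Rightarrow> 'a \<Rightarrow> real) \<Rightarrow> 'a \<Rightarrow> real \<Rightarrow> real" where
  "observation t X L \<omega> = (\<lambda>i\<in>insert (-1) {0..t}. if i = -1 then L t \<omega> else X i \<omega> + L i \<omega>)"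

lemma (in pitman_pair) observation_meas:
  assumes "0 \<le> t"
  shows "observation t X L \<in> M \<rightarrow>\<^sub>M PiM (insert (-1) {0..t}) (\<lambda>_. borel)"
proof -
  have "(\<lambda>\<omega>. \<lambda>i\<in>insert (-1) {0..t}. if i = -1 then L t \<omega> else X i \<omega> + L i \<omega>) \<in> M \<rightarrow>\<^sub>M PiM (insert (-1) {0..t}) (\<lambda>_. borel)"
  proof (rule measurable_restrict)
    fix i :: real assume "i \<in> insert (-1) {0..t}"
    then show "(\<lambda>\<omega>. if i = -1 then L t \<omega> else X i \<omega> + L i \<omega>) \<in> borel_measurable M"
      using assms X_meas L_meas by (cases "i = -1") auto
  qed
  then show ?thesis by (simp add: observation_def[abs_def])
qed

lemma (in pitman_pair) observation_cylinder:
  assumes t: "0 < t" and J: "finite J" "J \<subseteq> insert (-1) {0..t}" and A: "\<And>i. i \<in> J \<Longrightarrow> A i \<in> sets borel"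
  shows "emeasure (distr M (PiM (insert (-1) {0..t}) (\<lambda>_. borel)) (observation t X L)) (prod_emb (insert (-1) {0..t}) (\<lambda>_. borel) J (Pi\<^sub>E J A)) =
     emeasure (law (insert t (J \<inter> {0..t})) (\<lambda>i. if i \<in> J then A i else UNIV) t) {p. -1 \<in> J \<longrightarrow> snd p \<in> A (-1)}"
proof -
  let ?I = "insert (-1) {0..t}" and ?K = "insert t (J \<inter> {0..t})" and ?A = "\<lambda>i. if i \<in> J then A i else UNIV"
  have C: "{p :: real \<times> real. -1 \<in> J \<longrightarrow> snd p \<in> A (-1)} \<in> sets borel"
  proof (cases "-1 \<in> J")
    case True
    have "snd -` A (-1) \<inter> space (borel :: (real \<times> real) measure) \<in> sets borel"
      by (rule measurable_sets[OF _ A[OF True]]) (intro borel_measurable_continuous_onI continuous_intros)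
    then show ?thesis using True by (simp add: vimage_def)
  qed simp
  have "emeasure (distr M (PiM ?I (\<lambda>_. borel)) (observation t X L)) (prod_emb ?I (\<lambda>_. borel) J (Pi\<^sub>E J A)) =
      emeasure M (observation t X L -` prod_emb ?I (\<lambda>_. borel) J (Pi\<^sub>E J A) \<inter> space M)"
    using t J A by (intro emeasure_distr observation_meas sets_PiM_I) auto
  also have "observation t X L -` prod_emb ?I (\<lambda>_. borel) J (Pi\<^sub>E J A) \<inter> space M = {\<omega>\<in>space M. \<forall>i\<in>J. observation t X L \<omega> i \<in> A i}"
  proof -
    have "observation t X L \<omega> \<in> extensional ?I" for \<omega> by (simp add: observation_def)
    then show ?thesis by (auto simp: prod_emb_def PiE_iff)
  qed
  also have "\<dots> = {\<omega>\<in>space M. (\<forall>i\<in>?K. X i \<omega> + L i \<omega> \<in> ?A i) \<and> (X t \<omega>, L t \<omega>) \<in> {p. -1 \<in> J \<longrightarrow> snd p \<in> A (-1)}}"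
    using J(2) t by (auto simp: observation_def subset_eq split: if_splits)
  also have "emeasure M \<dots> = emeasure (law ?K ?A t) {p. -1 \<in> J \<longrightarrow> snd p \<in> A (-1)}"
    using J A t C by (intro emeasure_law[symmetric]) auto
  finally show ?thesis .
qed

lemma pitman_pair_observations:
  assumes P: "pitman_pair M X L" and P': "pitman_pair N X' L'" and t: "0 < t"
  shows "distr M (PiM (insert (-1) {0..t}) (\<lambda>_. borel)) (observation t X L) = distr N (PiM (insert (-1) {0..t}) (\<lambda>_. borel)) (observation t X' L')"
proof -
  interpret P: pitman_pair M X L by (rule P)
  interpret P': pitman_pair N X' L' by (rule P')
  show ?thesis
  proof (rule measure_eqI_PiM_infinite[where I = "insert (-1) {0..t}" and M = "\<lambda>_. borel"])
    fix A :: "real \<Rightarrow> real set" and J :: "real set" assume J: "finite J" "J \<subseteq> insert (-1) {0..t}" and A: "\<And>i. i \<in> J \<Longrightarrow> A i \<in> sets borel"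
    let ?K = "insert t (J \<inter> {0..t})" and ?A = "\<lambda>i. if i \<in> J then A i else UNIV"
    have m: "Max (insert 0 ?K) = t" using t J(1) by (intro Max_eqI) auto
    have "P.law ?K ?A (Max (insert 0 ?K)) = P'.law ?K ?A (Max (insert 0 ?K))"
      using t J A by (intro pitman_pair_laws[OF P P']) auto
    then have law: "P.law ?K ?A t = P'.law ?K ?A t" unfolding m .
    show "emeasure (distr M (PiM (insert (-1) {0..t}) (\<lambda>_. borel)) (observation t X L)) (prod_emb (insert (-1) {0..t}) (\<lambda>_. borel) J (Pi\<^sub>E J A)) =
       emeasure (distr N (PiM (insert (-1) {0..t}) (\<lambda>_. borel)) (observation t X' L')) (prod_emb (insert (-1) {0..t}) (\<lambda>_. borel) J (Pi\<^sub>E J A))"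
      using P.observation_cylinder[where A = A, OF t J A] P'.observation_cylinder[where A = A, OF t J A] law by simp
  next
    show "finite_measure (distr M (PiM (insert (-1) {0..t}) (\<lambda>_. borel)) (observation t X L))"
      using t by (intro P.finite_measure_distr P.observation_meas) auto
  qed auto
qed


section \<open>The two processes\<close>

lemma (in brownian_motion) B_integrable:
  assumes s: "0 \<le> s"
  shows "integrable M (B s)"
proof -
  have "integrable M (\<lambda>\<omega>. B s \<omega> - B 0 \<omega>)"
  proof (cases "s = 0")
    case False
    then have d: "distributed M lborel (\<lambda>\<omega>. B s \<omega> - B 0 \<omega>) (normal_density 0 (sqrt s))" using B_incr[of 0 s] s by simp
    have "integrable lborel (\<lambda>x. normal_density 0 (sqrt s) x * x)"
      using integrable_normal_moment[of "sqrt s" 0 1] False s by simp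
    then show ?thesis
      using distributed_integrable[OF d, of "\<lambda>x. x"] by simp
  qed simp
  then show ?thesis
    using s B_zero by (elim integrable_cong_AE_imp) (auto intro: B_meas elim!: eventually_mono)
qed

text \<open>The local time itself need not be measurable with respect to the past of \<open>B\<close>, which is not
  completed; the limit of the occupation integrals is, and it agrees with \<open>L\<close> outside a null set.\<close>

lemma (in bm_local_time) reflected_pair: "pitman_pair M (\<lambda>s \<omega>. \<bar>B s \<omega>\<bar>) (\<lambda>s \<omega>. max 0 (L s \<omega>))"
proof
  show "AE \<omega> in M. \<bar>B 0 \<omega>\<bar> = 0 \<and> max 0 (L 0 \<omega>) = 0"
    using AE_good AE_space by eventually_elim (auto simp: L_good(1) good_def)
  fix K :: "real set" and m u :: real and A :: "real \<Rightarrow> real set" and \<xi> k :: real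
  assume K: "finite K" "K \<subseteq> {0..m}" and m: "0 \<le> m" and mu: "m < u" and A: "\<And>i. i \<in> K \<Longrightarrow> A i \<in> sets borel" and k: "0 < k"
  let ?Lh = "\<lambda>i \<omega>. lim (\<lambda>n. occ (trapezoid (n + 2)) i \<omega>)"
  let ?E = "{\<omega>\<in>space M. \<forall>i\<in>K. \<bar>B i \<omega>\<bar> + max 0 (L i \<omega>) \<in> A i}"
  let ?H = "indicator {\<omega>\<in>space M. \<forall>i\<in>K. \<bar>B i \<omega>\<bar> + max 0 (?Lh i \<omega>) \<in> A i} :: 'a \<Rightarrow> real"
  have "{\<omega>\<in>space (history M B m). \<forall>i\<in>K. \<bar>B i \<omega>\<bar> + max 0 (?Lh i \<omega>) \<in> A i} \<in> sets (history M B m)"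
  proof (intro sets.sets_Collect_finite_All K(1))
    fix i assume i: "i \<in> K"
    have [measurable]: "B i \<in> borel_measurable (history M B m)" "A i \<in> sets borel"
      using i K A by (auto intro: measurable_history)
    have "occ (trapezoid n) i \<in> borel_measurable (history M B m)" for n
      using i K by (intro measurable_history_mono[OF trap.occ_adapted]) auto
    then have [measurable]: "?Lh i \<in> borel_measurable (history M B m)"
      by (intro borel_measurable_lim_metric) auto
    show "{\<omega>\<in>space (history M B m). \<bar>B i \<omega>\<bar> + max 0 (?Lh i \<omega>) \<in> A i} \<in> sets (history M B m)" by measurable
  qed
  then have H: "?H \<in> borel_measurable (history M B m)" by (simp add: space_history)
  have same: "AE \<omega> in M. ?H \<omega> * f \<omega> (L r \<omega>) = indicator ?E \<omega> * f \<omega> (max 0 (L r \<omega>))" if r: "0 \<le> r" for r and f :: "'a \<Rightarrow> real \<Rightarrow> real"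
    using AE_good AE_space
  proof eventually_elim
    case (elim \<omega>)
    have "?Lh i \<omega> = L i \<omega>" if "i \<in> K" for i
      using occ_tendsto_L[OF elim(2,1)] that K by (intro limI) auto
    then show ?case using L_good(2)[OF elim(2,1) r] elim by (simp add: indicator_def max_absorb2)
  qed
  have Hm: "?H \<in> borel_measurable M"
    using H sets_history_subset_events[of B M m, OF B_meas] by (auto simp: measurable_def)
  have Em: "indicator ?E \<in> borel_measurable M"
  proof (intro borel_measurable_indicator sets.sets_Collect_finite_All K(1))
    fix i assume "i \<in> K"
    then have [measurable]: "B i \<in> borel_measurable M" "L i \<in> borel_measurable M" "A i \<in> sets borel"
      using K A B_meas L_meas by auto
    show "{\<omega>\<in>space M. \<bar>B i \<omega>\<bar> + max 0 (L i \<omega>) \<in> A i} \<in> events" by measurable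
  qed
  have same_integral: "(\<integral>\<omega>. ?H \<omega> * pitman_fun \<xi> k \<bar>B r \<omega>\<bar> (L r \<omega>) \<partial>M) =
      (\<integral>\<omega>. indicator ?E \<omega> * pitman_fun \<xi> k \<bar>B r \<omega>\<bar> (max 0 (L r \<omega>)) \<partial>M)" if r: "0 \<le> r" for r
  proof (rule integral_cong_AE)
    note [measurable] = Hm Em B_meas[OF r] L_meas[OF r]
    show "(\<lambda>\<omega>. ?H \<omega> * pitman_fun \<xi> k \<bar>B r \<omega>\<bar> (L r \<omega>)) \<in> borel_measurable M" unfolding pitman_fun_def by measurable
    show "(\<lambda>\<omega>. indicator ?E \<omega> * pitman_fun \<xi> k \<bar>B r \<omega>\<bar> (max 0 (L r \<omega>))) \<in> borel_measurable M" unfolding pitman_fun_def by measurable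
  qed (rule same[OF r])
  have "0 \<le> u" using m mu by simp
  from pitman_martingale[OF m mu less_imp_le[OF k] H, of 1 \<xi>]
  show "(\<integral>\<omega>. indicator ?E \<omega> * pitman_fun \<xi> k \<bar>B u \<omega>\<bar> (max 0 (L u \<omega>)) \<partial>M) =
      exp (- \<xi>\<^sup>2 * (u - m) / 2) * (\<integral>\<omega>. indicator ?E \<omega> * pitman_fun \<xi> k \<bar>B m \<omega>\<bar> (max 0 (L m \<omega>)) \<partial>M)"
    unfolding same_integral[OF m] same_integral[OF \<open>0 \<le> u\<close>] by (simp add: indicator_def)
qed (use B_meas L_meas B_integrable in auto)

lemma (in brownian3) radial_pair: "pitman_pair N (\<lambda>s \<omega>. \<bar>W s \<omega> $ 1\<bar>) (\<lambda>s \<omega>. norm (W s \<omega>) - \<bar>W s \<omega> $ 1\<bar>)"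
proof
  show "AE \<omega> in N. \<bar>W 0 \<omega> $ 1\<bar> = 0 \<and> norm (W 0 \<omega>) - \<bar>W 0 \<omega> $ 1\<bar> = 0"
    using W_zero by eventually_elim simp
  fix s \<omega> show "0 \<le> norm (W s \<omega>) - \<bar>W s \<omega> $ 1\<bar>" using component_le_norm_cart[of "W s \<omega>" 1] by simp
next
  fix K :: "real set" and m u :: real and A :: "real \<Rightarrow> real set" and \<xi> k :: real
  assume "finite K" "K \<subseteq> {0..m}" "0 \<le> m" "m < u" "\<And>i. i \<in> K \<Longrightarrow> A i \<in> sets borel" "0 < k"
  then show "(\<integral>\<omega>. indicator {\<omega>\<in>space N. \<forall>i\<in>K. \<bar>W i \<omega> $ 1\<bar> + (norm (W i \<omega>) - \<bar>W i \<omega> $ 1\<bar>) \<in> A i} \<omega> *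
        pitman_fun \<xi> k \<bar>W u \<omega> $ 1\<bar> (norm (W u \<omega>) - \<bar>W u \<omega> $ 1\<bar>) \<partial>N) =
      exp (- \<xi>\<^sup>2 * (u - m) / 2) *
      (\<integral>\<omega>. indicator {\<omega>\<in>space N. \<forall>i\<in>K. \<bar>W i \<omega> $ 1\<bar> + (norm (W i \<omega>) - \<bar>W i \<omega> $ 1\<bar>) \<in> A i} \<omega> *
        pitman_fun \<xi> k \<bar>W m \<omega> $ 1\<bar> (norm (W m \<omega>) - \<bar>W m \<omega> $ 1\<bar>) \<partial>N)"
    using bessel_martingale[of K m A u k \<xi>] by (simp add: radial_event_def)
qed (use W_meas c.B_meas c.B_integrable in \<open>auto intro!: borel_measurable_diff borel_measurable_norm\<close>)

text \<open>The two-dimensional process as a function of the observed data. The infimum is taken over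
  countably many times and over absolute values in order to be measurable on the whole product
  space.\<close>

definition pitman_path :: "real \<Rightarrow> (real \<Rightarrow> real) \<Rightarrow> real \<Rightarrow> real \<times> real" where
  "pitman_path t x = (\<lambda>s\<in>{0..t}. (x s, x s - min (INF u\<in>rational_times s t. \<bar>x u\<bar>) (x (-1))))"

lemma pitman_path_meas:
  "pitman_path t \<in> PiM (insert (-1) {0..t}) (\<lambda>_. borel) \<rightarrow>\<^sub>M PiM {0..t} (\<lambda>_. borel)"
  unfolding pitman_path_def[abs_def]
proof (rule measurable_restrict)
  fix s :: real assume s: "s \<in> {0..t}"
  have c: "(\<lambda>x. x i) \<in> borel_measurable (PiM (insert (-1) {0..t}) (\<lambda>_. borel :: real measure))" if "i \<in> insert (-1) {0..t}" for i
    using that by (rule measurable_component_singleton)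
  have sub: "rational_times s t \<subseteq> {0..t}" using s by (auto simp: rational_times_def)
  have "(\<lambda>x. INF u\<in>rational_times s t. \<bar>x u\<bar>) \<in> borel_measurable (PiM (insert (-1) {0..t}) (\<lambda>_. borel :: real measure))"
    using c sub by (intro borel_measurable_cINF_real countable_rational_times borel_measurable_abs) auto
  with c[of s] c[of "-1"] s
  show "(\<lambda>x. (x s, x s - min (INF u\<in>rational_times s t. \<bar>x u\<bar>) (x (-1)))) \<in> borel_measurable (PiM (insert (-1) {0..t}) (\<lambda>_. borel :: real measure))"
    by (intro borel_measurable_Pair borel_measurable_diff borel_measurable_min) auto
qed

lemma pitman_path_observation:
  fixes X L :: "real \<Rightarrow> 'a \<Rightarrow> real"
  assumes t: "0 < t" and cont: "continuous_on {0..t} (\<lambda>s. X s \<omega> + L s \<omega>)"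
    and nn: "\<And>s. s \<in> {0..t} \<Longrightarrow> 0 \<le> X s \<omega> + L s \<omega>"
  shows "pitman_path t (observation t X L \<omega>) =
    (\<lambda>s\<in>{0..t}. (X s \<omega> + L s \<omega>, X s \<omega> + L s \<omega> - min (INF u\<in>{s..t}. X u \<omega> + L u \<omega>) (L t \<omega>)))"
  unfolding pitman_path_def
proof (rule restrict_ext)
  fix s assume s: "s \<in> {0..t}"
  have o: "observation t X L \<omega> u = X u \<omega> + L u \<omega>" if "u \<in> {0..t}" for u using that by (auto simp: observation_def)
  have sub: "rational_times s t \<subseteq> {0..t}" using s by (auto simp: rational_times_def)
  have "(INF u\<in>rational_times s t. \<bar>observation t X L \<omega> u\<bar>) = (INF u\<in>rational_times s t. \<bar>X u \<omega> + L u \<omega>\<bar>)"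
    using sub by (intro INF_cong refl) (auto simp: o)
  also have "\<dots> = (INF u\<in>{s..t}. X u \<omega> + L u \<omega>)"
    using s by (intro running_min_rational[symmetric] cont nn) auto
  finally show "(observation t X L \<omega> s, observation t X L \<omega> s - min (INF u\<in>rational_times s t. \<bar>observation t X L \<omega> u\<bar>) (observation t X L \<omega> (-1))) =
      (X s \<omega> + L s \<omega>, X s \<omega> + L s \<omega> - min (INF u\<in>{s..t}. X u \<omega> + L u \<omega>) (L t \<omega>))"
    using o[OF s] by (simp add: observation_def)
qed

lemma (in bm_local_time) reflected_path:
  assumes t: "0 < t"
  shows "AE \<omega> in M. path_map t (\<lambda>s \<omega>. (\<bar>B s \<omega>\<bar> + L s \<omega>, \<bar>B s \<omega>\<bar>)) \<omega> =
    pitman_path t (observation t (\<lambda>s \<omega>. \<bar>B s \<omega>\<bar>) (\<lambda>s \<omega>. max 0 (L s \<omega>)) \<omega>)"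
  using AE_good AE_space
proof eventually_elim
  case (elim \<omega>)
  note good = elim(2,1)
  have Lpos: "max 0 (L s \<omega>) = L s \<omega>" if "s \<in> {0..t}" for s using L_good(2)[OF good, of s] that by simp
  have cB: "continuous_on {0..t} (\<lambda>s. B s \<omega>)" and cL: "continuous_on {0..t} (\<lambda>s. L s \<omega>)"
    using B_cont[OF good(1)] L_cont[OF good(1)] by (auto elim: continuous_on_subset)
  have "pitman_path t (observation t (\<lambda>s \<omega>. \<bar>B s \<omega>\<bar>) (\<lambda>s \<omega>. max 0 (L s \<omega>)) \<omega>) =
     (\<lambda>s\<in>{0..t}. (\<bar>B s \<omega>\<bar> + max 0 (L s \<omega>), \<bar>B s \<omega>\<bar> + max 0 (L s \<omega>) - min (INF u\<in>{s..t}. \<bar>B u \<omega>\<bar> + max 0 (L u \<omega>)) (max 0 (L t \<omega>))))"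
    by (rule pitman_path_observation[OF t]) (auto intro!: continuous_intros cB cL)
  also have "\<dots> = (\<lambda>s\<in>{0..t}. (\<bar>B s \<omega>\<bar> + L s \<omega>, \<bar>B s \<omega>\<bar>))"
  proof (rule restrict_ext)
    fix s assume s: "s \<in> {0..t}"
    have "L s \<omega> = min (INF u\<in>{s..t}. \<bar>B u \<omega>\<bar> + L u \<omega>) (L t \<omega>)"
      using s by (intro growth_at_zeros_eq_future_min cB cL L_good(3)[OF good] L_good(4)[OF good]) (auto simp: L_good(1)[OF good])
    moreover have "(INF u\<in>{s..t}. \<bar>B u \<omega>\<bar> + max 0 (L u \<omega>)) = (INF u\<in>{s..t}. \<bar>B u \<omega>\<bar> + L u \<omega>)"
      using s by (intro INF_cong refl) (auto simp: Lpos)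
    ultimately show "(\<bar>B s \<omega>\<bar> + max 0 (L s \<omega>), \<bar>B s \<omega>\<bar> + max 0 (L s \<omega>) - min (INF u\<in>{s..t}. \<bar>B u \<omega>\<bar> + max 0 (L u \<omega>)) (max 0 (L t \<omega>))) = (\<bar>B s \<omega>\<bar> + L s \<omega>, \<bar>B s \<omega>\<bar>)"
      using Lpos[OF s] Lpos[of t] t by simp
  qed
  finally show ?case by (simp add: path_map_def)
qed

lemma (in brownian3) radial_path:
  assumes t: "0 < t" and w: "\<omega> \<in> space N"
  shows "path_map t (\<lambda>s \<omega>. (norm (W s \<omega>), norm (W s \<omega>) - min (INF u\<in>{s..t}. norm (W u \<omega>)) (norm (W t \<omega>) - \<bar>W t \<omega> $ 1\<bar>))) \<omega> =
    pitman_path t (observation t (\<lambda>s \<omega>. \<bar>W s \<omega> $ 1\<bar>) (\<lambda>s \<omega>. norm (W s \<omega>) - \<bar>W s \<omega> $ 1\<bar>) \<omega>)"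
proof -
  have c: "continuous_on {0..t} (\<lambda>s. norm (W s \<omega>))"
    using continuous_on_subset[OF W_cont[OF w], of "{0..t}"] by (intro continuous_on_norm) auto
  show ?thesis
    by (subst pitman_path_observation[OF t]) (use c in \<open>simp_all add: path_map_def\<close>)
qed

lemma (in brownian3) radial_continuous_meas:
  defines "Y \<equiv> \<lambda>t s \<omega>. (norm (W s \<omega>), norm (W s \<omega>) - min (INF u\<in>{s..t}. norm (W u \<omega>)) (norm (W t \<omega>) - \<bar>W t \<omega> $ 1\<bar>))"
  assumes t: "0 < t"
  shows "\<omega> \<in> space N \<Longrightarrow> continuous_on {0..t} (\<lambda>s. Y t s \<omega>)" and "s \<in> {0..t} \<Longrightarrow> Y t s \<in> borel_measurable N"
proof -
  interpret P: pitman_pair N "\<lambda>s \<omega>. \<bar>W s \<omega> $ 1\<bar>" "\<lambda>s \<omega>. norm (W s \<omega>) - \<bar>W s \<omega> $ 1\<bar>" by (rule radial_pair)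
  show "continuous_on {0..t} (\<lambda>s. Y t s \<omega>)" if w: "\<omega> \<in> space N"
  proof -
    have c: "continuous_on {0..t} (\<lambda>s. norm (W s \<omega>))"
      using continuous_on_subset[OF W_cont[OF w], of "{0..t}"] by (intro continuous_on_norm) auto
    have "continuous_on {0..t} (\<lambda>s. INF u\<in>{s..t}. norm (W u \<omega>))"
      using t by (intro running_min_continuous c) simp
    then show ?thesis unfolding Y_def
      by (intro continuous_on_Pair continuous_on_diff continuous_on_min c continuous_on_const)
  qed
  show "Y t s \<in> borel_measurable N" if s: "s \<in> {0..t}"
  proof -
    let ?o = "observation t (\<lambda>s \<omega>. \<bar>W s \<omega> $ 1\<bar>) (\<lambda>s \<omega>. norm (W s \<omega>) - \<bar>W s \<omega> $ 1\<bar>)"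
    have "(\<lambda>\<omega>. pitman_path t (?o \<omega>)) \<in> N \<rightarrow>\<^sub>M PiM {0..t} (\<lambda>_. borel)"
      using t by (intro measurable_compose[OF P.observation_meas pitman_path_meas]) simp
    from measurable_compose[OF this measurable_component_singleton[OF s]]
    have "(\<lambda>\<omega>. pitman_path t (?o \<omega>) s) \<in> borel_measurable N" .
    also have "?this \<longleftrightarrow> ?thesis"
    proof (rule measurable_cong)
      fix \<omega> assume "\<omega> \<in> space N"
      from radial_path[OF t this] have "pitman_path t (?o \<omega>) = path_map t (Y t) \<omega>" unfolding Y_def by simp
      then show "pitman_path t (?o \<omega>) s = Y t s \<omega>" using s by (simp add: path_map_def)
    qed
    finally show ?thesis .
  qed
qed

theorem theorem1p5:
  fixes t :: real
    and M :: "'a measure" and B L :: "real \<Rightarrow> 'a \<Rightarrow> real"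
    and N :: "'b measure" and W :: "real \<Rightarrow> 'b \<Rightarrow> real ^ 3"
  assumes "t > 0"
    and "standard_BM M B"
    and "local_time_at_0 M B L"
    and "standard_BM3 N W"
  shows "identical_in_law t
           M (\<lambda>s \<omega>. (\<bar>B s \<omega>\<bar> + L s \<omega>, \<bar>B s \<omega>\<bar>))
           N (\<lambda>s \<omega>. (norm (W s \<omega>),
                norm (W s \<omega>) - min (INF u\<in>{s..t}. norm (W u \<omega>)) (norm (W t \<omega>) - \<bar>W t \<omega> $ 1\<bar>)))"
proof -
  interpret b: bm_local_time M B L
    using assms by (simp add: bm_local_time_def bm_local_time_axioms_def brownian_motion_def)
  interpret w: brownian3 N W using assms by (simp add: brownian3_def)
  interpret P: pitman_pair M "\<lambda>s \<omega>. \<bar>B s \<omega>\<bar>" "\<lambda>s \<omega>. max 0 (L s \<omega>)" by (rule b.reflected_pair)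
  interpret P': pitman_pair N "\<lambda>s \<omega>. \<bar>W s \<omega> $ 1\<bar>" "\<lambda>s \<omega>. norm (W s \<omega>) - \<bar>W s \<omega> $ 1\<bar>" by (rule w.radial_pair)
  let ?X = "\<lambda>s \<omega>. (\<bar>B s \<omega>\<bar> + L s \<omega>, \<bar>B s \<omega>\<bar>)"
  let ?Y = "\<lambda>s \<omega>. (norm (W s \<omega>), norm (W s \<omega>) - min (INF u\<in>{s..t}. norm (W u \<omega>)) (norm (W t \<omega>) - \<bar>W t \<omega> $ 1\<bar>))"
  let ?o = "observation t (\<lambda>s \<omega>. \<bar>B s \<omega>\<bar>) (\<lambda>s \<omega>. max 0 (L s \<omega>))"
  let ?o' = "observation t (\<lambda>s \<omega>. \<bar>W s \<omega> $ 1\<bar>) (\<lambda>s \<omega>. norm (W s \<omega>) - \<bar>W s \<omega> $ 1\<bar>)"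
  let ?I = "PiM {0..t} (\<lambda>_. borel) :: (real \<Rightarrow> real \<times> real) measure"
  have X_meas: "?X s \<in> borel_measurable M" if "s \<in> {0..t}" for s
  proof -
    have "0 \<le> s" using that by simp
    note [measurable] = b.B_meas[OF this] b.L_meas[OF this]
    show ?thesis by measurable
  qed
  have X_cont: "continuous_on {0..t} (\<lambda>s. ?X s \<omega>)" if "\<omega> \<in> space M" for \<omega>
    using continuous_on_subset[OF b.B_cont[OF that], of "{0..t}"] continuous_on_subset[OF b.L_cont[OF that], of "{0..t}"]
    by (intro continuous_intros) auto
  have o: "?o \<in> M \<rightarrow>\<^sub>M PiM (insert (-1) {0..t}) (\<lambda>_. borel)" "?o' \<in> N \<rightarrow>\<^sub>M PiM (insert (-1) {0..t}) (\<lambda>_. borel)"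
    using P.observation_meas P'.observation_meas assms(1) by auto
  have "distr M ?I (path_map t ?X) = distr M ?I (pitman_path t \<circ> ?o)"
  proof (rule distr_cong_AE)
    show "AE \<omega> in M. path_map t ?X \<omega> = (pitman_path t \<circ> ?o) \<omega>" using b.reflected_path[OF assms(1)] by simp
    show "path_map t ?X \<in> M \<rightarrow>\<^sub>M ?I" unfolding path_map_def[abs_def] by (intro measurable_restrict X_meas)
    show "pitman_path t \<circ> ?o \<in> M \<rightarrow>\<^sub>M ?I" by (rule measurable_comp[OF o(1) pitman_path_meas])
  qed simp_all
  also have "\<dots> = distr (distr M (PiM (insert (-1) {0..t}) (\<lambda>_. borel)) ?o) ?I (pitman_path t)"
    by (rule distr_distr[OF pitman_path_meas o(1), symmetric])
  also have "\<dots> = distr (distr N (PiM (insert (-1) {0..t}) (\<lambda>_. borel)) ?o') ?I (pitman_path t)"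
    unfolding pitman_pair_observations[OF b.reflected_pair w.radial_pair assms(1)] ..
  also have "\<dots> = distr N ?I (pitman_path t \<circ> ?o')"
    by (rule distr_distr[OF pitman_path_meas o(2)])
  also have "\<dots> = distr N ?I (path_map t ?Y)"
    by (rule distr_cong) (simp_all add: w.radial_path[OF assms(1)])
  finally have "distr M ?I (path_map t ?X) = distr N ?I (path_map t ?Y)" .
  then show ?thesis
    using w.radial_continuous_meas[OF assms(1)]
    by (intro identical_in_lawI[OF assms(1) X_meas X_cont]) auto
qed

end
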